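(* Let $\mathfrak f = 3^2 p_1\cdots p_\nu$ ($\nu\ge 0$), where $p_1,\dots,p_\nu$ are distinct primes with $p_1\equiv\cdots\equiv p_\nu\equiv 1 \pmod 3$. Let $(M,N)\in\mathbb Z\times\mathbb Z$ satisfy $4\mathfrak f = M^2+27N^2$ with $M=3M_0$, $M_0\equiv 2\pmod 3$, $N\not\equiv 0\pmod 3$ and $N>0$. Put $n_1=(M-3N)/2$, $n_2=N$ and $n=n_1/n_2$. Then: (1) $n_1$ and $n_2$ are coprime integers. (2) $n_1^2+3n_1n_2+9n_2^2=\mathfrak f$. (3) $f_n(X)$ is irreducible over $\mathbb Q$ and the conductor of the cyclic cubic field $L_n=\mathbb Q(\rho_n)$ is $\mathfrak f$. (4) $n_2^3\,\mu(\mathfrak f/9)\, f_n(X) = P\!\left(\mu(\mathfrak f/9)\left(n_2X-\tfrac{n_1}{3}\right)\right)$, where $P(X)=(X-\eta_0)(X-\eta_1)(X-\eta_2)$ is the period polynomial whose roots are the Gaussian periods $\eta_0,\eta_1,\eta_2$ of $L_n$. (5) $\{\eta_0,\eta_1,\eta_2\} = \left\{\mu(\mathfrak f/9)\left(n_2\rho_n-\tfrac{n_1}{3}\right),\ \mu(\mathfrak f/9)\left(n_2\rho_n'-\tfrac{n_1}{3}\right),\ \mu(\mathfrak f/9)\left(n_2\rho_n''-\tfrac{n_1}{3}\right)\right\}$. Furthermore, every cyclic cubic field with conductor $\mathfrak f$ equals $L_n$ for $n=n_1/n_2$ arising in this way from some such pair $(M,N)$.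
   Context: For $n\in\mathbb Q$, Shanks' cubic polynomial is $f_n(X)=X^3-nX^2-(n+3)X-1\in\mathbb Q[X]$; $\rho_n$ denotes a root of $f_n(X)$ and $L_n=\mathbb Q(\rho_n)$. When $L_n$ is a cyclic cubic field with Galois group generated by $\sigma$, $\rho_n'=\sigma(\rho_n)$ and $\rho_n''=\sigma^2(\rho_n)$. For a cyclic cubic field $L$ of conductor $\mathfrak f$, with $\zeta_{\mathfrak f}=e^{2\pi i/\mathfrak f}$, the Gaussian periods are $\eta_0=\mathrm{Tr}_{\mathbb Q(\zeta_{\mathfrak f})/L}(\zeta_{\mathfrak f})$, $\eta_1=\sigma(\eta_0)$, $\eta_2=\sigma^2(\eta_0)$, where $\sigma$ generates $\mathrm{Gal}(L/\mathbb Q)$. $\mu$ is the Möbius function. *)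

theory Defs
  imports
    Complex_Main
    "HOL-Algebra.Bij"
    "HOL-Algebra.Elementary_Groups"
    "HOL-Algebra.Embedded_Algebras"
    "HOL-Algebra.Generated_Fields"
    "HOL-Algebra.Algebraic_Closure_Type"
    "HOL-Number_Theory.Cong"
    "HOL-Computational_Algebra.Computational_Algebra"
begin

text \<open>All number fields are subfields of the field of complex numbers, so equality of fields
  is equality of subsets of \<^typ>\<open>complex\<close>.\<close>

abbreviation complex_ring :: "complex ring" where
  "complex_ring \<equiv> ring_of_type_algebra"

abbreviation subfield_ring :: "complex set \<Rightarrow> complex ring" where
  "subfield_ring K \<equiv> complex_ring\<lparr>carrier := K\<rparr>"

definition rat_adjoin :: "complex \<Rightarrow> complex set" where
  "rat_adjoin x = generate_field complex_ring (insert x \<rat>)"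

text \<open>Galois groups, embeddings and traces are written with the large field first: the extension
  is \<open>K\<close> over its subfield \<open>F\<close>. Maps are extensional, i.e. \<open>undefined\<close> outside \<open>K\<close>, so that each
  homomorphism on \<open>K\<close> is represented by exactly one function.\<close>

definition galois_group :: "complex set \<Rightarrow> complex set \<Rightarrow> (complex \<Rightarrow> complex) monoid" where
  "galois_group K F = (BijGroup K)\<lparr>carrier :=
     {\<sigma> \<in> Bij K. \<sigma> \<in> ring_hom (subfield_ring K) (subfield_ring K) \<and> (\<forall>x\<in>F. \<sigma> x = x)}\<rparr>"

definition galois_extension :: "complex set \<Rightarrow> complex set \<Rightarrow> bool" where
  "galois_extension K F \<longleftrightarrow>
     subfield F complex_ring \<and> subfield K complex_ring \<and> F \<subseteq> K \<and>
     ring.finite_dimension complex_ring F K \<and>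
     {x \<in> K. \<forall>\<sigma> \<in> carrier (galois_group K F). \<sigma> x = x} = F"

definition cyclic_cubic_field :: "complex set \<Rightarrow> bool" where
  "cyclic_cubic_field L \<longleftrightarrow>
     galois_extension L \<rat> \<and> ring.dimension complex_ring 3 \<rat> L \<and> cyclic_group (galois_group L \<rat>)"

definition embeddings :: "complex set \<Rightarrow> complex set \<Rightarrow> (complex \<Rightarrow> complex) set" where
  "embeddings K F =
     {\<tau> \<in> extensional K. \<tau> \<in> ring_hom (subfield_ring K) complex_ring \<and> (\<forall>x\<in>F. \<tau> x = x)}"

text \<open>The trace of a finite extension of number fields, as the sum over the embeddings
  of \<open>K\<close> into the complex numbers that fix \<open>F\<close>; for Galois extensions this is the sum over the
  Galois group.\<close>

definition field_trace :: "complex set \<Rightarrow> complex set \<Rightarrow> complex \<Rightarrow> complex" where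
  "field_trace K F x = (\<Sum>\<tau>\<in>embeddings K F. \<tau> x)"

definition zeta :: "nat \<Rightarrow> complex" where
  "zeta m = exp (2 * of_real pi * \<i> / of_nat m)"

definition is_conductor :: "complex set \<Rightarrow> nat \<Rightarrow> bool" where
  "is_conductor L f \<longleftrightarrow> f > 0 \<and> L \<subseteq> rat_adjoin (zeta f) \<and>
     (\<forall>m>0. L \<subseteq> rat_adjoin (zeta m) \<longrightarrow> f \<le> m)"

definition gaussian_period :: "nat \<Rightarrow> complex set \<Rightarrow> complex" where
  "gaussian_period f L = field_trace (rat_adjoin (zeta f)) L (zeta f)"

definition moebius_mu :: "nat \<Rightarrow> int" where
  "moebius_mu m = (if squarefree m then (- 1) ^ card (prime_factors m) else 0)"

definition shanks_poly :: "rat \<Rightarrow> rat poly" where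
  "shanks_poly n = [:- 1, - (n + 3), - n, 1:]"

definition admissible_pair :: "nat \<Rightarrow> int \<Rightarrow> int \<Rightarrow> bool" where
  "admissible_pair f M N \<longleftrightarrow>
     4 * int f = M\<^sup>2 + 27 * N\<^sup>2 \<and>
     (\<exists>M0. M = 3 * M0 \<and> [M0 = 2] (mod 3)) \<and>
     \<not> [N = 0] (mod 3) \<and> N > 0"

end

(* Write J for the Jacobi sum of a primitive cubic character chi modulo f and G for its Gauss sum.
   Since G^2 = J * conj G and |G|^2 = f, the sum eta of zeta_f^a over the kernel of chi satisfies
   27 eta^3 = f (J + conj J) + 9 f eta, an equation which the substitution
   X -> mu (n2 X - n1/3) turns into the Shanks polynomial as soon as mu (J + conj J) = M.
   Jacobi sums are multiplicative in the modulus, equal to -1 modulo 3 at the primes p_i and to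
   3 omega or 3 omega^2 at 9, so each chi yields an admissible pair; conversely, factoring
   (M + 3 N sqrt(-3))/2 in the Eisenstein integers one prime at a time shows that each admissible
   pair comes from some chi.  Irreducibility of the cyclotomic polynomials gives the Galois action
   on Q(zeta_f), under which primitive cubic characters correspond to the cyclic cubic
   subfields of conductor f, and the kernel sum eta becomes the trace of zeta_f. *)

theory Submission
  imports Defs "HOL-Number_Theory.Residue_Primitive_Roots"
begin

section \<open>Cubic characters, Gauss sums and Jacobi sums\<close>

text \<open>No Galois correspondence is invoked. The automorphisms of Q(zeta_f) are explicit
  substitutions (\<open>conj_map\<close>), an element is descended from modulus n to n/q by
  averaging over conjugates, and two elements fixed by the same kernel are compared by Lagrange
  interpolation. Because 9 divides f, the primitive f-th roots of unity sum to 0. Hence 3 eta = G +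
  conj G without a constant term, and the cubic of eta has no quadratic term; the shift by n1/3 is
  what removes the quadratic term on the Shanks side. The sign mu collects one residue -1 modulo 3
  per prime p_i. It makes mu J / 3 congruent to omega or omega^2 modulo 3, and the congruences
  imposed on M0 and N express exactly this. The choice N > 0 forgets complex conjugation, which
  exchanges chi with its conjugate and so preserves the kernel and the field. The same congruences,
  read modulo 9, exclude a rational root of the cubic, which gives irreducibility and shows that the
  three periods are distinct.\<close>

definition cubic_char :: "nat \<Rightarrow> (int \<Rightarrow> complex) \<Rightarrow> bool" where
  "cubic_char n \<chi> \<longleftrightarrow>
     (\<forall>a b. \<chi> (a * b) = \<chi> a * \<chi> b) \<and>
     (\<forall>a b. [a = b] (mod int n) \<longrightarrow> \<chi> a = \<chi> b) \<and>
     (\<forall>a. coprime a (int n) \<longrightarrow> \<chi> a ^ 3 = 1) \<and>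
     (\<forall>a. \<not> coprime a (int n) \<longrightarrow> \<chi> a = 0)"

text \<open>A character coming from a proper divisor of \<open>n\<close> comes from some
  \<open>n div q\<close> with \<open>q\<close> prime, so nontriviality is tested only on units that
  are 1 modulo such a maximal proper divisor.\<close>

definition primitive_char :: "nat \<Rightarrow> (int \<Rightarrow> complex) \<Rightarrow> bool" where
  "primitive_char n \<chi> \<longleftrightarrow> cubic_char n \<chi> \<and>
     (\<forall>q. prime q \<and> q dvd n \<longrightarrow>
        (\<exists>a. [a = 1] (mod int (n div q)) \<and> coprime a (int n) \<and> \<chi> a \<noteq> 1))"

definition gauss_sum :: "nat \<Rightarrow> (int \<Rightarrow> complex) \<Rightarrow> complex" where
  "gauss_sum n \<chi> = (\<Sum>a\<in>{0..<int n}. \<chi> a * zeta n powi a)"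

definition jacobi_sum :: "nat \<Rightarrow> (int \<Rightarrow> complex) \<Rightarrow> complex" where
  "jacobi_sum n \<chi> = (\<Sum>a\<in>{0..<int n}. \<chi> a * \<chi> (1 - a))"

section \<open>Powers of \<open>zeta n\<close> and sums over complete residue systems\<close>

lemma zeta_nonzero [simp]: "zeta n \<noteq> 0"
  by (simp add: zeta_def)

lemma zeta_powi: "zeta n powi a = cis (2 * pi * of_int a / of_nat n)"
  unfolding zeta_def
  by (simp add: exp_of_real[symmetric] cis_conv_exp exp_power_int mult_ac)

lemma zeta_powi_eq_1_iff:
  assumes "n > 0"
  shows "zeta n powi a = 1 \<longleftrightarrow> int n dvd a"
proof -
  have "zeta n powi a = 1 \<longleftrightarrow> (\<exists>k::int. 2 * pi * of_int a / of_nat n = of_int k * 2 * pi)"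
    proof
    assume "zeta n powi a = 1"
    then have "cos (2 * pi * of_int a / of_nat n) = 1"
      unfolding zeta_powi by (simp add: complex_eq_iff)
    then show "\<exists>k::int. 2 * pi * of_int a / of_nat n = of_int k * 2 * pi"
      by (simp only: cos_one_2pi_int)
  next
    assume "\<exists>k::int. 2 * pi * of_int a / of_nat n = of_int k * 2 * pi"
    then show "zeta n powi a = 1"
      unfolding zeta_powi using cis_multiple_2pi[OF Ints_of_int] by (auto simp: mult_ac)
  qed
  also have "\<dots> \<longleftrightarrow> (\<exists>k::int. a = k * int n)"
  proof (rule ex_cong1)
    fix k
    have "2 * pi * of_int a / of_nat n = of_int k * 2 * pi \<longleftrightarrow> real_of_int a = real_of_int k * real n"
      using assms by (auto simp: field_simps)
    also have "\<dots> \<longleftrightarrow> a = k * int n"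
      by (metis of_int_eq_iff of_int_mult of_int_of_nat_eq)
    finally show "(2 * pi * of_int a / of_nat n = of_int k * 2 * pi) = (a = k * int n)" .
  qed
  finally show ?thesis by (auto simp: dvd_def mult.commute)
qed

lemma zeta_powi_cong_iff:
  assumes "n > 0"
  shows "zeta n powi a = zeta n powi b \<longleftrightarrow> [a = b] (mod int n)"
proof -
  have "zeta n powi a = zeta n powi b \<longleftrightarrow> zeta n powi (a - b) = 1"
    by (simp add: power_int_diff field_simps)
  then show ?thesis
    using zeta_powi_eq_1_iff[OF assms] by (simp add: cong_iff_dvd_diff)
qed

lemma zeta_powi_cong: "[a = b] (mod int n) \<Longrightarrow> zeta n powi a = zeta n powi b"
  by (cases "n = 0") (auto simp: zeta_powi_cong_iff cong_def)

lemma zeta_power_eq_1 [simp]: "zeta n ^ n = 1"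
  using zeta_powi_eq_1_iff[of n "int n"] by (cases "n = 0") auto

lemma cnj_zeta_powi: "cnj (zeta n) powi a = zeta n powi (- a)"
proof -
  have "cnj (zeta n powi a) = zeta n powi (- a)"
    by (simp only: zeta_powi cis_cnj) simp
  then show ?thesis by simp
qed

lemma zeta_mult: "n > 0 \<Longrightarrow> m > 0 \<Longrightarrow> zeta (n * m) ^ m = zeta n"
  using zeta_powi[of "n*m" "int m"] zeta_powi[of n 1] by simp

text \<open>A self-map of a finite residue system that is injective modulo \<open>n\<close> permutes
  it, so substitutions in sums need only be injective.\<close>

lemma sum_residues_reindex:
  fixes h :: "int \<Rightarrow> 'a::comm_monoid_add" and n :: nat
  assumes n: "n > 0" and h: "\<And>a b. [a = b] (mod int n) \<Longrightarrow> h a = h b"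
    and T: "\<And>a b. [T a = T b] (mod int n) \<Longrightarrow> [a = b] (mod int n)"
  shows "(\<Sum>a\<in>{0..<int n}. h (T a)) = (\<Sum>a\<in>{0..<int n}. h a)"
proof -
  have inj: "inj_on (\<lambda>a. T a mod int n) {0..<int n}"
  proof (rule inj_onI)
    fix x y assume "x \<in> {0..<int n}" "y \<in> {0..<int n}" "T x mod int n = T y mod int n"
    then show "x = y" using T[of x y] by (auto simp: cong_def)
  qed
  have "(\<lambda>a. T a mod int n) ` {0..<int n} = {0..<int n}"
    by (rule endo_inj_surj) (use inj n in auto)
  then have "(\<Sum>a\<in>{0..<int n}. h a) = (\<Sum>a\<in>{0..<int n}. h (T a mod int n))"
    using sum.reindex[OF inj, of h] by simp
  also have "\<dots> = (\<Sum>a\<in>{0..<int n}. h (T a))"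
    by (rule sum.cong) (auto intro!: h simp: cong_def)
  finally show ?thesis by simp
qed

lemma sum_residues_mult:
  fixes h :: "int \<Rightarrow> 'a::comm_monoid_add" and n :: nat
  assumes n: "n > 0" and h: "\<And>a b. [a = b] (mod int n) \<Longrightarrow> h a = h b" and "coprime c (int n)"
  shows "(\<Sum>a\<in>{0..<int n}. h (c * a)) = (\<Sum>a\<in>{0..<int n}. h a)"
  by (rule sum_residues_reindex) (use assms in \<open>auto simp: cong_mult_lcancel\<close>)

text \<open>By the Chinese remainder theorem the pair of reductions is a bijection onto the product
  of the two residue systems.\<close>

lemma sum_residues_product:
  fixes F G :: "int \<Rightarrow> 'a::comm_semiring_0" and d e :: nat
  assumes de: "d > 0" "e > 0" "coprime d e"
    and F: "\<And>a b. [a = b] (mod int d) \<Longrightarrow> F a = F b"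
    and G: "\<And>a b. [a = b] (mod int e) \<Longrightarrow> G a = G b"
  shows "(\<Sum>a\<in>{0..<int (d * e)}. F a * G a)
    = (\<Sum>a\<in>{0..<int d}. F a) * (\<Sum>a\<in>{0..<int e}. G a)"
proof -
  let ?T = "\<lambda>a. (a mod int d, a mod int e)"
  have inj: "inj_on ?T {0..<int (d * e)}"
  proof (rule inj_onI)
    fix x y assume xy: "x \<in> {0..<int (d * e)}" "y \<in> {0..<int (d * e)}" "?T x = ?T y"
    then have "[x = y] (mod int d)" "[x = y] (mod int e)" by (auto simp: cong_def)
    then have "[x = y] (mod (int d * int e))"
      using de by (intro coprime_cong_mult) auto
    then show "x = y" using xy by (simp add: cong_def)
  qed
  have "?T ` {0..<int (d * e)} = {0..<int d} \<times> {0..<int e}"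
    by (rule card_subset_eq) (use de card_image[OF inj] in \<open>auto simp: card_cartesian_product nat_mult_distrib\<close>)
  with inj have bij: "bij_betw ?T {0..<int (d * e)} ({0..<int d} \<times> {0..<int e})"
    by (simp add: bij_betw_def)
  have "(\<Sum>a\<in>{0..<int d}. F a) * (\<Sum>a\<in>{0..<int e}. G a)
    = (\<Sum>z\<in>{0..<int d} \<times> {0..<int e}. F (fst z) * G (snd z))"
    by (simp add: sum_product sum.cartesian_product case_prod_unfold)
  also have "\<dots> = (\<Sum>a\<in>{0..<int (d * e)}. F (fst (?T a)) * G (snd (?T a)))"
    by (rule sum.reindex_bij_betw[OF bij, symmetric])
  also have "\<dots> = (\<Sum>a\<in>{0..<int (d * e)}. F a * G a)"
    by (intro sum.cong refl arg_cong2[of _ _ _ _ "(*)"]) (auto intro: F G)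
  finally show ?thesis by simp
qed

lemma sum_zeta_powi:
  assumes "n > 0"
  shows "(\<Sum>a\<in>{0..<int n}. zeta n powi (a * b)) = (if int n dvd b then of_nat n else 0)"
proof (cases "int n dvd b")
  case True
  then have "zeta n powi (a * b) = 1" for a
    using zeta_powi_eq_1_iff[OF assms] by simp
  then show ?thesis using True by simp
next
  case False
  let ?S = "\<Sum>a\<in>{0..<int n}. zeta n powi (a * b)"
  \<comment> \<open>Shifting the index multiplies the sum by \<open>zeta n powi b\<close>, which
    differs from 1 in this case.\<close>
  have "?S = (\<Sum>a\<in>{0..<int n}. zeta n powi ((a + 1) * b))"
    by (rule sum_residues_reindex[where T = "\<lambda>a. a + 1" and h = "\<lambda>a. zeta n powi (a * b)", symmetric])
      (use assms in \<open>auto simp: cong_add_rcancel intro!: zeta_powi_cong cong_mult\<close>)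
  also have "\<dots> = zeta n powi b * ?S"
    by (simp add: sum_distrib_left distrib_right power_int_add mult.commute[of "zeta n powi b"])
  finally have "(1 - zeta n powi b) * ?S = 0" by (simp add: algebra_simps)
  then show ?thesis using False zeta_powi_eq_1_iff[OF assms, of b] by auto
qed

section \<open>Values of a single cubic character\<close>

context
  fixes n :: nat and \<chi> :: "int \<Rightarrow> complex"
  assumes n: "n > 0" and \<chi>: "cubic_char n \<chi>"
begin

lemma cubic_char_mult: "\<chi> (a * b) = \<chi> a * \<chi> b"
  and cubic_char_cong: "[a = b] (mod int n) \<Longrightarrow> \<chi> a = \<chi> b"
  and cubic_char_cube: "coprime a (int n) \<Longrightarrow> \<chi> a ^ 3 = 1"
  and cubic_char_zero: "\<not> coprime a (int n) \<Longrightarrow> \<chi> a = 0"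
  using \<chi> unfolding cubic_char_def by blast+

lemma cubic_char_nonzero: "coprime a (int n) \<Longrightarrow> \<chi> a \<noteq> 0"
  using cubic_char_cube[of a] by auto

lemma cubic_char_one: "\<chi> 1 = 1"
  using cubic_char_mult[of 1 1] cubic_char_nonzero[of 1] by simp

text \<open>\<open>\<chi> (- 1)\<close> has both square and cube 1. Evenness lets complex
  conjugation of a Gauss sum produce no sign.\<close>

lemma cubic_char_minus: "\<chi> (- a) = \<chi> a"
proof -
  have "\<chi> (- 1) ^ 2 = 1"
    using cubic_char_mult[of "-1" "-1"] cubic_char_one by (simp add: power2_eq_square)
  moreover have "\<chi> (- 1) ^ 3 = 1" by (rule cubic_char_cube) simp
  ultimately have "\<chi> (- 1) = 1" by (simp add: power3_eq_cube power2_eq_square mult.assoc)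
  then show ?thesis using cubic_char_mult[of "-1" a] by simp
qed

lemma cubic_char_norm: "coprime a (int n) \<Longrightarrow> norm (\<chi> a) = 1"
  using cubic_char_cube[of a] power_eq_imp_eq_base[of "norm (\<chi> a)" 3 1]
  by (simp flip: norm_power)

lemma cubic_char_cnj: "cnj (\<chi> a) = \<chi> a ^ 2"
proof (cases "coprime a (int n)")
  case True
  have "\<chi> a * cnj (\<chi> a) = 1"
    using cubic_char_norm[OF True] by (simp add: complex_norm_square[symmetric])
  also have "\<dots> = \<chi> a * \<chi> a ^ 2"
    using cubic_char_cube[OF True] by (simp add: power3_eq_cube power2_eq_square mult.assoc)
  finally show ?thesis using cubic_char_nonzero[OF True] by simp
next
  case False
  then show ?thesis using cubic_char_zero by simp
qed

lemma cubic_char_cnj_char: "cubic_char n (\<lambda>a. cnj (\<chi> a))"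
  unfolding cubic_char_def using cubic_char_mult cubic_char_cong cubic_char_cube cubic_char_zero
  by (auto simp flip: complex_cnj_power)

lemma cubic_char_cnj_mult: "coprime a (int n) \<Longrightarrow> \<chi> a * cnj (\<chi> a) = 1"
  using cubic_char_cube[of a] by (simp add: cubic_char_cnj power3_eq_cube power2_eq_square mult.assoc)

end

section \<open>Gauss sums of primitive characters and their relation to Jacobi sums\<close>

lemma primitive_cubic: "primitive_char n \<chi> \<Longrightarrow> cubic_char n \<chi>"
  by (simp add: primitive_char_def)

lemma primitive_char_cnj:
  assumes "n > 0" "primitive_char n \<chi>"
  shows "primitive_char n (\<lambda>a. cnj (\<chi> a))"
  using assms(2) cubic_char_cnj_char[OF assms(1) primitive_cubic[OF assms(2)]]
  unfolding primitive_char_def by simp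

lemma jacobi_sum_cnj: "jacobi_sum n (\<lambda>a. cnj (\<chi> a)) = cnj (jacobi_sum n \<chi>)"
  by (simp add: jacobi_sum_def)

text \<open>The case of non-invertible \<open>b\<close> is where primitivity is needed.\<close>

lemma gauss_sum_separable:
  assumes n: "n > 0" and \<chi>: "primitive_char n \<chi>"
  shows "(\<Sum>a\<in>{0..<int n}. \<chi> a * zeta n powi (a * b)) = cnj (\<chi> b) * gauss_sum n \<chi>"
proof -
  note C = n primitive_cubic[OF \<chi>]
  let ?S = "\<lambda>b. \<Sum>a\<in>{0..<int n}. \<chi> a * zeta n powi (a * b)"
  have scale: "?S b = \<chi> c * ?S (c * b)" if "coprime c (int n)" for b c
  proof -
    have "?S b = (\<Sum>a\<in>{0..<int n}. \<chi> (c * a) * zeta n powi (c * a * b))"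
      by (rule sum_residues_mult[where h = "\<lambda>a. \<chi> a * zeta n powi (a * b)", symmetric])
        (use n that in \<open>auto intro!: arg_cong2[of _ _ _ _ "(*)"] zeta_powi_cong cong_mult cubic_char_cong[OF C]\<close>)
    then show ?thesis by (simp add: cubic_char_mult[OF C] sum_distrib_left mult_ac)
  qed
  show ?thesis
  proof (cases "coprime b (int n)")
    case True
    have "gauss_sum n \<chi> = ?S 1" by (simp add: gauss_sum_def)
    also have "\<dots> = \<chi> b * ?S (b * 1)" by (rule scale[OF True])
    finally have G: "gauss_sum n \<chi> = \<chi> b * ?S b" by simp
    have "cnj (\<chi> b) * (\<chi> b * ?S b) = (\<chi> b * cnj (\<chi> b)) * ?S b" by (simp only: mult_ac)
    then show ?thesis
      using cubic_char_cnj_mult[OF C True] by (simp only: G mult_1)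
  next
    case False
    then have "gcd b (int n) \<noteq> 1" "gcd b (int n) \<noteq> 0" using n by auto
    then obtain q :: int where q: "prime q" "q dvd b" "q dvd int n"
      using prime_divisor_exists[of "gcd b (int n)"] by auto
    define r where "r = nat q"
    have "q = int r" using q(1) prime_ge_0_int by (simp add: r_def)
    then have r: "prime r" "r dvd n" "q = int r" using q by simp_all
    then obtain c where c: "[c = 1] (mod int (n div r))" "coprime c (int n)" "\<chi> c \<noteq> 1"
      using \<chi> unfolding primitive_char_def by blast
    \<comment> \<open>\<open>n div r\<close> divides \<open>c - 1\<close> and \<open>r\<close>
      divides \<open>b\<close>, so \<open>c * b\<close> is \<open>b\<close> modulo \<open>n\<close>.
      Scaling by \<open>c\<close> thus multiplies the sum by \<open>\<chi> c\<close>, which is not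
      1, and also leaves it unchanged.\<close>
    have "int (n div r) * q = int n"
      using r by (simp flip: of_nat_mult)
    then have "int n dvd (c - 1) * b"
      using c(1) q(2) mult_dvd_mono[of "int (n div r)" "c - 1" q b]
      by (simp add: cong_iff_dvd_diff)
    then have "[c * b = b] (mod int n)" by (simp add: cong_iff_dvd_diff algebra_simps)
    then have "?S (c * b) = ?S b"
      by (intro sum.cong refl arg_cong2[of _ _ _ _ "(*)"] zeta_powi_cong cong_mult) auto
    with scale[OF c(2), of b] c(3) have "?S b = 0" by simp
    then show ?thesis using cubic_char_zero[OF C False] by simp
  qed
qed

text \<open>The sum of the squared norms of the twisted sums over all \<open>b\<close> is evaluated
  twice: by orthogonality of the exponentials, and by separability. Both give a multiple of the
  number of units.\<close>

lemma gauss_sum_norm: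
  assumes n: "n > 0" and \<chi>: "primitive_char n \<chi>"
  shows "gauss_sum n \<chi> * cnj (gauss_sum n \<chi>) = of_nat n"
proof -
  note C = n primitive_cubic[OF \<chi>]
  let ?I = "{0..<int n}" and ?G = "gauss_sum n \<chi>"
  let ?S = "\<lambda>b. \<Sum>a\<in>?I. \<chi> a * zeta n powi (a * b)"
  let ?\<phi> = "\<Sum>b\<in>?I. \<chi> b * cnj (\<chi> b)"
  have "(\<Sum>b\<in>?I. ?S b * cnj (?S b))
    = (\<Sum>b\<in>?I. \<Sum>a\<in>?I. \<Sum>c\<in>?I. \<chi> a * cnj (\<chi> c) * zeta n powi (b * (a - c)))"
  proof (intro sum.cong refl)
    fix b
    have "\<chi> a * zeta n powi (a * b) * cnj (\<chi> c * zeta n powi (c * b))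
      = \<chi> a * cnj (\<chi> c) * zeta n powi (b * (a - c))" for a c
    proof -
      have "zeta n powi (b * (a - c)) = zeta n powi (a * b) * zeta n powi (- (c * b))"
        by (subst power_int_add[symmetric]) (auto simp: algebra_simps)
      then show ?thesis
        by (simp only: complex_cnj_mult complex_cnj_power_int cnj_zeta_powi mult_ac)
    qed
    then show "?S b * cnj (?S b) = (\<Sum>a\<in>?I. \<Sum>c\<in>?I. \<chi> a * cnj (\<chi> c) * zeta n powi (b * (a - c)))"
      by (simp only: sum_product cnj_sum)
  qed
  also have "\<dots> = (\<Sum>a\<in>?I. \<Sum>c\<in>?I. \<Sum>b\<in>?I. \<chi> a * cnj (\<chi> c) * zeta n powi (b * (a - c)))"
    by (subst sum.swap, rule sum.cong[OF refl], rule sum.swap)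
  also have "\<dots> = (\<Sum>a\<in>?I. \<Sum>c\<in>?I. if c = a then \<chi> a * cnj (\<chi> c) * of_nat n else 0)"
  proof (intro sum.cong refl)
    fix a c assume ac: "a \<in> ?I" "c \<in> ?I"
    have "int n dvd a - c \<longleftrightarrow> c = a"
      using ac by (auto simp: mod_eq_dvd_iff[symmetric])
    then show "(\<Sum>b\<in>?I. \<chi> a * cnj (\<chi> c) * zeta n powi (b * (a - c)))
      = (if c = a then \<chi> a * cnj (\<chi> c) * of_nat n else 0)"
      by (simp add: sum_distrib_left[symmetric] sum_zeta_powi[OF n])
  qed
  also have "\<dots> = of_nat n * ?\<phi>"
    by (simp add: sum_distrib_left mult_ac)
  finally have "(\<Sum>b\<in>?I. ?S b * cnj (?S b)) = of_nat n * ?\<phi>" .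
  moreover have "(\<Sum>b\<in>?I. ?S b * cnj (?S b)) = ?G * cnj ?G * ?\<phi>"
    unfolding gauss_sum_separable[OF n \<chi>] by (simp add: sum_distrib_left mult_ac)
  moreover have "?\<phi> \<noteq> 0"
  proof -
    have "?\<phi> = of_real (\<Sum>b\<in>?I. (norm (\<chi> b))\<^sup>2)"
      by (simp only: of_real_sum complex_norm_square)
    moreover have "(\<Sum>b\<in>?I. (norm (\<chi> b))\<^sup>2) \<ge> (norm (\<chi> (1 mod int n)))\<^sup>2"
      by (rule member_le_sum) (use n in auto)
    moreover have "\<chi> (1 mod int n) = 1"
      using cubic_char_cong[OF C, of "1 mod int n" 1] cubic_char_one[OF C] by simp
    ultimately have "?\<phi> = of_real (\<Sum>b\<in>?I. (norm (\<chi> b))\<^sup>2)" "(\<Sum>b\<in>?I. (norm (\<chi> b))\<^sup>2) \<ge> 1"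
      by auto
    then show ?thesis by (metis of_real_eq_0_iff not_one_le_zero)
  qed
  ultimately show ?thesis by auto
qed

lemma gauss_sum_cnj:
  assumes n: "n > 0" and \<chi>: "cubic_char n \<chi>"
  shows "cnj (gauss_sum n \<chi>) = gauss_sum n (\<lambda>a. cnj (\<chi> a))"
proof -
  note C = n \<chi>
  have "cnj (gauss_sum n \<chi>) = (\<Sum>a\<in>{0..<int n}. cnj (\<chi> (- 1 * a)) * zeta n powi (- 1 * a))"
    by (simp add: gauss_sum_def cnj_zeta_powi cubic_char_minus[OF C])
  also have "\<dots> = (\<Sum>a\<in>{0..<int n}. cnj (\<chi> a) * zeta n powi a)"
    by (rule sum_residues_mult[where h = "\<lambda>a. cnj (\<chi> a) * zeta n powi a"])
      (use n in \<open>auto intro!: arg_cong2[of _ _ _ _ "(*)"] zeta_powi_cong cubic_char_cong[OF C]\<close>)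
  finally show ?thesis by (simp add: gauss_sum_def)
qed

text \<open>Separability for the conjugate character rewrites \<open>\<chi> (1 - x)\<close> times
  the conjugate Gauss sum as an exponential sum, also when \<open>1 - x\<close> is no unit. After
  exchanging the sums, separability for \<open>\<chi>\<close> applies, and the square of the
  conjugate of \<open>\<chi>\<close> is \<open>\<chi>\<close> again.\<close>

lemma gauss_sum_square:
  assumes n: "n > 0" and \<chi>: "primitive_char n \<chi>"
  shows "gauss_sum n \<chi> ^ 2 = jacobi_sum n \<chi> * cnj (gauss_sum n \<chi>)"
proof -
  note C = n primitive_cubic[OF \<chi>]
  let ?I = "{0..<int n}" and ?G = "gauss_sum n \<chi>"
  note cnjG = gauss_sum_cnj[OF C]
  have sep: "(\<Sum>a\<in>?I. cnj (\<chi> a) * zeta n powi (a * b)) = \<chi> b * cnj ?G" for b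
    using gauss_sum_separable[OF n primitive_char_cnj[OF n \<chi>], of b] cnjG by simp
  have "jacobi_sum n \<chi> * cnj ?G = (\<Sum>x\<in>?I. \<chi> x * (\<Sum>a\<in>?I. cnj (\<chi> a) * zeta n powi (a * (1 - x))))"
    by (simp add: jacobi_sum_def sep sum_distrib_left mult_ac)
  also have "\<dots> = (\<Sum>x\<in>?I. \<Sum>a\<in>?I. cnj (\<chi> a) * zeta n powi a * (\<chi> x * zeta n powi (x * (- a))))"
  proof (intro sum.cong refl)
    fix x
    have "zeta n powi (a * (1 - x)) = zeta n powi a * zeta n powi (x * (- a))" for a
      by (subst power_int_add[symmetric]) (auto simp: algebra_simps)
    then show "\<chi> x * (\<Sum>a\<in>?I. cnj (\<chi> a) * zeta n powi (a * (1 - x)))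
      = (\<Sum>a\<in>?I. cnj (\<chi> a) * zeta n powi a * (\<chi> x * zeta n powi (x * (- a))))"
      by (simp add: sum_distrib_left mult_ac)
  qed
  also have "\<dots> = (\<Sum>a\<in>?I. cnj (\<chi> a) * zeta n powi a * (cnj (\<chi> (- a)) * ?G))"
    by (subst sum.swap) (simp only: sum_distrib_left[symmetric] gauss_sum_separable[OF n \<chi>])
  also have "\<dots> = (\<Sum>a\<in>?I. \<chi> a * zeta n powi a * ?G)"
  proof (intro sum.cong refl)
    fix a
    have "cnj (\<chi> a) * cnj (\<chi> a) = \<chi> a"
    proof (cases "coprime a (int n)")
      case True
      have "cnj (\<chi> a) * cnj (\<chi> a) = \<chi> a ^ 3 * \<chi> a"
        by (simp add: cubic_char_cnj[OF C] power3_eq_cube power2_eq_square)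
      then show ?thesis using cubic_char_cube[OF C True] by simp
    qed (simp add: cubic_char_zero[OF C])
    then show "cnj (\<chi> a) * zeta n powi a * (cnj (\<chi> (- a)) * ?G) = \<chi> a * zeta n powi a * ?G"
      by (simp add: cubic_char_minus[OF C] mult_ac)
  qed
  also have "\<dots> = ?G ^ 2"
    by (simp add: gauss_sum_def sum_distrib_right power2_eq_square)
  finally show ?thesis by simp
qed

lemma jacobi_sum_norm:
  assumes n: "n > 0" and \<chi>: "primitive_char n \<chi>"
  shows "jacobi_sum n \<chi> * cnj (jacobi_sum n \<chi>) = of_nat n"
proof -
  let ?G = "gauss_sum n \<chi>" and ?J = "jacobi_sum n \<chi>"
  have "(?J * cnj ?J) * (?G * cnj ?G) = ?G ^ 2 * cnj (?G ^ 2)"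
    by (simp add: gauss_sum_square[OF assms] mult_ac)
  also have "\<dots> = (?G * cnj ?G) * (?G * cnj ?G)" by (simp add: power2_eq_square)
  finally show ?thesis using gauss_sum_norm[OF assms] n by simp
qed

lemma jacobi_sum_product:
  assumes "d > 0" "e > 0" "coprime d e" "cubic_char d \<chi>" "cubic_char e \<psi>"
  shows "jacobi_sum (d * e) (\<lambda>a. \<chi> a * \<psi> a) = jacobi_sum d \<chi> * jacobi_sum e \<psi>"
proof -
  have "jacobi_sum (d * e) (\<lambda>a. \<chi> a * \<psi> a)
    = (\<Sum>a\<in>{0..<int (d * e)}. (\<chi> a * \<chi> (1 - a)) * (\<psi> a * \<psi> (1 - a)))"
    by (simp add: jacobi_sum_def mult_ac)
  also have "\<dots> = jacobi_sum d \<chi> * jacobi_sum e \<psi>"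
    unfolding jacobi_sum_def
    by (rule sum_residues_product)
      (use assms in \<open>auto intro!: arg_cong2[of _ _ _ _ "(*)"] cong_diff
         cubic_char_cong[OF assms(1,4)] cubic_char_cong[OF assms(2,5)]\<close>)
  finally show ?thesis .
qed

section \<open>Jacobi sums modulo a prime and modulo 9\<close>

text \<open>Eisenstein integers in the basis 1, \<open>zeta 3\<close>; integer coordinates make
  congruences modulo 3 and divisibility directly accessible.\<close>

definition eis :: "int \<Rightarrow> int \<Rightarrow> complex" where
  "eis a b = of_int a + of_int b * zeta 3"

lemma zeta3_cube: "zeta 3 ^ 3 = 1"
  by (rule zeta_power_eq_1)

lemma zeta3_ne_1: "zeta 3 \<noteq> 1"
  using zeta_powi_eq_1_iff[of 3 1] by simp

lemma zeta3_square: "zeta 3 ^ 2 = - 1 - zeta 3"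
proof -
  have "(zeta 3 - 1) * (zeta 3 ^ 2 + zeta 3 + 1) = 0"
    using zeta3_cube by (simp add: algebra_simps power3_eq_cube power2_eq_square)
  then have "zeta 3 ^ 2 + zeta 3 + 1 = 0" using zeta3_ne_1 by simp
  moreover have "zeta 3 ^ 2 = (zeta 3 ^ 2 + zeta 3 + 1) - 1 - zeta 3" by simp
  ultimately show ?thesis by simp
qed

lemma cnj_zeta3: "cnj (zeta 3) = - 1 - zeta 3"
proof -
  have "cnj (zeta 3) = zeta 3 powi (- 1)"
    using cnj_zeta_powi[of 3 1] by simp
  also have "\<dots> = zeta 3 powi 2"
    by (rule zeta_powi_cong) (simp add: cong_def)
  finally show ?thesis by (simp add: zeta3_square)
qed

lemma cube_root_unity:
  assumes "(z :: complex) ^ 3 = 1"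
  shows "z = 1 \<or> z = zeta 3 \<or> z = zeta 3 ^ 2"
proof -
  have "(z - 1) * (z - zeta 3) * (z - zeta 3 ^ 2) = z ^ 3 - 1 - (zeta 3 ^ 2 + zeta 3 + 1) * (z ^ 2 - z)
     + (zeta 3 ^ 3 - 1) * (z - 1)"
    by (simp add: algebra_simps power3_eq_cube power2_eq_square)
  also have "\<dots> = 0" using assms zeta3_cube by (simp add: zeta3_square)
  finally show ?thesis by auto
qed

lemma eis_mult: "eis a b * eis c d = eis (a * c - b * d) (a * d + b * c - b * d)"
proof -
  have "eis a b * eis c d = of_int (a * c) + of_int (a * d + b * c) * zeta 3 + of_int (b * d) * zeta 3 ^ 2"
    by (simp add: eis_def algebra_simps power2_eq_square)
  then show ?thesis by (simp add: zeta3_square eis_def algebra_simps)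
qed

lemma eis_cnj: "cnj (eis a b) = eis (a - b) (- b)"
  by (simp add: eis_def cnj_zeta3 algebra_simps)

lemma eis_norm: "eis a b * cnj (eis a b) = of_int (a\<^sup>2 - a * b + b\<^sup>2)"
  unfolding eis_cnj eis_mult by (simp add: eis_def algebra_simps power2_eq_square)

lemma eis_trace: "eis a b + cnj (eis a b) = of_int (2 * a - b)"
  unfolding eis_cnj by (simp add: eis_def)

text \<open>Every orbit has exactly three elements; the induction removes one orbit at a
  time.\<close>

lemma card_cong_fixed_points_mod_3:
  assumes "finite A" "\<And>x. x \<in> A \<Longrightarrow> g x \<in> A" "\<And>x. x \<in> A \<Longrightarrow> g (g (g x)) = x"
    "\<And>x. x \<in> A \<Longrightarrow> g x \<noteq> x"
  shows "3 dvd card A"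
  using assms
proof (induction "card A" arbitrary: A rule: less_induct)
  case less
  show ?case
  proof (cases "A = {}")
    case False
    then obtain x where x: "x \<in> A" by blast
    let ?O = "{x, g x, g (g x)}"
    have O: "?O \<subseteq> A" using x less.prems(2) by auto
    have x1: "g x \<noteq> x" "g (g x) \<noteq> g x" using less.prems(2,4) x by auto
    then have ne: "g x \<noteq> x" "g (g x) \<noteq> g x" "g (g x) \<noteq> x"
      using less.prems(3)[OF x] by auto
    then have card: "card ?O = 3" by simp
    then have cA: "card A = card (A - ?O) + 3"
      using O less.prems(1) card_mono[OF less.prems(1) O] by (simp add: card_Diff_subset)
    have "3 dvd card (A - ?O)"
    proof (rule less.hyps)
      show "g y \<in> A - ?O" if "y \<in> A - ?O" for y
      proof -
        have y: "y \<in> A" "g (g (g y)) = y" using that less.prems(3) by auto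
        then have "g y = x \<Longrightarrow> y = g (g x)" "g y = g x \<Longrightarrow> y = x" "g y = g (g x) \<Longrightarrow> y = g x"
          using less.prems(3)[OF x] by metis+
        then show ?thesis using that y(1) less.prems(2) by blast
      qed
    qed (use cA less.prems in auto)
    then show ?thesis by (simp add: cA)
  qed simp
qed

text \<open>The summand \<open>\<chi> (x (1 - x))\<close> is invariant under the map \<open>x \<mapsto> 1 / (1 - x)\<close> of order 3, whose
  fixed points satisfy \<open>x (1 - x) = 1\<close>.\<close>

lemma jacobi_sum_prime:
  assumes p: "prime p" "[p = 1] (mod 3)" and \<chi>: "cubic_char p \<chi>"
  obtains a b where "jacobi_sum p \<chi> = eis a b" "[a = 2] (mod 3)" "[b = 0] (mod 3)"
proof -
  have p0: "p > 0" using p(1) prime_gt_0_nat by blast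
  note C = p0 \<chi>
  let ?I = "{0..<int p}"
  \<comment> \<open>An inverse modulo \<open>p\<close>, reduced so that \<open>g\<close> takes
    values in \<open>?I\<close>. Multiples of \<open>p\<close>, where the choice is arbitrary, are
    kept away by the nonvanishing conditions below.\<close>
  define recip where "recip y = (SOME z. [y * z = 1] (mod int p)) mod int p" for y :: int
  have p3: "p \<ge> 3" using p prime_ge_2_nat[of p] by (cases "p = 2") (auto simp: cong_def)
  have cop: "coprime x (int p) \<longleftrightarrow> \<not> int p dvd x" for x
  proof -
    have "prime (int p)" using p(1) by simp
    then have "coprime (int p) x \<longleftrightarrow> \<not> int p dvd x"
      using prime_imp_coprime[of "int p" x] coprime_absorb_left[of "int p" x] not_prime_unit[of "int p"] by blast
    then show ?thesis by (simp add: coprime_commute)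
  qed
  have recip: "[y * recip y = 1] (mod int p)" if "\<not> int p dvd y" for y
  proof -
    have "\<exists>z. [y * z = 1] (mod int p)" using that cop cong_solve_coprime_int by blast
    then have "[y * (SOME z. [y * z = 1] (mod int p)) = 1] (mod int p)" by (rule someI_ex)
    then show ?thesis by (simp add: recip_def cong_def mod_mult_right_eq)
  qed
  define g where "g x = recip (1 - x)" for x
  define A where "A z = {x \<in> ?I. \<chi> x * \<chi> (1 - x) = z}" for z
  have unit: "\<not> int p dvd x \<and> \<not> int p dvd 1 - x" if "\<chi> x * \<chi> (1 - x) \<noteq> 0" for x
    using that cubic_char_zero[OF C] cop by force
  have g: "[g x * (1 - x) = 1] (mod int p)" "[1 - g x = - (x * g x)] (mod int p)"
    "g x \<in> ?I" "\<not> int p dvd g x" "\<not> int p dvd 1 - g x"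
    if "\<chi> x * \<chi> (1 - x) \<noteq> 0" for x
  proof -
    note u = unit[OF that]
    show 1: "[g x * (1 - x) = 1] (mod int p)"
      using recip[of "1 - x"] u by (simp add: g_def mult.commute)
    have "1 - g x - - (x * g x) = - (g x * (1 - x) - 1)" by (simp add: algebra_simps)
    with 1 show 2: "[1 - g x = - (x * g x)] (mod int p)"
      unfolding cong_iff_dvd_diff by (metis dvd_minus_iff)
    show "g x \<in> ?I" using p0 by (simp add: g_def recip_def)
    show 3: "\<not> int p dvd g x"
    proof
      assume "int p dvd g x"
      then have "int p dvd 1" using 1 by (meson cong_dvd_iff dvd_mult2)
      then show False using p3 by simp
    qed
    show "\<not> int p dvd 1 - g x"
      using cong_dvd_iff[OF 2] 3 u prime_dvd_mult_iff[of "int p"] p(1) by simp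
  qed
  have mem: "g x \<in> A z" if "x \<in> A z" "z \<noteq> 0" for x z
  proof -
    have x: "\<chi> x * \<chi> (1 - x) \<noteq> 0" "\<chi> x * \<chi> (1 - x) = z" using that by (auto simp: A_def)
    have "\<chi> (g x) * \<chi> (1 - x) = 1"
      using cubic_char_cong[OF C g(1)[OF x(1)]] by (simp add: cubic_char_mult[OF C] cubic_char_one[OF C])
    moreover have "\<chi> (g x) ^ 3 = 1" using cubic_char_cube[OF C] cop g(4)[OF x(1)] by blast
    ultimately have "\<chi> (g x) * \<chi> (g x) ^ 2 = \<chi> (g x) * \<chi> (1 - x)" "\<chi> (g x) \<noteq> 0"
      by (auto simp: power3_eq_cube power2_eq_square mult.assoc)
    then have "\<chi> (g x) ^ 2 = \<chi> (1 - x)" by simp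
    moreover have "\<chi> (1 - g x) = \<chi> x * \<chi> (g x)"
      using cubic_char_cong[OF C g(2)[OF x(1)]] by (simp add: cubic_char_mult[OF C] cubic_char_minus[OF C])
    ultimately have "\<chi> (g x) * \<chi> (1 - g x) = z"
      using x(2) by (simp add: power2_eq_square mult_ac)
    then show ?thesis using g(3)[OF x(1)] by (simp add: A_def)
  qed
  have ggg: "g (g (g x)) = x" if xA: "x \<in> A z" "z \<noteq> 0" for x z
  proof -
    define y where "y = g x"
    define w where "w = g y"
    have nz: "\<chi> x * \<chi> (1 - x) \<noteq> 0" "\<chi> y * \<chi> (1 - y) \<noteq> 0" "\<chi> w * \<chi> (1 - w) \<noteq> 0"
      using that mem[OF xA] mem[OF mem[OF xA] xA(2)] by (auto simp: A_def y_def w_def)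
    have 1: "[1 - y = - (x * y)] (mod int p)" using g(2)[OF nz(1)] by (simp add: y_def)
    have 2: "[1 - w = - (y * w)] (mod int p)" "[w * (1 - y) = 1] (mod int p)"
      using g(1,2)[OF nz(2)] by (auto simp: w_def)
    have "[x * (1 - w) = x * - (y * w)] (mod int p)" using 2(1) by (intro cong_mult) auto
    also have "x * - (y * w) = w * - (x * y)" by simp
    also have "[w * - (x * y) = w * (1 - y)] (mod int p)" using 1 by (intro cong_mult) (auto simp: cong_sym_eq)
    also note 2(2)
    finally have "[x * (1 - w) = 1] (mod int p)" .
    moreover have "[g w * (1 - w) = 1] (mod int p)" by (rule g(1)[OF nz(3)])
    ultimately have "[x * (1 - w) = g w * (1 - w)] (mod int p)" by (metis cong_sym cong_trans)
    then have "[x = g w] (mod int p)"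
      using cop unit[OF nz(3)] by (simp add: cong_mult_rcancel)
    then show ?thesis
      using xA g(3)[OF nz(3)] by (simp add: A_def cong_def y_def w_def)
  qed
  \<comment> \<open>At a fixed point \<open>x * (1 - x)\<close> is 1 modulo \<open>p\<close>, so
    fixed points can lie only in the fibre over 1.\<close>
  have fixed: "g x \<noteq> x" if "x \<in> A z" "z \<noteq> 0" "z \<noteq> 1" for x z
  proof
    assume eq: "g x = x"
    have x: "\<chi> x * \<chi> (1 - x) \<noteq> 0" "\<chi> x * \<chi> (1 - x) = z" using that by (auto simp: A_def)
    have "\<chi> x * \<chi> (1 - x) = 1"
      using cubic_char_cong[OF C g(1)[OF x(1)]] eq by (simp add: cubic_char_mult[OF C] cubic_char_one[OF C])
    then show False using x that(3) by simp
  qed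
  let ?N = "\<lambda>z. card (A z)"
  have fin: "finite (A z)" for z unfolding A_def by (rule finite_subset[of _ ?I]) auto
  have N: "3 dvd ?N z" if "z \<noteq> 0" "z \<noteq> 1" for z
    by (rule card_cong_fixed_points_mod_3[OF fin, of z g]) (use mem ggg fixed that in auto)
  have z: "zeta 3 ^ 2 \<noteq> 1" "zeta 3 ^ 2 \<noteq> zeta 3"
    using zeta3_cube zeta3_ne_1 by (auto simp: power2_eq_square power3_eq_cube)
  have img: "(\<lambda>x. \<chi> x * \<chi> (1 - x)) ` (?I - A 0) \<subseteq> {1, zeta 3, zeta 3 ^ 2}"
  proof (rule image_subsetI)
    fix x assume "x \<in> ?I - A 0"
    then have "\<chi> x * \<chi> (1 - x) \<noteq> 0" by (simp add: A_def)
    then have "\<chi> x ^ 3 = 1" "\<chi> (1 - x) ^ 3 = 1"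
      using unit cubic_char_cube[OF C] cop by blast+
    then have "(\<chi> x * \<chi> (1 - x)) ^ 3 = 1" by (simp add: power_mult_distrib)
    then show "\<chi> x * \<chi> (1 - x) \<in> {1, zeta 3, zeta 3 ^ 2}"
      using cube_root_unity by blast
  qed
  have part: "?I - A 0 = A 1 \<union> A (zeta 3) \<union> A (zeta 3 ^ 2)"
    using img by (auto simp: A_def)
  have disj: "A y \<inter> A z = {}" if "y \<noteq> z" for y z using that by (auto simp: A_def)
  have A0: "A 0 = {0, 1}"
  proof -
    have "x = 0 \<or> x = 1" if "x \<in> ?I" "\<chi> x * \<chi> (1 - x) = 0" for x
    proof -
      have "int p dvd x \<or> int p dvd 1 - x"
        using that cubic_char_nonzero[OF C] cop by force
      then show ?thesis
        using that(1) zdvd_imp_le[of "int p" x] zdvd_imp_le[of "int p" "x - 1"] by (force simp: dvd_diff_commute[of "int p" 1])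
    qed
    moreover have "\<chi> 0 = 0" using cubic_char_zero[OF C, of 0] cop[of 0] by simp
    ultimately show ?thesis using p3 by (auto simp: A_def)
  qed
  have "card (?I - A 0) = p - 2"
    using p3 by (subst card_Diff_subset) (auto simp: A0)
  then have cnt: "p - 2 = ?N 1 + ?N (zeta 3) + ?N (zeta 3 ^ 2)"
    unfolding part using z zeta3_ne_1 z[symmetric] zeta3_ne_1[symmetric]
    by (simp add: card_Un_disjoint fin disj Int_Un_distrib2)
  have sumA: "(\<Sum>x\<in>A z. \<chi> x * \<chi> (1 - x)) = of_nat (?N z) * z" for z
  proof -
    have "(\<Sum>x\<in>A z. \<chi> x * \<chi> (1 - x)) = (\<Sum>x\<in>A z. z)" by (rule sum.cong) (auto simp: A_def)
    then show ?thesis by simp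
  qed
  have "jacobi_sum p \<chi> = (\<Sum>x\<in>?I - A 0. \<chi> x * \<chi> (1 - x))"
    unfolding jacobi_sum_def by (rule sum.mono_neutral_right) (auto simp: A_def)
  also have "\<dots> = of_nat (?N 1) + of_nat (?N (zeta 3)) * zeta 3 + of_nat (?N (zeta 3 ^ 2)) * zeta 3 ^ 2"
    unfolding part using z zeta3_ne_1 z[symmetric] zeta3_ne_1[symmetric]
    by (simp add: sum.union_disjoint fin disj Int_Un_distrib2 sumA)
  also have "\<dots> = eis (int (?N 1) - int (?N (zeta 3 ^ 2))) (int (?N (zeta 3)) - int (?N (zeta 3 ^ 2)))"
    by (simp add: eis_def zeta3_square algebra_simps)
  finally have J: "jacobi_sum p \<chi> = \<dots>" .
  have d: "3 dvd ?N (zeta 3)" "3 dvd ?N (zeta 3 ^ 2)"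
    using N z zeta3_ne_1 by simp_all
  have "[int (?N 1) - int (?N (zeta 3 ^ 2)) = 2] (mod 3)"
  proof -
    have "p mod 3 = 1" using p(2) by (simp add: cong_def)
    \<comment> \<open>The three fibres have \<open>p - 2\<close> elements together, because 0 and 1
      contribute nothing; \<open>p - 2\<close> is 2 modulo 3, and two of the fibres have size
      divisible by 3.\<close>
    then have "?N 1 mod 3 = 2" using cnt d p3 by presburger
    moreover have "a mod 3 = 2 \<Longrightarrow> 3 dvd b \<Longrightarrow> (int a - int b) mod 3 = 2 mod 3" for a b
    proof -
      assume "a mod 3 = 2" "3 dvd b"
      then obtain c where "b = 3 * c" by blast
      have "a = 2 + 3 * (a div 3)" using \<open>a mod 3 = 2\<close> mult_div_mod_eq[of 3 a] by linarith
      then have "int a - int b = 2 + 3 * (int (a div 3) - int c)"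
        using \<open>b = 3 * c\<close> by (metis (no_types) add_diff_eq of_nat_add of_nat_mult of_nat_numeral right_diff_distrib)
      then show ?thesis by (simp only: mod_mult_self2)
    qed
    ultimately show ?thesis using d unfolding cong_def by blast
  qed
  moreover have "[int (?N (zeta 3)) - int (?N (zeta 3 ^ 2)) = 0] (mod 3)"
    using d by (simp add: cong_iff_dvd_diff dvd_diff flip: int_dvd_int_iff)
  ultimately show ?thesis using that J by blast
qed

lemma coprime_9_iff: "coprime a 9 \<longleftrightarrow> \<not> 3 dvd (a :: int)"
proof -
  have "coprime a 9 \<longleftrightarrow> coprime a (3 ^ 2)" by simp
  also have "\<dots> \<longleftrightarrow> coprime a 3" by (subst coprime_power_right_iff) simp
  also have "\<dots> \<longleftrightarrow> \<not> 3 dvd a"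
    using prime_imp_coprime[of 3 a] coprime_absorb_left[of 3 a]
    by (auto simp: coprime_commute)
  finally show ?thesis .
qed

lemma atLeastLessThan_9: "{0..<9::int} = {0,1,2,3,4,5,6,7,8}"
proof -
  have "{0..<9::int} = set [0..8]" unfolding set_upto by auto
  then show ?thesis by (simp add: upto.simps del: set_upto)
qed

lemma mod_9_cases: "a mod 9 \<in> {0,1,2,3,4,5,6,7,8::int}"
  unfolding atLeastLessThan_9[symmetric] by simp

text \<open>The units that are 1 modulo 3 are 1, 4 and 7 modulo 9, so primitivity makes
  \<open>\<chi> 4\<close> and its square \<open>\<chi> 7\<close> nontrivial. In the sum only
  \<open>a\<close> = 2, 5, 8 survive, and each time \<open>a * (1 - a)\<close> is 7 modulo
  9.\<close>

lemma jacobi_sum_9: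
  assumes "primitive_char 9 \<chi>"
  shows "jacobi_sum 9 \<chi> = 3 * zeta 3 \<or> jacobi_sum 9 \<chi> = 3 * zeta 3 ^ 2"
proof -
  have C: "(9::nat) > 0" "cubic_char 9 \<chi>" using assms by (auto simp: primitive_cubic)
  obtain a where a: "[a = 1] (mod 3)" "coprime a 9" "\<chi> a \<noteq> 1"
    using conjunct2[OF assms[unfolded primitive_char_def], rule_format, of 3] by auto
  have sq: "\<chi> 7 = \<chi> 4 * \<chi> 4"
    using cubic_char_mult[OF C, of 4 4] cubic_char_cong[OF C, of 16 7] by (simp add: cong_def)
  have "a mod 9 = 1 \<or> a mod 9 = 4 \<or> a mod 9 = 7"
  proof -
    have "(a mod 9) mod 3 = 1" using a(1) by (simp add: cong_def mod_mod_cancel)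
    then show ?thesis using mod_9_cases[of a] by auto
  qed
  then have "\<chi> a = 1 \<or> \<chi> a = \<chi> 4 \<or> \<chi> a = \<chi> 7"
    using cubic_char_cong[OF C, of a 1] cubic_char_cong[OF C, of a 4] cubic_char_cong[OF C, of a 7]
      cubic_char_one[OF C] by (auto simp: cong_def)
  then have "\<chi> 4 \<noteq> 1" using a(3) sq by auto
  moreover have c4: "\<chi> 4 ^ 3 = 1"
    by (rule cubic_char_cube[OF C]) (simp add: coprime_9_iff)
  ultimately have "\<chi> 7 \<noteq> 1" unfolding sq by (auto simp: power3_eq_cube)
  moreover have "\<chi> 7 ^ 3 = 1"
    by (rule cubic_char_cube[OF C]) (simp add: coprime_9_iff)
  ultimately have "\<chi> 7 = zeta 3 \<or> \<chi> 7 = zeta 3 ^ 2" using cube_root_unity by blast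
  moreover have "jacobi_sum 9 \<chi> = 3 * \<chi> 7"
  proof -
    have "\<chi> 0 = 0" "\<chi> 3 = 0" "\<chi> 6 = 0" "\<chi> (-3) = 0" "\<chi> (-6) = 0"
      by (rule cubic_char_zero[OF C], simp add: coprime_9_iff)+
    moreover have "\<chi> 2 * \<chi> (-1) = \<chi> 7" "\<chi> 5 * \<chi> (-4) = \<chi> 7" "\<chi> 8 * \<chi> (-7) = \<chi> 7"
      by (simp add: cubic_char_mult[OF C, symmetric], rule cubic_char_cong[OF C], simp add: cong_def)+
    ultimately show ?thesis by (simp add: jacobi_sum_def atLeastLessThan_9)
  qed
  ultimately show ?thesis by auto
qed

section \<open>Existence and decomposition of primitive cubic characters\<close>

text \<open>A power residue symbol: \<open>a ^ k\<close> lies in the group of order 3 generated by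
  \<open>w\<close>, which is identified with the complex cube roots of unity through
  \<open>w\<close> and \<open>zeta 3\<close>. The modulus is arbitrary because both \<open>p\<close>
  and 9 are needed.\<close>

lemma power_residue_char:
  fixes n k :: nat and w :: int
  assumes n: "n > 0" and w: "[w ^ 3 = 1] (mod int n)" "\<not> [w = 1] (mod int n)"
    and cov: "\<And>a. coprime a (int n) \<Longrightarrow>
      [a ^ k = 1] (mod int n) \<or> [a ^ k = w] (mod int n) \<or> [a ^ k = w ^ 2] (mod int n)"
  obtains \<chi> where "cubic_char n \<chi>" "\<And>a. coprime a (int n) \<Longrightarrow> \<chi> a = 1 \<longleftrightarrow> [a ^ k = 1] (mod int n)"
proof -
  define \<chi> where "\<chi> a = (if \<not> coprime a (int n) then 0 else if [a ^ k = 1] (mod int n) then 1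
    else if [a ^ k = w] (mod int n) then zeta 3 else zeta 3 ^ 2)" for a
  have wcop: "coprime w (int n)"
    using cong_imp_coprime[OF cong_sym[OF w(1)]] by simp
  have w2: "\<not> [w ^ 2 = 1] (mod int n)" "\<not> [w ^ 2 = w] (mod int n)"
  proof -
    show "\<not> [w ^ 2 = w] (mod int n)"
      using w(2) wcop cong_mult_lcancel[of w "int n" w 1] by (simp add: power2_eq_square)
    show "\<not> [w ^ 2 = 1] (mod int n)"
    proof
      assume "[w ^ 2 = 1] (mod int n)"
      then have "[w * w ^ 2 = w * 1] (mod int n)" by (intro cong_mult) auto
      then show False using w by (simp add: power3_eq_cube power2_eq_square mult.assoc)
        (blast intro: cong_sym cong_trans)
    qed
  qed
  have red: "[w ^ i = w ^ (i mod 3)] (mod int n)" for i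
  proof -
    have "w ^ i = (w ^ 3) ^ (i div 3) * w ^ (i mod 3)"
      by (metis mult_div_mod_eq power_add power_mult)
    moreover have "[(w ^ 3) ^ (i div 3) * w ^ (i mod 3) = 1 ^ (i div 3) * w ^ (i mod 3)] (mod int n)"
      by (intro cong_mult cong_pow w(1) cong_refl)
    ultimately show ?thesis by simp
  qed
  have zred: "zeta 3 ^ i = zeta 3 ^ (i mod 3)" for i
    by (metis mult_div_mod_eq power_add power_mult zeta3_cube power_one mult_1)
  have val: "\<chi> a = zeta 3 ^ i" if "coprime a (int n)" "[a ^ k = w ^ i] (mod int n)" for a i
  proof -
    have *: "[a ^ k = w ^ (i mod 3)] (mod int n)" using that(2) red cong_trans by blast
    have "i mod 3 = 0 \<or> i mod 3 = 1 \<or> i mod 3 = 2" by presburger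
    then have "\<chi> a = zeta 3 ^ (i mod 3)"
      using * that(1) w(2) w2 unfolding \<chi>_def
      by (elim disjE) (auto simp: cong_def)
    then show ?thesis using zred by metis
  qed
  have ex: "\<exists>i. [a ^ k = w ^ i] (mod int n)" if "coprime a (int n)" for a
    using cov[OF that] by (metis power_0 power_one_right)
  have "cubic_char n \<chi>"
    unfolding cubic_char_def
  proof (intro conjI allI impI)
    fix a b
    show "\<chi> (a * b) = \<chi> a * \<chi> b"
    proof (cases "coprime a (int n) \<and> coprime b (int n)")
      case True
      then obtain i j where ij: "[a ^ k = w ^ i] (mod int n)" "[b ^ k = w ^ j] (mod int n)" using ex by blast
      then have "[(a * b) ^ k = w ^ (i + j)] (mod int n)"
        unfolding power_mult_distrib power_add by (rule cong_mult)
      then show ?thesis using val[of "a * b" "i + j"] val[of a i] val[of b j] True ij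
        by (simp add: power_add)
    qed (auto simp: \<chi>_def)
  next
    fix a b assume "[a = b] (mod int n)"
    then have "coprime a (int n) = coprime b (int n)" "a ^ k mod int n = b ^ k mod int n"
      using cong_imp_coprime cong_sym cong_pow[of a b "int n" k] by (blast, simp add: cong_def)
    then show "\<chi> a = \<chi> b" unfolding \<chi>_def cong_def by simp
  next
    fix a assume "coprime a (int n)"
    then obtain i where "\<chi> a = zeta 3 ^ i" using val ex by blast
    then have "\<chi> a ^ 3 = (zeta 3 ^ 3) ^ i" by (simp only: power_mult[symmetric] mult.commute)
    then show "\<chi> a ^ 3 = 1" by (simp only: zeta3_cube power_one)
  qed (auto simp: \<chi>_def)
  moreover have "\<chi> a = 1 \<longleftrightarrow> [a ^ k = 1] (mod int n)" if "coprime a (int n)" for a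
    using that zeta3_cube zeta3_ne_1 by (auto simp: \<chi>_def power2_eq_square power3_eq_cube)
  ultimately show ?thesis using that by blast
qed

text \<open>The cubic residue symbol modulo \<open>p\<close>: the exponent is
  \<open>(p - 1) div 3\<close>, and the image of a primitive root under this power map has order
  3.\<close>

lemma primitive_char_prime_exists:
  assumes p: "prime p" "[p = 1] (mod 3)"
  obtains \<chi> where "primitive_char p \<chi>"
proof -
  define k where "k = (p - 1) div 3"
  have p0: "p > 0" and p1: "p > 1" using p(1) prime_gt_0_nat prime_gt_1_nat by auto
  have k: "p - 1 = 3 * k"
    using p(2) p1 unfolding k_def cong_def by presburger
  obtain g where g: "residue_primroot p g" using prime_primitive_root_exists[OF p1] p(1) by blast
  then have gc: "coprime p g" "ord p g = p - 1"
    using p(1) by (auto simp: residue_primroot_def totient_prime)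
  have "\<not> [g ^ k = 1] (mod p)"
    using k p1 gc(2) ord_divides[of g k p] by (auto dest!: dvd_imp_le)
  then have w2: "\<not> [int g ^ k = 1] (mod int p)"
    by (metis cong_int_iff of_nat_1 of_nat_power)
  have "[g ^ (3 * k) = 1] (mod p)" using k gc(2) ord_divides[of g "3 * k" p] by simp
  then have w1: "[(int g ^ k) ^ 3 = 1] (mod int p)"
    by (metis cong_int_iff of_nat_1 of_nat_power power_mult mult.commute)
  have ip: "prime (int p)" using p(1) by simp
  define w where "w = int g ^ k"
  have "int p dvd (w - 1) * (w\<^sup>2 + w + 1)"
    using w1 by (simp add: cong_iff_dvd_diff w_def algebra_simps power2_eq_square power3_eq_cube)
  then have w3: "int p dvd w\<^sup>2 + w + 1"
    using w2 prime_dvd_mult_iff[OF ip] by (auto simp: cong_iff_dvd_diff w_def)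
  have cov: "[a ^ k = 1] (mod int p) \<or> [a ^ k = w] (mod int p) \<or> [a ^ k = w ^ 2] (mod int p)"
    if "coprime a (int p)" for a
  proof -
    define b where "b = nat (a mod int p)"
    have b: "int b = a mod int p" using p0 by (simp add: b_def)
    then have ba: "[int b = a] (mod int p)" by (simp add: cong_def)
    then have "coprime (int b) (int p)" using that cong_imp_coprime cong_sym by blast
    then have "\<not> p dvd b" using p1 coprime_absorb_right[of p b] by auto
    then have "[b ^ (p - 1) = 1] (mod p)" by (rule fermat_theorem[OF p(1)])
    then have "[int b ^ (p - 1) = 1] (mod int p)" by (metis cong_int_iff of_nat_1 of_nat_power)
    then have "[a ^ (p - 1) = 1] (mod int p)"
      using cong_pow[OF ba, of "p - 1"] cong_sym cong_trans by blast
    then have "int p dvd (a ^ k) ^ 3 - 1" by (simp only: k cong_iff_dvd_diff power_mult[symmetric] mult.commute)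
    \<comment> \<open>The factorization of \<open>X ^ 3 - 1\<close> into three linear factors modulo
      \<open>p\<close>; the error term is a multiple of \<open>w\<^sup>2 + w + 1\<close>.\<close>
    moreover have "(a ^ k - 1) * (a ^ k - w) * (a ^ k - w\<^sup>2) = ((a ^ k) ^ 3 - 1)
      - (w\<^sup>2 + w + 1) * ((a ^ k)\<^sup>2 - w * a ^ k  + w - 1)"
      by (simp add: algebra_simps power2_eq_square power3_eq_cube)
    ultimately have "int p dvd (a ^ k - 1) * (a ^ k - w) * (a ^ k - w\<^sup>2)"
      using w3 by (metis dvd_diff dvd_mult2)
    then show ?thesis using ip by (simp add: cong_iff_dvd_diff prime_dvd_mult_iff)
  qed
  obtain \<chi> where \<chi>: "cubic_char p \<chi>" "\<And>a. coprime a (int p) \<Longrightarrow> \<chi> a = 1 \<longleftrightarrow> [a ^ k = 1] (mod int p)"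
    by (rule power_residue_char[OF p0, of w k]) (use w1 w2 cov in \<open>auto simp: w_def\<close>)
  have "coprime (int g) (int p)" using gc(1) by (simp add: coprime_commute)
  then have "\<chi> (int g) \<noteq> 1" using \<chi>(2) w2 by blast
  then have "primitive_char p \<chi>"
    unfolding primitive_char_def
  proof (intro conjI allI impI \<chi>(1))
    fix q assume nt: "\<chi> (int g) \<noteq> 1" and q: "prime q \<and> q dvd p"
    then have "q = p" using primes_dvd_imp_eq p(1) by blast
    then show "\<exists>a. [a = 1] (mod int (p div q)) \<and> coprime a (int p) \<and> \<chi> a \<noteq> 1"
      using nt \<open>coprime (int g) (int p)\<close> p0 by (intro exI[of _ "int g"]) (simp add: cong_def)
  qed
  then show ?thesis using that by blast
qed

lemma primitive_char_9_exists:
  obtains \<chi> where "primitive_char 9 \<chi>"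
proof -
  have cov: "[a ^ 2 = 1] (mod 9) \<or> [a ^ 2 = 4] (mod 9) \<or> [a ^ 2 = 4 ^ 2] (mod 9)"
    if "coprime a 9" for a :: int
  proof -
    note r = mod_9_cases[of a]
    have "\<not> 3 dvd a mod 9" using that unfolding coprime_9_iff by (simp add: dvd_mod_iff)
    then have "a mod 9 \<in> {1,2,4,5,7,8}" using r by auto
    then have "(a mod 9) ^ 2 mod 9 \<in> {1, 4, 7}" by auto
    then show ?thesis by (auto simp: cong_def power_mod)
  qed
  \<comment> \<open>The unit group modulo 9 has order 6, whence the exponent 2 = 6 / 3, and 4 has
    order 3 in it.\<close>
  obtain \<chi> where \<chi>: "cubic_char 9 \<chi>" "\<And>a. coprime a (int 9) \<Longrightarrow> \<chi> a = 1 \<longleftrightarrow> [a ^ 2 = 1] (mod int 9)"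
    by (rule power_residue_char[of 9 4 2]) (use cov in \<open>auto simp: cong_def\<close>)
  have c: "coprime (4::int) 9" by (simp add: coprime_9_iff)
  have "\<chi> 4 \<noteq> 1" using \<chi>(2)[of 4] c by (simp add: cong_def)
  moreover have "q = 3" if "prime q" "q dvd 9" for q :: nat
    using that prime_dvd_power[of q 3 2] primes_dvd_imp_eq[of q 3] by simp
  ultimately have "primitive_char 9 \<chi>"
    unfolding primitive_char_def
  proof (intro conjI allI impI \<chi>(1))
    fix q assume "\<And>q. prime q \<Longrightarrow> q dvd 9 \<Longrightarrow> q = (3::nat)" "prime q \<and> q dvd (9::nat)"
    then have "q = 3" by blast
    then show "\<exists>a. [a = 1] (mod int (9 div q)) \<and> coprime a (int 9) \<and> \<chi> a \<noteq> 1"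
      using \<open>\<chi> 4 \<noteq> 1\<close> c by (intro exI[of _ 4]) (simp add: cong_def)
  qed
  then show ?thesis using that by blast
qed

text \<open>The map \<open>l\<close> embeds the residues modulo \<open>d\<close> as residues that
  are trivial modulo \<open>e\<close>; it carries witnesses and characters between a factor and the
  full modulus.\<close>

lemma crt_lift:
  fixes d e :: nat
  assumes "coprime d e"
  obtains l :: "int \<Rightarrow> int"
  where "\<And>a. [l a = a] (mod int d)" "\<And>a. [l a = 1] (mod int e)"
proof -
  have "\<exists>x. [x = a] (mod int d) \<and> [x = 1] (mod int e)" for a
    using binary_chinese_remainder_int[of "int d" "int e" a 1] assms by auto
  then show ?thesis using that by metis
qed

lemma primitive_char_mult:
  assumes de: "d > 0" "e > 0" "coprime d e" and \<chi>: "primitive_char d \<chi>" and \<psi>: "primitive_char e \<psi>"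
  shows "primitive_char (d * e) (\<lambda>a. \<chi> a * \<psi> a)"
proof -
  note C = de(1) primitive_cubic[OF \<chi>] and D = de(2) primitive_cubic[OF \<psi>]
  have cub: "cubic_char (d * e) (\<lambda>a. \<chi> a * \<psi> a)"
    unfolding cubic_char_def
  proof (intro conjI allI impI)
    fix a b assume "[a = b] (mod int (d * e))"
    then have "[a = b] (mod int d)" "[a = b] (mod int e)"
      by (auto simp: cong_iff_dvd_diff dest: dvd_mult_left dvd_mult_right)
    then show "\<chi> a * \<psi> a = \<chi> b * \<psi> b" using cubic_char_cong[OF C] cubic_char_cong[OF D] by metis
  qed (use cubic_char_zero[OF C] cubic_char_zero[OF D] in
      \<open>auto simp: cubic_char_mult[OF C] cubic_char_mult[OF D] power_mult_distrib
        cubic_char_cube[OF C] cubic_char_cube[OF D]\<close>)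
  \<comment> \<open>A witness for \<open>\<chi>\<close> is lifted to be 1 modulo \<open>e\<close>,
    where \<open>\<psi>\<close> cannot interfere. The claim is generalized over both moduli so that
    it serves either factor.\<close>
  have wit: "\<exists>a. [a = 1] (mod int (d * e div q)) \<and> coprime a (int (d * e)) \<and> \<chi> a * \<psi> a \<noteq> 1"
    if q: "prime q" "q dvd d" and de: "d > 0" "e > 0" "coprime d e" "primitive_char d \<chi>" "primitive_char e \<psi>"
    for q d e \<chi> \<psi>
  proof -
    note C = de(1) primitive_cubic[OF de(4)] and D = de(2) primitive_cubic[OF de(5)]
    obtain c where c: "[c = 1] (mod int (d div q))" "coprime c (int d)" "\<chi> c \<noteq> 1"
      using de(4) q unfolding primitive_char_def by blast
    obtain l where l: "\<And>a. [l a = a] (mod int d)" "\<And>a. [l a = 1] (mod int e)"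
      using crt_lift[OF de(3)] by blast
    have "d div q dvd d" using dvd_triv_left[of "d div q" q] q(2) by simp
    then have "[l c = 1] (mod int (d div q))"
      using cong_trans[OF cong_dvd_modulus[OF l(1)] c(1)] by simp
    moreover have "coprime (d div q) e"
      using coprime_divisors[OF \<open>d div q dvd d\<close> dvd_refl de(3)] .
    ultimately have "[l c = 1] (mod (int (d div q) * int e))"
      using l(2) by (intro coprime_cong_mult) auto
    moreover have "d * e div q = d div q * e" using q(2) by (simp add: div_mult_swap mult.commute)
    ultimately have "[l c = 1] (mod int (d * e div q))" by simp
    moreover have "coprime (l c) (int (d * e))"
      using c(2) l cong_imp_coprime[of c "l c" "int d"] cong_imp_coprime[of 1 "l c" "int e"]
      by (simp add: cong_sym)
    moreover have "\<chi> (l c) * \<psi> (l c) \<noteq> 1"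
      using c(3) cubic_char_cong[OF C l(1)] cubic_char_cong[OF D l(2)] cubic_char_one[OF D] by simp
    ultimately show ?thesis by blast
  qed
  show ?thesis
    unfolding primitive_char_def
  proof (intro conjI allI impI cub)
    fix q assume q: "prime q \<and> q dvd d * e"
    then consider "q dvd d" | "q dvd e" using prime_dvd_mult_iff by blast
    then show "\<exists>a. [a = 1] (mod int (d * e div q)) \<and> coprime a (int (d * e)) \<and> \<chi> a * \<psi> a \<noteq> 1"
    proof cases
      case 1
      then show ?thesis using wit[OF _ 1 de \<chi> \<psi>] q by blast
    next
      case 2
      then show ?thesis using wit[OF _ 2 de(2,1) _ \<psi> \<chi>] q de(3)
        by (simp add: coprime_commute mult.commute)
    qed
  qed
qed

text \<open>The component at \<open>d\<close> evaluates \<open>\<chi>\<close> at a lift that is 1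
  modulo \<open>e\<close>. Any \<open>a\<close> is congruent to the product of its two lifts, which
  yields the factorization.\<close>

lemma primitive_char_decompose:
  assumes de: "d > 0" "e > 0" "coprime d e" and \<chi>: "primitive_char (d * e) \<chi>"
  obtains \<chi>1 \<chi>2 where "primitive_char d \<chi>1" "primitive_char e \<chi>2" "\<chi> = (\<lambda>a. \<chi>1 a * \<chi>2 a)"
proof -
  have part: "\<exists>\<psi>. primitive_char d \<psi> \<and> (\<forall>a x. [x = a] (mod int d) \<longrightarrow> [x = 1] (mod int e) \<longrightarrow> \<psi> a = \<chi> x)"
    if de: "d > 0" "e > 0" "coprime d e" and \<chi>: "primitive_char (d * e) \<chi>" for d e
  proof -
    have "d * e > 0" using de by simp
    note C = this primitive_cubic[OF \<chi>]
    obtain l where l: "\<And>a. [l a = a] (mod int d)" "\<And>a. [l a = 1] (mod int e)"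
      using crt_lift[OF de(3)] by blast
    have uniq: "[x = y] (mod int (d * e))" if "[x = y] (mod int d)" "[x = y] (mod int e)" for x y
      using that de(3) by (simp add: coprime_cong_mult)
    have lcop: "coprime (l a) (int (d * e)) \<longleftrightarrow> coprime a (int d)" for a
    proof -
      have "coprime (l a) (int d) \<longleftrightarrow> coprime a (int d)"
        using l(1) cong_imp_coprime cong_sym by blast
      moreover have "coprime (l a) (int e)"
        using cong_imp_coprime[of 1 "l a" "int e"] l(2) by (simp add: cong_sym)
      ultimately show ?thesis by simp
    qed
    have \<psi>: "\<chi> (l a) = \<chi> x" if "[x = a] (mod int d)" "[x = 1] (mod int e)" for a x
      by (intro cubic_char_cong[OF C] uniq) (use that l in \<open>metis cong_sym cong_trans\<close>)+
    have cub: "cubic_char d (\<lambda>a. \<chi> (l a))"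
      unfolding cubic_char_def
    proof (intro conjI allI impI)
      fix a b
      have "\<chi> (l (a * b)) = \<chi> (l a * l b)"
        by (rule \<psi>) (use l cong_mult[OF l(2) l(2), of a b] in \<open>auto intro: cong_mult\<close>)
      then show "\<chi> (l (a * b)) = \<chi> (l a) * \<chi> (l b)" by (simp add: cubic_char_mult[OF C])
    next
      fix a b assume "[a = b] (mod int d)"
      then show "\<chi> (l a) = \<chi> (l b)" using \<psi> l cong_trans cong_sym by metis
    qed (use lcop cubic_char_cube[OF C] cubic_char_zero[OF C] in auto)
    have "primitive_char d (\<lambda>a. \<chi> (l a))"
      unfolding primitive_char_def
    proof (intro conjI allI impI cub)
      fix q assume q: "prime q \<and> q dvd d"
      then have "q dvd d * e" by simp
      then obtain c where c: "[c = 1] (mod int (d * e div q))" "coprime c (int (d * e))" "\<chi> c \<noteq> 1"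
        using \<chi> q unfolding primitive_char_def by blast
      have eq: "d * e div q = d div q * e" using q by (simp add: div_mult_swap mult.commute)
      have "[c = 1] (mod int (d div q))" "[c = 1] (mod int e)"
        by (rule cong_dvd_modulus[OF c(1)], simp add: eq)+
      moreover have "coprime c (int d)" using c(2) by simp
      moreover have "\<chi> (l c) \<noteq> 1" using \<psi>[of c c] c(3) \<open>[c = 1] (mod int e)\<close> by simp
      ultimately show "\<exists>a. [a = 1] (mod int (d div q)) \<and> coprime a (int d) \<and> \<chi> (l a) \<noteq> 1" by blast
    qed
    then show ?thesis using \<psi> by blast
  qed
  obtain \<chi>1 where 1: "primitive_char d \<chi>1"
    "\<And>a x. [x = a] (mod int d) \<Longrightarrow> [x = 1] (mod int e) \<Longrightarrow> \<chi>1 a = \<chi> x"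
    using part[OF de \<chi>] by blast
  obtain \<chi>2 where 2: "primitive_char e \<chi>2"
    "\<And>a x. [x = a] (mod int e) \<Longrightarrow> [x = 1] (mod int d) \<Longrightarrow> \<chi>2 a = \<chi> x"
    using part[OF de(2,1)] de(3) \<chi> by (auto simp: coprime_commute mult.commute)
  have "\<chi> a = \<chi>1 a * \<chi>2 a" for a
  proof -
    have "d * e > 0" using de by simp
    note C = this primitive_cubic[OF \<chi>]
    obtain x where x: "[x = a] (mod int d)" "[x = 1] (mod int e)"
      using crt_lift[OF de(3)] by blast
    obtain y where y: "[y = a] (mod int e)" "[y = 1] (mod int d)"
      using crt_lift[of e d] de(3) by (metis coprime_commute)
    have "[x * y = a * 1] (mod int d)" "[x * y = 1 * a] (mod int e)"
      using cong_mult[OF x(1) y(2)] cong_mult[OF x(2) y(1)] by auto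
    then have "[x * y = a] (mod (int d * int e))"
      using de(3) by (intro coprime_cong_mult) auto
    then have "\<chi> a = \<chi> (x * y)" by (intro cubic_char_cong[OF C]) (simp add: cong_sym)
    then show ?thesis using 1(2)[OF x] 2(2)[OF y] by (simp add: cubic_char_mult[OF C])
  qed
  then show ?thesis using that 1(1) 2(1) by blast
qed

section \<open>Jacobi sums and admissible pairs\<close>

lemma primitive_char_1: "primitive_char 1 (\<lambda>_. 1)"
  by (auto simp: primitive_char_def cubic_char_def)

lemma jacobi_sum_1:
  assumes "primitive_char 1 \<chi>"
  shows "jacobi_sum 1 \<chi> = 1"
proof -
  have "\<chi> 1 = 1" "\<chi> 0 = \<chi> 1"
    using cubic_char_one[OF _ primitive_cubic[OF assms]]
      cubic_char_cong[OF _ primitive_cubic[OF assms], of 0 1] by auto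
  moreover have "{0..<int 1} = {0}" by auto
  ultimately show ?thesis by (simp add: jacobi_sum_def)
qed

lemma prod_primes_insert:
  assumes "finite S" "\<forall>q\<in>insert p S. prime (q::nat)" "p \<notin> S"
  shows "\<Prod>(insert p S) = p * \<Prod>S" "coprime p (\<Prod>S)" "p > 0" "\<Prod>S > 0"
proof -
  show "\<Prod>(insert p S) = p * \<Prod>S" using assms by simp
  have "coprime p q" if "q \<in> S" for q
    using assms(2,3) that by (auto intro: primes_coprime)
  then show "coprime p (\<Prod>S)" by (intro prod_coprime_right) auto
  show "p > 0" using assms(2) prime_gt_0_nat by simp
  show "\<Prod>S > 0" using assms(2) prime_gt_0_nat by (auto intro!: prod_pos)
qed

text \<open>Each prime contributes an Eisenstein integer congruent to -1 modulo 3. This is the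
  origin of the Moebius sign in the theorem.\<close>

lemma jacobi_sum_squarefree:
  assumes "finite S" "\<And>p. p \<in> S \<Longrightarrow> prime p \<and> [p = 1] (mod 3)" "primitive_char (\<Prod>S) \<chi>"
  shows "\<exists>a b. jacobi_sum (\<Prod>S) \<chi> = eis a b \<and> [a = (- 1) ^ card S] (mod 3) \<and> [b = 0] (mod 3)"
  using assms
proof (induction S arbitrary: \<chi> rule: finite_induct)
  case empty
  then have "jacobi_sum 1 \<chi> = eis 1 0" using jacobi_sum_1 by (simp add: eis_def)
  then show ?case by (intro exI[of _ 1] exI[of _ 0]) simp
next
  case (insert p S)
  have pr: "\<forall>q\<in>insert p S. prime q" using insert.prems(1) by blast
  note pS = prod_primes_insert[OF insert.hyps(1) pr insert.hyps(2)]
  obtain \<chi>1 \<chi>2 where \<chi>: "primitive_char p \<chi>1" "primitive_char (\<Prod>S) \<chi>2" "\<chi> = (\<lambda>a. \<chi>1 a * \<chi>2 a)"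
    using primitive_char_decompose[OF pS(3,4,2), of \<chi>] insert.prems(2) unfolding pS(1) by blast
  obtain a b where 1: "jacobi_sum p \<chi>1 = eis a b" "[a = 2] (mod 3)" "[b = 0] (mod 3)"
    using jacobi_sum_prime[of p \<chi>1] insert.prems(1) primitive_cubic[OF \<chi>(1)] by blast
  obtain c d where 2: "jacobi_sum (\<Prod>S) \<chi>2 = eis c d" "[c = (- 1) ^ card S] (mod 3)" "[d = 0] (mod 3)"
    using insert.IH[OF _ \<chi>(2)] insert.prems(1) by blast
  have "jacobi_sum (\<Prod>(insert p S)) \<chi> = eis (a * c - b * d) (a * d + b * c - b * d)"
    using jacobi_sum_product[OF pS(3,4,2) primitive_cubic[OF \<chi>(1)] primitive_cubic[OF \<chi>(2)]]
    unfolding pS(1) \<chi>(3) 1(1) 2(1) eis_mult by simp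
  moreover have "[a * c - b * d = 2 * (- 1) ^ card S - 0 * 0] (mod 3)"
    by (intro cong_diff cong_mult 1 2)
  moreover have "[2 * (- 1) ^ card S - 0 * 0 = ((- 1) ^ card (insert p S) :: int)] (mod 3)"
    using insert.hyps by (auto simp: cong_iff_dvd_diff minus_one_power_iff)
  ultimately have "jacobi_sum (\<Prod>(insert p S)) \<chi> = eis (a * c - b * d) (a * d + b * c - b * d)"
      "[a * c - b * d = (- 1) ^ card (insert p S)] (mod 3)"
    by (blast intro: cong_trans)+
  moreover have "[a * d + b * c - b * d = a * 0 + 0 * c - 0 * d] (mod 3)"
    by (intro cong_diff cong_add cong_mult 1 2 cong_refl)
  ultimately show ?case by auto
qed

text \<open>\<open>A\<close> and \<open>b * c - a * d\<close> are the coordinates of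
  \<open>eis a b\<close> times the conjugate of \<open>eis c d\<close>. The latter is divisible by
  \<open>p\<close> by assumption; the norm of this product is divisible by \<open>p\<close>, so
  \<open>A\<close> is too. Dividing by \<open>p\<close> gives the quotient of \<open>eis a b\<close>
  by \<open>eis c d\<close>.\<close>

lemma eis_eq_prime_times:
  assumes nrm: "c\<^sup>2 - c * d + d\<^sup>2 = int p" and p: "prime p" and N: "a\<^sup>2 - a * b + b\<^sup>2 = int (p * m)"
    and dvd: "int p dvd b * c - a * d"
  obtains x y where "eis a b = eis c d * eis x y" "x\<^sup>2 - x * y + y\<^sup>2 = int m"
    "a = c * x - d * y" "b = c * y + d * x - d * y"
proof -
  have ip: "prime (int p)" and p0: "p > 0" using p prime_gt_0_nat by auto
  define A where "A = a * c - a * d + b * d"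
  obtain y where y: "b * c - a * d = int p * y" using dvd by blast
  have AN: "A\<^sup>2 - A * (b * c - a * d) + (b * c - a * d)\<^sup>2 = int p * (int p * int m)"
  proof -
    have "A\<^sup>2 - A * (b * c - a * d) + (b * c - a * d)\<^sup>2 = (a\<^sup>2 - a * b + b\<^sup>2) * (c\<^sup>2 - c * d + d\<^sup>2)"
      by (simp add: A_def power2_eq_square algebra_simps)
    then show ?thesis by (simp add: nrm N)
  qed
  then have "A\<^sup>2 = int p * (int p * int m + A * y - int p * y\<^sup>2)"
    by (simp add: y power2_eq_square algebra_simps)
  then have "int p dvd A" using ip prime_dvd_power by (metis dvd_triv_left)
  then obtain x where x: "A = int p * x" by blast
  have "int p * int p * (x\<^sup>2 - x * y + y\<^sup>2) = int p * int p * int m"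
    using AN by (simp add: x y power2_eq_square algebra_simps)
  then have xy: "x\<^sup>2 - x * y + y\<^sup>2 = int m" using p0 by simp
  have "int p * a = int p * (c * x - d * y)"
  proof -
    have "int p * (c * x - d * y) = c * A - d * (b * c - a * d)" by (simp add: x y algebra_simps)
    also have "\<dots> = a * (c\<^sup>2 - c * d + d\<^sup>2)" by (simp add: A_def power2_eq_square algebra_simps)
    finally show ?thesis by (metis mult.commute nrm)
  qed
  then have a: "a = c * x - d * y" by (rule mult_left_cancel[THEN iffD1, rotated]) (use p0 in simp)
  have "int p * b = int p * (c * y + d * x - d * y)"
  proof -
    have "int p * (c * y + d * x - d * y) = (c - d) * (b * c - a * d) + d * A" by (simp add: x y algebra_simps)
    also have "\<dots> = b * (c\<^sup>2 - c * d + d\<^sup>2)" by (simp add: A_def power2_eq_square algebra_simps)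
    finally show ?thesis by (metis mult.commute nrm)
  qed
  then have b: "b = c * y + d * x - d * y" by (rule mult_left_cancel[THEN iffD1, rotated]) (use p0 in simp)
  show ?thesis
    by (rule that[OF _ xy a b]) (simp add: eis_mult a b)
qed

text \<open>A prime \<open>p\<close> of the norm splits, and one of its two conjugate prime factors
  divides \<open>eis a b\<close>. Up to sign these factors are the Jacobi sums of a character modulo
  \<open>p\<close> and of its conjugate, so the right one of the two is chosen. The congruences
  modulo 3 fix the unit.\<close>

lemma jacobi_sum_realize:
  assumes "finite S" "\<And>p. p \<in> S \<Longrightarrow> prime p \<and> [p = 1] (mod 3)"
    "a\<^sup>2 - a * b + b\<^sup>2 = int (\<Prod>S)" "[a = 1] (mod 3)" "[b = 0] (mod 3)"
  shows "\<exists>\<chi>. primitive_char (\<Prod>S) \<chi> \<and> (- 1) ^ card S * jacobi_sum (\<Prod>S) \<chi> = eis a b"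
  using assms
proof (induction S arbitrary: a b rule: finite_induct)
  case empty
  \<comment> \<open>Four times the norm equation. A unit with \<open>b\<close> divisible by 3 has
    \<open>b = 0\<close>, and the condition on \<open>a\<close> then leaves only 1.\<close>
  have four: "(2 * a - b)\<^sup>2 + 3 * b\<^sup>2 = 4"
    using empty.prems(2) by (simp add: power2_eq_square algebra_simps)
  obtain k where k: "b = 3 * k" using empty.prems(4) by (auto simp: cong_0_iff)
  have "b\<^sup>2 \<le> 1" using four zero_le_power2[of "2 * a - b"] by linarith
  then have "9 * k\<^sup>2 \<le> 1" by (simp add: k power_mult_distrib)
  then have "k\<^sup>2 \<le> 0" by linarith
  then have "k = 0" by simp
  then have "b = 0" using k by simp
  then have "a\<^sup>2 = 1" using empty.prems(2) by simp
  then have "a = 1" using empty.prems(3) by (auto simp: power2_eq_1_iff cong_def)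
  then show ?case
    using \<open>b = 0\<close> primitive_char_1 jacobi_sum_1[OF primitive_char_1]
    by (intro exI[of _ "\<lambda>_. 1"]) (simp add: eis_def)
next
  case (insert p S)
  have pr: "\<forall>q\<in>insert p S. prime q" using insert.prems(1) by blast
  note pS = prod_primes_insert[OF insert.hyps(1) pr insert.hyps(2)]
  have pp: "prime p" "[p = 1] (mod 3)" using insert.prems(1) by auto
  have ip: "prime (int p)" using pp by simp
  have key: ?case
    if \<psi>: "primitive_char p \<psi>" "- jacobi_sum p \<psi> = eis c d" and nrm: "c\<^sup>2 - c * d + d\<^sup>2 = int p"
      and cd: "[c = 1] (mod 3)" "[d = 0] (mod 3)" and dvd: "int p dvd b * c - a * d" for \<psi> c d
  proof -
    have N: "a\<^sup>2 - a * b + b\<^sup>2 = int (p * \<Prod>S)" using insert.prems(2) pS(1) by simp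
    obtain x y where xy: "eis a b = eis c d * eis x y" "x\<^sup>2 - x * y + y\<^sup>2 = int (\<Prod>S)"
      "a = c * x - d * y" "b = c * y + d * x - d * y"
      using eis_eq_prime_times[OF nrm pp(1) N dvd] by blast
    have "[c * x - d * y = 1 * x - 0 * y] (mod 3)" "[c * y + d * x - d * y = 1 * y + 0 * x - 0 * y] (mod 3)"
      by (intro cong_diff cong_add cong_mult cd cong_refl)+
    then have "[a = x] (mod 3)" "[b = y] (mod 3)" using xy(3,4) by simp_all
    then have "[x = 1] (mod 3)" "[y = 0] (mod 3)"
      using insert.prems(3,4) by (meson cong_sym cong_trans)+
    then obtain \<chi> where \<chi>: "primitive_char (\<Prod>S) \<chi>" "(- 1) ^ card S * jacobi_sum (\<Prod>S) \<chi> = eis x y"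
      using insert.IH[OF _ xy(2)] insert.prems(1) by blast
    have "primitive_char (\<Prod>(insert p S)) (\<lambda>a. \<psi> a * \<chi> a)"
      unfolding pS(1) by (rule primitive_char_mult[OF pS(3,4,2) \<psi>(1) \<chi>(1)])
    moreover have "jacobi_sum (\<Prod>(insert p S)) (\<lambda>a. \<psi> a * \<chi> a) = jacobi_sum p \<psi> * jacobi_sum (\<Prod>S) \<chi>"
      unfolding pS(1)
      by (rule jacobi_sum_product[OF pS(3,4,2) primitive_cubic[OF \<psi>(1)] primitive_cubic[OF \<chi>(1)]])
    moreover have "(- 1) ^ card (insert p S) * (jacobi_sum p \<psi> * jacobi_sum (\<Prod>S) \<chi>)
      = (- jacobi_sum p \<psi>) * ((- 1) ^ card S * jacobi_sum (\<Prod>S) \<chi>)"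
      using insert.hyps by simp
    ultimately show ?thesis using xy(1) \<psi>(2) \<chi>(2) by metis
  qed
  obtain \<psi> where \<psi>: "primitive_char p \<psi>" using primitive_char_prime_exists pp by blast
  obtain c d where cd: "jacobi_sum p \<psi> = eis c d" "[c = 2] (mod 3)" "[d = 0] (mod 3)"
    using jacobi_sum_prime[OF pp primitive_cubic[OF \<psi>]] by blast
  have p0: "p > 0" using pp prime_gt_0_nat by blast
  have nrm: "c\<^sup>2 - c * d + d\<^sup>2 = int p"
  proof -
    have "of_int (c\<^sup>2 - c * d + d\<^sup>2) = (of_int (int p) :: complex)"
      using jacobi_sum_norm[OF p0 \<psi>] unfolding cd(1) eis_norm by simp
    then show ?thesis by (simp only: of_int_eq_iff)
  qed
  have eis_minus: "- eis u v = eis (- u) (- v)" for u v by (simp add: eis_def)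
  have "[- c = - 2] (mod 3)" "[- d = - 0] (mod 3)" using cd(2,3) by (simp_all only: cong_minus_minus_iff)
  moreover have "[- 2 = (1::int)] (mod 3)" by (simp add: cong_def)
  ultimately have cd': "[- c = 1] (mod 3)" "[- d = 0] (mod 3)" by (auto intro: cong_trans)
  \<comment> \<open>The two factors are the second coordinates of \<open>eis a b\<close> times the
    conjugate of \<open>eis c d\<close> and times \<open>eis c d\<close> itself. Their product is
    divisible by \<open>p\<close> because both norms are.\<close>
  have "(b * c - a * d) * (a * d + b * c - b * d) = b\<^sup>2 * (c\<^sup>2 - c * d + d\<^sup>2) - d\<^sup>2 * (a\<^sup>2 - a * b + b\<^sup>2)"
    by (simp add: power2_eq_square algebra_simps)
  also have "\<dots> = int p * (b\<^sup>2 - d\<^sup>2 * int (\<Prod>S))"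
    unfolding nrm insert.prems(2) pS(1) by (simp add: algebra_simps)
  finally have "int p dvd (b * c - a * d) * (a * d + b * c - b * d)" by simp
  then consider "int p dvd b * c - a * d" | "int p dvd a * d + b * c - b * d"
    using prime_dvd_mult_iff[OF ip] by blast
  then show ?case
  proof cases
    case 1
    have "- (b * c - a * d) = b * (- c) - a * (- d)" by (simp add: algebra_simps)
    then have "int p dvd b * (- c) - a * (- d)" using 1 by (metis dvd_minus_iff)
    then show ?thesis
      by (intro key[OF \<psi>, of "- c" "- d"])
        (use cd' nrm in \<open>auto simp: cd(1) eis_minus power2_eq_square\<close>)
  next
    case 2
    \<comment> \<open>\<open>d - c\<close> and \<open>d\<close> are the coordinates of minus the
      conjugate of \<open>eis c d\<close>, which belongs to the conjugate character.\<close>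
    have "- (a * d + b * c - b * d) = b * (d - c) - a * d" by (simp add: algebra_simps)
    then have *: "int p dvd b * (d - c) - a * d" using 2 by (metis dvd_minus_iff)
    have "[d - c = 0 + 1] (mod 3)" using cong_add[OF cd(3) cd'(1)] by simp
    then show ?thesis
      by (intro key[OF primitive_char_cnj[OF p0 \<psi>], of "d - c" d])
        (use cd nrm * in \<open>auto simp: jacobi_sum_cnj eis_cnj eis_minus power2_eq_square algebra_simps\<close>)
  qed
qed

lemma coprime_9_prod:
  assumes "finite S" "\<And>p. p \<in> S \<Longrightarrow> prime p \<and> [p = 1] (mod (3::nat))"
  shows "coprime 9 (\<Prod>S)" "[\<Prod>S = 1] (mod 3)" "\<Prod>S > 0"
proof -
  have "coprime 3 p" if "p \<in> S" for p :: nat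
  proof -
    have "prime p" "p \<noteq> 3" using assms(2)[OF that] by (auto simp: cong_def)
    then show ?thesis using primes_coprime[of 3 p] by simp
  qed
  then have "coprime 3 (\<Prod>S)" by (intro prod_coprime_right) auto
  then have "coprime (3 ^ 2) (\<Prod>S)" by (simp only: coprime_power_left_iff) simp
  then show "coprime 9 (\<Prod>S)" by simp
  have "[(\<Prod>p\<in>S. p) = (\<Prod>p\<in>S. 1)] (mod 3)" by (rule cong_prod) (use assms in auto)
  then show "[\<Prod>S = 1] (mod 3)" by simp
  show "\<Prod>S > 0" using assms(2) prime_gt_0_nat by (auto intro!: prod_pos)
qed

text \<open>After the sign is removed, the squarefree part is 1 modulo 3 and the part at 9 is 3
  times \<open>zeta 3\<close> or its square. The product is \<open>3 * eis x y\<close> with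
  \<open>y\<close> prime to 3. \<open>M\<close> is its trace and \<open>N\<close> the absolute value
  of \<open>y\<close>; the sign of \<open>y\<close> changes under conjugation, the trace does
  not.\<close>

lemma admissible_of_primitive_char:
  assumes S: "finite S" "\<And>p. p \<in> S \<Longrightarrow> prime p \<and> [p = 1] (mod 3)"
    and \<chi>: "primitive_char (9 * \<Prod>S) \<chi>"
  obtains M N where "admissible_pair (9 * \<Prod>S) M N"
    "(- 1) ^ card S * (jacobi_sum (9 * \<Prod>S) \<chi> + cnj (jacobi_sum (9 * \<Prod>S) \<chi>)) = of_int M"
proof -
  let ?m = "\<Prod>S" and ?J = "jacobi_sum (9 * \<Prod>S) \<chi>"
  note m = coprime_9_prod[OF S]
  obtain \<chi>1 \<chi>2 where d: "primitive_char 9 \<chi>1" "primitive_char ?m \<chi>2" "\<chi> = (\<lambda>a. \<chi>1 a * \<chi>2 a)"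
    using primitive_char_decompose[OF _ m(3,1) \<chi>] by auto
  obtain a b where ab: "jacobi_sum ?m \<chi>2 = eis a b" "[a = (- 1) ^ card S] (mod 3)" "[b = 0] (mod 3)"
    using jacobi_sum_squarefree[OF S d(2)] by blast
  define s :: int where "s = (- 1) ^ card S"
  have s: "s * s = 1" by (simp add: s_def flip: power_add)
  define a' b' where "a' = s * a" and "b' = s * b"
  have ab': "[a' = 1] (mod 3)" "[b' = 0] (mod 3)"
    using cong_mult[OF cong_refl[of s] ab(2)] cong_mult[OF cong_refl[of s] ab(3)]
    by (simp_all add: a'_def b'_def s_def[symmetric] s)
  have J: "?J = jacobi_sum 9 \<chi>1 * eis a b"
    using jacobi_sum_product[OF _ m(3,1) primitive_cubic[OF d(1)] primitive_cubic[OF d(2)]] by (simp add: d(3) ab)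
  have z: "zeta 3 = eis 0 1" "zeta 3 ^ 2 = eis (- 1) (- 1)" by (simp_all add: eis_def zeta3_square)
  have sJ: "of_int s * ?J = jacobi_sum 9 \<chi>1 * eis a' b'"
    unfolding J by (simp add: a'_def b'_def eis_def algebra_simps)
  have "\<exists>x y. of_int s * ?J = 3 * eis x y \<and> [2 * x - y = 2] (mod 3) \<and> \<not> [y = 0] (mod 3)"
    using jacobi_sum_9[OF d(1)]
  proof
    assume *: "jacobi_sum 9 \<chi>1 = 3 * zeta 3"
    have "of_int s * ?J = 3 * eis (- b') (a' - b')" unfolding sJ * z(1) by (simp add: eis_mult)
    moreover have "[2 * (- b') - (a' - b') = 2] (mod 3)" "\<not> [a' - b' = 0] (mod 3)"
      using ab' by - (unfold cong_iff_dvd_diff, presburger+)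
    ultimately show ?thesis by blast
  next
    assume *: "jacobi_sum 9 \<chi>1 = 3 * zeta 3 ^ 2"
    have "of_int s * ?J = 3 * eis (b' - a') (- a')" unfolding sJ * z(2) by (simp add: eis_mult)
    moreover have "[2 * (b' - a') - (- a') = 2] (mod 3)" "\<not> [- a' = 0] (mod 3)"
      using ab' by - (unfold cong_iff_dvd_diff, presburger+)
    ultimately show ?thesis by blast
  qed
  then obtain x y where xy: "of_int s * ?J = 3 * eis x y" "[2 * x - y = 2] (mod 3)" "\<not> [y = 0] (mod 3)"
    by blast
  have "of_int (9 * (x\<^sup>2 - x * y + y\<^sup>2)) = (of_int (s * s * (9 * int ?m)) :: complex)"
  proof -
    have "of_int (9 * (x\<^sup>2 - x * y + y\<^sup>2)) = (3 * eis x y) * cnj (3 * eis x y)"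
      using eis_norm[of x y] by (simp add: mult_ac)
    also have "\<dots> = of_int (s * s) * (?J * cnj ?J)" unfolding xy(1)[symmetric] by simp
    also have "?J * cnj ?J = of_nat (9 * ?m)" by (rule jacobi_sum_norm[OF _ \<chi>]) (use m in simp)
    finally show ?thesis by simp
  qed
  then have n: "x\<^sup>2 - x * y + y\<^sup>2 = int ?m" unfolding of_int_eq_iff s by simp
  show ?thesis
  proof (rule that)
    have "4 * int (9 * ?m) = 36 * (x\<^sup>2 - x * y + y\<^sup>2)" unfolding n by simp
    also have "\<dots> = (3 * (2 * x - y))\<^sup>2 + 27 * \<bar>y\<bar>\<^sup>2"
      by (simp add: power2_eq_square algebra_simps)
    finally have "4 * int (9 * ?m) = \<dots>" .
    moreover have "\<not> [\<bar>y\<bar> = 0] (mod 3)" "\<bar>y\<bar> > 0" using xy(3) by (auto simp: cong_0_iff)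
    ultimately show "admissible_pair (9 * ?m) (3 * (2 * x - y)) \<bar>y\<bar>"
      using xy(2) unfolding admissible_pair_def by blast
    have "(- 1) ^ card S * (?J + cnj ?J) = of_int s * ?J + cnj (of_int s * ?J)"
      by (simp add: s_def algebra_simps)
    also have "\<dots> = 3 * (eis x y + cnj (eis x y))" by (simp add: xy(1))
    finally show "(- 1) ^ card S * (?J + cnj ?J) = of_int (3 * (2 * x - y))" by (simp add: eis_trace)
  qed
qed

text \<open>With \<open>d\<close> equal to \<open>N\<close> up to sign, \<open>3 * eis c d\<close>
  has trace \<open>M\<close> and norm \<open>9 * \<Prod>S\<close>. Splitting off
  \<open>3 * zeta 3\<close> for the modulus 9 leaves an element congruent to 1 modulo 3, which is
  realized prime by prime.\<close>

lemma primitive_char_of_admissible: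
  assumes S: "finite S" "\<And>p. p \<in> S \<Longrightarrow> prime p \<and> [p = 1] (mod 3)"
    and adm: "admissible_pair (9 * \<Prod>S) M N"
  obtains \<chi> where "primitive_char (9 * \<Prod>S) \<chi>"
    "(- 1) ^ card S * (jacobi_sum (9 * \<Prod>S) \<chi> + cnj (jacobi_sum (9 * \<Prod>S) \<chi>)) = of_int M"
proof -
  let ?m = "\<Prod>S"
  note m = coprime_9_prod[OF S]
  obtain M0 where M0: "M = 3 * M0" "[M0 = 2] (mod 3)" and MN: "4 * int (9 * ?m) = M\<^sup>2 + 27 * N\<^sup>2"
    and N: "\<not> [N = 0] (mod 3)"
    using adm unfolding admissible_pair_def by blast
  \<comment> \<open>The sign is chosen so that the unit to be split off at 9 is
    \<open>zeta 3\<close>, not its square.\<close>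
  define d where "d = (if [N = 1] (mod 3) then N else - N)"
  have d: "[d = 1] (mod 3)" "d\<^sup>2 = N\<^sup>2"
    using N unfolding d_def cong_def by (auto simp: zmod_zminus1_eq_if split: if_splits)
  have 4: "4 * int ?m = M0\<^sup>2 + 3 * d\<^sup>2" using MN M0 d(2) by (simp add: power_mult_distrib)
  have "even (M0\<^sup>2 + 3 * d\<^sup>2)" unfolding 4[symmetric] by simp
  then have "even (M0 + d)" by simp
  then obtain c where c: "M0 + d = 2 * c" by blast
  have "4 * (c\<^sup>2 - c * d + d\<^sup>2) = (2 * c - d)\<^sup>2 + 3 * d\<^sup>2" by (simp add: power2_eq_square algebra_simps)
  also have "2 * c - d = M0" using c by simp
  finally have nc: "c\<^sup>2 - c * d + d\<^sup>2 = int ?m" using 4 by simp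
  \<comment> \<open>\<open>d - c\<close> and \<open>- c\<close> are the coordinates of
    \<open>eis c d\<close> divided by \<open>zeta 3\<close>.\<close>
  have "(d - c)\<^sup>2 - (d - c) * (- c) + (- c)\<^sup>2 = int ?m"
    using nc by (simp add: power2_eq_square algebra_simps)
  moreover have "[d - c = 1] (mod 3)" "[- c = 0] (mod 3)"
    using c d(1) M0(2) by - (unfold cong_iff_dvd_diff, presburger+)
  ultimately obtain \<chi>2 where \<chi>2: "primitive_char ?m \<chi>2" "(- 1) ^ card S * jacobi_sum ?m \<chi>2 = eis (d - c) (- c)"
    using jacobi_sum_realize[OF S] by blast
  obtain \<psi> where \<psi>: "primitive_char 9 \<psi>" "jacobi_sum 9 \<psi> = 3 * zeta 3"
  proof -
    obtain \<psi> where \<psi>: "primitive_char 9 \<psi>" by (rule primitive_char_9_exists)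
    have "cnj (zeta 3 ^ 2) = zeta 3" by (simp add: cnj_zeta3 zeta3_square power2_eq_square algebra_simps)
       (simp add: zeta3_square power2_eq_square[symmetric])
    then show ?thesis
      using jacobi_sum_9[OF \<psi>] \<psi> primitive_char_cnj[OF _ \<psi>] jacobi_sum_cnj[of 9 \<psi>] that by force
  qed
  let ?\<chi> = "\<lambda>a. \<psi> a * \<chi>2 a"
  have p: "primitive_char (9 * ?m) ?\<chi>" by (rule primitive_char_mult[OF _ m(3,1) \<psi>(1) \<chi>2(1)]) simp
  have J: "jacobi_sum (9 * ?m) ?\<chi> = 3 * zeta 3 * jacobi_sum ?m \<chi>2"
    using jacobi_sum_product[OF _ m(3,1) primitive_cubic[OF \<psi>(1)] primitive_cubic[OF \<chi>2(1)]] \<psi>(2) by simp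
  have "(- 1) ^ card S * jacobi_sum (9 * ?m) ?\<chi> = 3 * (eis 0 1 * eis (d - c) (- c))"
    unfolding J \<chi>2(2)[symmetric] by (simp add: eis_def)
  also have "\<dots> = 3 * eis c d" by (simp add: eis_mult)
  finally have e: "(- 1) ^ card S * jacobi_sum (9 * ?m) ?\<chi> = 3 * eis c d" .
  have "(- 1) ^ card S * (jacobi_sum (9 * ?m) ?\<chi> + cnj (jacobi_sum (9 * ?m) ?\<chi>))
    = (- 1) ^ card S * jacobi_sum (9 * ?m) ?\<chi> + cnj ((- 1) ^ card S * jacobi_sum (9 * ?m) ?\<chi>)"
    by (simp add: algebra_simps)
  also have "\<dots> = of_int (3 * (2 * c - d))"
    unfolding e using eis_trace[of c d] by (simp flip: distrib_left)
  also have "3 * (2 * c - d) = M" using c M0(1) by simp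
  finally show ?thesis using that p by blast
qed


section \<open>The cubic equation of the periods\<close>

text \<open>For \<open>z = 1\<close> this is the sum over the kernel; the other two cube roots of
  unity give its conjugates.\<close>

definition cubic_period :: "nat \<Rightarrow> (int \<Rightarrow> complex) \<Rightarrow> complex \<Rightarrow> complex" where
  "cubic_period n \<chi> z = (\<Sum>a\<in>{0..<int n}. if \<chi> a = z then zeta n powi a else 0)"

text \<open>Adding \<open>n / 3\<close> to the exponent preserves coprimality, as \<open>n\<close>
  and \<open>n / 3\<close> have the same prime divisors when 9 divides \<open>n\<close>, and it
  multiplies every term by the same nontrivial root of unity.\<close>

lemma sum_coprime_zeta_powi:
  assumes n: "n > 0" "9 dvd n"
  shows "(\<Sum>a\<in>{0..<int n}. if coprime a (int n) then zeta n powi a else 0) = 0"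
proof -
  obtain m where m: "n = 9 * m" using n(2) by blast
  let ?h = "\<lambda>a. if coprime a (int n) then zeta n powi a else 0"
  have cop: "coprime (a + 3 * int m) (int n) \<longleftrightarrow> coprime a (int n)" for a
  proof -
    have "coprime b (int n) \<longleftrightarrow> coprime b (3 * int m)" for b
      using coprime_power_right_iff[of b 3 2] by (simp add: m)
    then show ?thesis by (simp add: coprime_iff_gcd_eq_1)
  qed
  have w: "zeta n powi (3 * int m) \<noteq> 1"
  proof -
    have "m > 0" using n(1) by (simp add: m)
    then have "\<not> int n dvd 3 * int m" using zdvd_imp_le[of "int n" "3 * int m"] by (auto simp: m)
    then show ?thesis using zeta_powi_eq_1_iff[OF n(1)] by blast
  qed
  have "(\<Sum>a\<in>{0..<int n}. ?h a) = (\<Sum>a\<in>{0..<int n}. ?h (a + 3 * int m))"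
  proof (rule sum_residues_reindex[where T = "\<lambda>a. a + 3 * int m" and h = ?h, symmetric])
    fix a b assume ab: "[a = b] (mod int n)"
    then have "coprime a (int n) \<longleftrightarrow> coprime b (int n)" using cong_imp_coprime cong_sym by blast
    then show "?h a = ?h b" using zeta_powi_cong[OF ab] by simp
  qed (use n in \<open>auto simp: cong_add_rcancel\<close>)
  also have "\<dots> = zeta n powi (3 * int m) * (\<Sum>a\<in>{0..<int n}. ?h a)"
    unfolding sum_distrib_left
    unfolding cop by (rule sum.cong) (simp_all add: power_int_add mult.commute[of "zeta n powi (3 * int m)"])
  finally show ?thesis using w by (metis mult_cancel_right1)
qed

context
  fixes n :: nat and \<chi> :: "int \<Rightarrow> complex"
  assumes n: "n > 0" "9 dvd n" and \<chi>: "primitive_char n \<chi>"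
begin

text \<open>Fourier inversion on the group of order 3: with \<open>w = z ^ 2 * \<chi> a\<close>, the
  sum \<open>1 + w + w ^ 2\<close> is 3 on the fibre over \<open>z\<close> and 0 on the other units.
  The contribution of the constant 1 vanishes by \<open>sum_coprime_zeta_powi\<close>.\<close>

lemma cubic_period_gauss:
  assumes z: "z ^ 3 = 1"
  shows "3 * cubic_period n \<chi> z = z ^ 2 * gauss_sum n \<chi> + z * cnj (gauss_sum n \<chi>)"
proof -
  note C = n(1) primitive_cubic[OF \<chi>]
  have ind: "(if coprime a (int n) then zeta n powi a else 0) + z ^ 2 * (\<chi> a * zeta n powi a)
      + z * (cnj (\<chi> a) * zeta n powi a) = 3 * (if \<chi> a = z then zeta n powi a else 0)" for a
  proof (cases "coprime a (int n)")
    case True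
    define w where "w = z ^ 2 * \<chi> a"
    have c: "\<chi> a ^ 3 = 1" using cubic_char_cube[OF C True] .
    have "z ^ 6 = (z ^ 3) ^ 2" "z ^ 4 = z ^ 3 * z" by (simp_all add: power_numeral_reduce)
    then have w3: "w ^ 3 = 1" "w ^ 2 = z * cnj (\<chi> a)"
      using z c by (simp_all add: w_def power_mult_distrib cubic_char_cnj[OF C])
    have iff: "\<chi> a = z \<longleftrightarrow> w = 1"
    proof
      assume "\<chi> a = z" then show "w = 1" using z by (simp add: w_def power3_eq_cube power2_eq_square)
    next
      assume "w = 1"
      then have "z = z * w" by simp
      also have "\<dots> = z ^ 3 * \<chi> a" by (simp add: w_def power3_eq_cube power2_eq_square)
      finally show "\<chi> a = z" using z by simp
    qed
    have "1 + w + w ^ 2 = (if w = 1 then 3 else 0)"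
    proof (cases "w = 1")
      case False
      have "(w - 1) * (1 + w + w ^ 2) = 0" using w3(1) by (simp add: algebra_simps power3_eq_cube power2_eq_square)
      then show ?thesis using False by simp
    qed simp
    then have "(1 + w + w ^ 2) * zeta n powi a = 3 * (if \<chi> a = z then zeta n powi a else 0)"
      unfolding iff by simp
    then show ?thesis unfolding w3(2) using True by (simp add: w_def algebra_simps)
  next
    case False
    then show ?thesis using cubic_char_zero[OF C False] z by auto
  qed
  have "3 * cubic_period n \<chi> z = (\<Sum>a\<in>{0..<int n}. 3 * (if \<chi> a = z then zeta n powi a else 0))"
    by (simp add: cubic_period_def sum_distrib_left)
  also have "\<dots> = 0 + z ^ 2 * gauss_sum n \<chi> + z * gauss_sum n (\<lambda>a. cnj (\<chi> a))"
    unfolding ind[symmetric] sum.distrib gauss_sum_def sum_distrib_left[symmetric] sum_coprime_zeta_powi[OF n] ..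
  finally show ?thesis using gauss_sum_cnj[OF C] by simp
qed

text \<open>Cardano's identity for \<open>u + v\<close>: here \<open>u * v = n\<close>, and
  \<open>u ^ 3\<close> and \<open>v ^ 3\<close> are \<open>n\<close> times the Jacobi sum and its
  conjugate, independently of the cube root \<open>z\<close>.\<close>

lemma cubic_period_poly:
  assumes z: "z ^ 3 = 1"
  shows "27 * cubic_period n \<chi> z ^ 3 = of_nat n * (jacobi_sum n \<chi> + cnj (jacobi_sum n \<chi>))
    + 9 * of_nat n * cubic_period n \<chi> z"
proof -
  let ?G = "gauss_sum n \<chi>" and ?J = "jacobi_sum n \<chi>" and ?y = "cubic_period n \<chi> z"
  define u v where "u = z ^ 2 * ?G" and "v = z * cnj ?G"
  have y: "3 * ?y = u + v" using cubic_period_gauss[OF z] by (simp add: u_def v_def)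
  have G: "?G * cnj ?G = of_nat n" "?G ^ 2 = ?J * cnj ?G"
    using gauss_sum_norm[OF n(1) \<chi>] gauss_sum_square[OF n(1) \<chi>] by blast+
  have uv: "u * v = of_nat n"
    using z G(1) by (simp add: u_def v_def power3_eq_cube power2_eq_square mult_ac)
  have G3: "?G ^ 3 = of_nat n * ?J"
  proof -
    have "?G ^ 3 = ?G * ?G ^ 2" by (simp add: power3_eq_cube power2_eq_square)
    also have "\<dots> = (?G * cnj ?G) * ?J" unfolding G(2) by (simp only: mult_ac)
    finally show ?thesis unfolding G(1) .
  qed
  have "cnj ?G ^ 3 = of_nat n * cnj ?J" using arg_cong[OF G3, of cnj] by simp
  moreover have "z ^ 6 = (z ^ 3) ^ 2" by simp
  ultimately have u3: "u ^ 3 = of_nat n * ?J" "v ^ 3 = of_nat n * cnj ?J"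
    using z G3 by (simp_all add: u_def v_def power_mult_distrib)
  have "27 * ?y ^ 3 = (3 * ?y) ^ 3" by (simp add: power_mult_distrib)
  also have "\<dots> = u ^ 3 + v ^ 3 + 3 * (u * v) * (u + v)"
    unfolding y by (simp add: power3_eq_cube algebra_simps)
  also have "\<dots> = of_nat n * (?J + cnj ?J) + 9 * of_nat n * ?y"
    unfolding u3 uv y[symmetric] by (simp add: algebra_simps)
  finally show ?thesis .
qed

lemma cubic_period_sum: "cubic_period n \<chi> 1 + cubic_period n \<chi> (zeta 3) + cubic_period n \<chi> (zeta 3 ^ 2) = 0"
proof -
  let ?G = "gauss_sum n \<chi>"
  have "(zeta 3 ^ 2) ^ 3 = 1" "(zeta 3 ^ 2) ^ 2 = zeta 3"
    by (simp_all add: zeta3_square power3_eq_cube power2_eq_square[of "- 1 - zeta 3"] algebra_simps)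
      (simp_all add: zeta3_square algebra_simps flip: power2_eq_square)
  then have "3 * (cubic_period n \<chi> 1 + cubic_period n \<chi> (zeta 3) + cubic_period n \<chi> (zeta 3 ^ 2))
    = (1 + zeta 3 + zeta 3 ^ 2) * ?G + (1 + zeta 3 + zeta 3 ^ 2) * cnj ?G"
    using cubic_period_gauss[of 1] cubic_period_gauss[OF zeta3_cube] cubic_period_gauss[of "zeta 3 ^ 2"]
    by (simp add: algebra_simps)
  also have "\<dots> = 0" by (simp add: zeta3_square)
  finally show ?thesis by (simp only: mult_eq_0_iff) simp
qed

end

text \<open>Modulo 9 the equation reads \<open>c = y\<^sup>3 - 3 y\<close>, and the right-hand side is never a square root of 1.\<close>

lemma cubic_no_int_root:
  fixes m y c :: int
  assumes "[m = 1] (mod 3)" "[c\<^sup>2 = 1] (mod 9)" "y ^ 3 = 3 * m * y + c"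
  shows False
proof -
  obtain k where k: "m = 1 + 3 * k" using assms(1) by (metis cong_iff_lin cong_sym mult.commute)
  have "c = (y ^ 3 - 3 * y) + 9 * (- k * y)" using assms(3) by (simp add: k algebra_simps)
  then have "[c = y ^ 3 - 3 * y] (mod 9)" by (simp add: cong_iff_dvd_diff)
  also have "[y ^ 3 - 3 * y = (y mod 9) ^ 3 - 3 * (y mod 9)] (mod 9)"
    by (intro cong_diff cong_mult cong_pow) (simp_all add: cong_def)
  finally have "[c\<^sup>2 = ((y mod 9) ^ 3 - 3 * (y mod 9))\<^sup>2] (mod 9)" by (rule cong_pow)
  then have sq: "(((y mod 9) ^ 3 - 3 * (y mod 9))\<^sup>2) mod 9 = 1" using assms(2) by (simp add: cong_def)
  have all: "\<forall>r\<in>{0,1,2,3,4,5,6,7,8::int}. ((r ^ 3 - 3 * r)\<^sup>2) mod 9 \<noteq> 1" by simp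
  from bspec[OF all mod_9_cases[of y]] sq show False by contradiction
qed

text \<open>A rational root of a monic integer polynomial is an integer.\<close>

lemma cubic_no_rat_root:
  fixes m c :: int and y :: rat
  assumes "[m = 1] (mod 3)" "[c\<^sup>2 = 1] (mod 9)" "y ^ 3 = 3 * of_int m * y + of_int c"
  shows False
proof -
  obtain p q where pq: "quotient_of y = (p, q)" by (cases "quotient_of y")
  note q = quotient_of_denom_pos[OF pq] quotient_of_coprime[OF pq]
  define u v :: rat where "u = of_int p" and "v = of_int q"
  have v: "v \<noteq> 0" "y = u / v" using q(1) quotient_of_div[OF pq] by (simp_all add: u_def v_def)
  have "u ^ 3 = v ^ 3 * y ^ 3" using v by (simp add: power_divide)
  also have "\<dots> = v * (3 * of_int m * u * v + of_int c * v\<^sup>2)"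
    unfolding assms(3) unfolding v(2) using v(1) by (simp add: power3_eq_cube power2_eq_square algebra_simps)
  finally have "of_int (p ^ 3) = (of_int (q * (3 * m * p * q + c * q\<^sup>2)) :: rat)"
    by (simp add: u_def v_def)
  then have "p ^ 3 = q * (3 * m * p * q + c * q\<^sup>2)" by (simp only: of_int_eq_iff)
  then have "q dvd p ^ 3" by simp
  moreover have "coprime (p ^ 3) q" using q(2) by simp
  ultimately have "q = 1" using q(1) coprime_absorb_right[of q "p ^ 3"] by simp
  then have "of_int (p ^ 3) = (of_int (3 * m * p + c) :: rat)" using assms(3) v(2) by (simp add: u_def v_def)
  then have "p ^ 3 = 3 * m * p + c" by (simp only: of_int_eq_iff)
  then show False by (rule cubic_no_int_root[OF assms(1,2)])
qed

section \<open>Irreducibility of the cyclotomic polynomials\<close>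

definition rpoly :: "rat poly \<Rightarrow> complex \<Rightarrow> complex" where
  "rpoly g x = poly (map_poly of_rat g) x"

lemma rpoly_0 [simp]: "rpoly 0 x = 0"
  by (simp add: rpoly_def)

lemma rpoly_pCons [simp]: "rpoly (pCons c g) x = of_rat c + x * rpoly g x"
  by (simp add: rpoly_def map_poly_pCons)

lemma rpoly_1 [simp]: "rpoly 1 x = 1"
  by (simp add: rpoly_def)

lemma rpoly_smult [simp]: "rpoly (smult c g) x = of_rat c * rpoly g x"
  by (induction g) (simp_all add: of_rat_mult algebra_simps)

lemma rpoly_add [simp]: "rpoly (g + h) x = rpoly g x + rpoly h x"
  by (induction g h rule: poly_induct2) (simp_all add: of_rat_add algebra_simps)

lemma rpoly_minus [simp]: "rpoly (- g) x = - rpoly g x"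
  using rpoly_smult[of "- 1" g x] by (simp add: of_rat_minus)

lemma rpoly_diff [simp]: "rpoly (g - h) x = rpoly g x - rpoly h x"
  using rpoly_add[of g "- h" x] by simp

lemma rpoly_mult [simp]: "rpoly (g * h) x = rpoly g x * rpoly h x"
  by (induction g) (simp_all add: algebra_simps)

lemma rpoly_pcompose [simp]: "rpoly (pcompose g h) x = rpoly g (rpoly h x)"
  by (induction g) (simp_all add: pcompose_pCons)

lemma rpoly_monom [simp]: "rpoly (monom c k) x = of_rat c * x ^ k"
  by (induction k) (simp_all add: monom_0 monom_Suc)

text \<open>Such a functional replaces norms and integral bases: it is used to bound the primes that
  divide a nonzero element of Z[zeta].\<close>

lemma rational_functional:
  fixes y :: complex
  assumes "y \<noteq> 0"
  obtains l :: "complex \<Rightarrow> rat" where "\<And>x z. l (x + z) = l x + l z" "\<And>q x. l (of_rat q * x) = q * l x" "l y = 1"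
proof -
  interpret vector_space_pair "\<lambda>q (x::complex). of_rat q * x" "(*) :: rat \<Rightarrow> rat \<Rightarrow> rat"
    by unfold_locales (auto simp: algebra_simps of_rat_add of_rat_mult)
  define l where "l = construct {y} (\<lambda>_. 1)"
  have ind: "vs1.independent {y}"
    using assms vs1.dependent_single by blast
  interpret l: Vector_Spaces.linear "\<lambda>q (x::complex). of_rat q * x" "(*) :: rat \<Rightarrow> rat \<Rightarrow> rat" l
    unfolding l_def by (rule linear_construct[OF ind])
  show ?thesis
    by (rule that[of l]) (simp_all add: l.add l.scale, simp add: l_def construct_basis[OF ind])
qed

section \<open>The ring Z[z] and the Frobenius map modulo a prime\<close>

definition int_adjoin :: "complex \<Rightarrow> complex set" where
  "int_adjoin z = range (\<lambda>g. poly (map_poly of_int g) z)"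

lemma int_poly_pCons: "poly (map_poly of_int (pCons c g)) z = of_int c + z * poly (map_poly of_int g) (z::complex)"
  by (simp add: map_poly_pCons)

lemma int_poly_add: "poly (map_poly of_int (g + h)) z = poly (map_poly of_int g) z + poly (map_poly of_int h) (z::complex)"
  by (induction g h rule: poly_induct2) (simp_all add: int_poly_pCons algebra_simps)

lemma int_poly_smult: "poly (map_poly of_int (smult c g)) z = of_int c * poly (map_poly of_int g) (z::complex)"
  by (induction g) (simp_all add: int_poly_pCons algebra_simps)

lemma int_poly_mult: "poly (map_poly of_int (g * h)) z = poly (map_poly of_int g) z * poly (map_poly of_int h) (z::complex)"
  by (induction g) (simp_all add: int_poly_pCons int_poly_add int_poly_smult algebra_simps)

lemma int_adjoin_closed:
  "x \<in> int_adjoin z \<Longrightarrow> y \<in> int_adjoin z \<Longrightarrow> x + y \<in> int_adjoin z"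
  "x \<in> int_adjoin z \<Longrightarrow> y \<in> int_adjoin z \<Longrightarrow> x * y \<in> int_adjoin z"
  "of_int c \<in> int_adjoin z" "z \<in> int_adjoin z"
proof -
  show "x \<in> int_adjoin z \<Longrightarrow> y \<in> int_adjoin z \<Longrightarrow> x + y \<in> int_adjoin z"
    unfolding int_adjoin_def by (force simp: int_poly_add[symmetric])
  show "x \<in> int_adjoin z \<Longrightarrow> y \<in> int_adjoin z \<Longrightarrow> x * y \<in> int_adjoin z"
    unfolding int_adjoin_def by (force simp: int_poly_mult[symmetric])
  show "of_int c \<in> int_adjoin z"
    unfolding int_adjoin_def by (rule range_eqI[of _ _ "[:c:]"]) (simp add: map_poly_pCons)
  show "z \<in> int_adjoin z"
    unfolding int_adjoin_def by (rule range_eqI[of _ _ "[:0, 1:]"]) (simp add: map_poly_pCons)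
qed

lemma int_adjoin_power: "x \<in> int_adjoin z \<Longrightarrow> x ^ k \<in> int_adjoin z"
  using int_adjoin_closed(3)[of 1 z] by (induction k) (auto intro: int_adjoin_closed(2))

lemma int_adjoin_sum: "(\<And>i. i \<in> A \<Longrightarrow> f i \<in> int_adjoin z) \<Longrightarrow> sum f A \<in> int_adjoin z"
  using int_adjoin_closed(3)[of 0 z]
  by (induction A rule: infinite_finite_induct) (auto intro: int_adjoin_closed(1))

lemma int_adjoin_poly:
  "x \<in> int_adjoin z \<Longrightarrow> poly (map_poly of_int g) x \<in> int_adjoin z"
  using int_adjoin_closed(3)[of 0 z]
  by (induction g) (auto simp: int_poly_pCons intro: int_adjoin_closed)

lemma int_fermat:
  assumes "prime p"
  shows "int p dvd c ^ p - c"
proof -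
  define b where "b = nat (c mod int p)"
  have p: "p > 0" using assms prime_gt_0_nat by blast
  have bc: "[int b = c] (mod int p)" using p by (simp add: b_def cong_def)
  have "[b ^ p = b] (mod p)"
  proof (cases "p dvd b")
    case True
    then have "p dvd b ^ p" using p by (simp add: dvd_power_le dvd_trans dvd_power)
    then show ?thesis using True by (simp add: cong_def)
  next
    case False
    have "[b ^ (p - 1) * b = 1 * b] (mod p)"
      by (intro cong_mult fermat_theorem[OF assms False] cong_refl)
    moreover have "b ^ (p - 1) * b = b ^ p" using p by (metis power_minus_mult)
    ultimately show ?thesis by simp
  qed
  then have "[int b ^ p = int b] (mod int p)" by (metis cong_int_iff of_nat_power)
  then have "[c ^ p = c] (mod int p)"
    using bc cong_pow[OF bc, of p] by (meson cong_sym cong_trans)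
  then show ?thesis by (simp add: cong_iff_dvd_diff)
qed

lemma int_adjoin_frobenius_add:
  assumes p: "prime p" and x: "x \<in> int_adjoin z" and y: "y \<in> int_adjoin z"
  shows "\<exists>r\<in>int_adjoin z. (x + y) ^ p - (x ^ p + y ^ p) = of_nat p * r"
proof -
  have p1: "p > 1" using p prime_gt_1_nat by blast
  define r where "r = (\<Sum>k\<in>{1..<p}. of_int (int ((p choose k) div p)) * (x ^ k * y ^ (p - k)))"
  have "r \<in> int_adjoin z"
    unfolding r_def by (intro int_adjoin_sum int_adjoin_closed(2,3) int_adjoin_power x y)
  moreover have "(x + y) ^ p = x ^ p + y ^ p + of_nat p * r"
  proof -
    have split: "{..p} = insert 0 (insert p {1..<p})" using p1 by auto
    have "(x + y) ^ p = (\<Sum>k\<le>p. of_nat (p choose k) * x ^ k * y ^ (p - k))" by (rule binomial_ring)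
    also have "\<dots> = y ^ p + x ^ p + (\<Sum>k\<in>{1..<p}. of_nat (p choose k) * x ^ k * y ^ (p - k))"
      unfolding split using p1 by (subst sum.insert, simp, simp, subst sum.insert) auto
    also have "(\<Sum>k\<in>{1..<p}. of_nat (p choose k) * x ^ k * y ^ (p - k)) = of_nat p * r"
      unfolding r_def sum_distrib_left
    proof (rule sum.cong)
      fix k assume k: "k \<in> {1..<p}"
      have "p dvd (p choose k)" using dvd_choose_prime[of k p] k p by simp
      then have "of_nat (p choose k) = (of_nat p * of_nat ((p choose k) div p) :: complex)"
        by (simp flip: of_nat_mult)
      then show "of_nat (p choose k) * x ^ k * y ^ (p - k)
        = of_nat p * (of_int (int ((p choose k) div p)) * (x ^ k * y ^ (p - k)))"
        by (simp add: mult.assoc)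
    qed simp
    finally show ?thesis by (simp add: add_ac)
  qed
  ultimately show ?thesis by (intro bexI[of _ r]) simp_all
qed

text \<open>Induction on the coefficients: Fermat's little theorem handles each coefficient, and
  divisibility of the binomial coefficients by \<open>p\<close> handles the sum.\<close>

lemma int_poly_frobenius:
  assumes p: "prime p" and x: "x \<in> int_adjoin z"
  shows "\<exists>r\<in>int_adjoin z. poly (map_poly of_int g) (x ^ p) - poly (map_poly of_int g) x ^ p = of_nat p * r"
proof (induction g)
  case 0
  have "p > 0" using p prime_gt_0_nat by blast
  then show ?case using int_adjoin_closed(3)[of 0 z] by (intro bexI[of _ 0]) auto
next
  case (pCons c g)
  let ?g = "poly (map_poly of_int g)"
  obtain r where r: "r \<in> int_adjoin z" "?g (x ^ p) - ?g x ^ p = of_nat p * r" using pCons.IH by blast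
  obtain s where s: "s \<in> int_adjoin z" "(of_int c + x * ?g x) ^ p - (of_int c ^ p + (x * ?g x) ^ p) = of_nat p * s"
    using int_adjoin_frobenius_add[OF p int_adjoin_closed(3) int_adjoin_closed(2)[OF x int_adjoin_poly[OF x]]] by blast
  obtain t where t: "c ^ p - c = int p * t" using int_fermat[OF p] by blast
  have t': "of_int c ^ p = (of_int c + of_nat p * of_int t :: complex)"
    using arg_cong[OF t, of "of_int :: int \<Rightarrow> complex"] by (simp add: algebra_simps)
  have "poly (map_poly of_int (pCons c g)) (x ^ p) - poly (map_poly of_int (pCons c g)) x ^ p
     = of_nat p * (x ^ p * r + of_int (- 1) * (s + of_int t))"
  proof -
    have e1: "?g (x ^ p) = ?g x ^ p + of_nat p * r" using r(2) by (simp add: algebra_simps)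
    have e2: "(of_int c + x * ?g x) ^ p = of_int c + of_nat p * of_int t + x ^ p * ?g x ^ p + of_nat p * s"
      using s(2) unfolding t' by (simp add: algebra_simps power_mult_distrib)
    show ?thesis unfolding int_poly_pCons e1 e2 by (simp add: algebra_simps)
  qed
  then show ?case
    by (intro bexI[of _ "x ^ p * r + of_int (- 1) * (s + of_int t)"])
      (auto intro!: int_adjoin_closed(1,2) int_adjoin_closed(3) int_adjoin_power x r s
         simp del: of_int_minus)
qed

lemma zeta_power_mod: "zeta n ^ k = zeta n ^ (k mod n)"
proof -
  have "zeta n ^ k = (zeta n ^ n) ^ (k div n) * zeta n ^ (k mod n)"
    by (metis mult_div_mod_eq power_add power_mult)
  then show ?thesis by simp
qed

text \<open>As a group, Z[zeta] is generated by the finitely many powers \<open>zeta n ^ i\<close>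
  with \<open>i < n\<close>, so the product of the denominators of their images is a common
  denominator.\<close>

lemma int_adjoin_zeta_functional:
  assumes n: "n > 0" and y: "y \<noteq> 0"
  shows "\<exists>(l :: complex \<Rightarrow> rat) (D :: int). D > 0 \<and> l y = 1 \<and>
    (\<forall>q x. l (of_rat q * x) = q * l x) \<and> (\<forall>r\<in>int_adjoin (zeta n). of_int D * l r \<in> \<int>)"
proof -
  obtain l where l: "\<And>x z. l (x + z) = l x + l z" "\<And>q x. l (of_rat q * x) = q * l x" "l y = 1"
    using rational_functional[OF y] by blast
  let ?d = "\<lambda>i. snd (quotient_of (l (zeta n ^ i)))"
  define D where "D = (\<Prod>i<n. ?d i)"
  have D: "D > 0" unfolding D_def by (intro prod_pos) (simp add: quotient_of_denom_pos')
  have pw: "of_int D * l (zeta n ^ k) \<in> \<int>" for k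
  proof -
    have km: "k mod n < n" using n by simp
    obtain a b where ab: "quotient_of (l (zeta n ^ (k mod n))) = (a, b)" by force
    have "b dvd D" unfolding D_def using km ab by (metis dvd_prodI finite_lessThan lessThan_iff snd_conv)
    then obtain e where "D = b * e" by blast
    moreover have "b > 0" "l (zeta n ^ k) = of_int a / of_int b"
      using ab quotient_of_denom_pos[OF ab] quotient_of_div[OF ab] zeta_power_mod[of n k] by auto
    ultimately have "of_int D * l (zeta n ^ k) = of_int (e * a)" by simp
    then show ?thesis by (metis Ints_of_int)
  qed
  have "of_int D * l (zeta n ^ k * poly (map_poly of_int g) (zeta n)) \<in> \<int>" for g k
  proof (induction g arbitrary: k)
    case 0
    have "l 0 = 0" using l(1)[of 0 0] by simp
    then show ?case by simp
  next
    case (pCons c g)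
    have "zeta n ^ k * poly (map_poly of_int (pCons c g)) (zeta n)
      = of_rat (of_int c) * zeta n ^ k + zeta n ^ Suc k * poly (map_poly of_int g) (zeta n)"
      by (simp add: int_poly_pCons algebra_simps)
    then have "of_int D * l (zeta n ^ k * poly (map_poly of_int (pCons c g)) (zeta n))
      = of_int c * (of_int D * l (zeta n ^ k)) + of_int D * l (zeta n ^ Suc k * poly (map_poly of_int g) (zeta n))"
      by (simp only: l algebra_simps)
    then show ?case using pw[of k] pCons.IH[of "Suc k"] by (simp only: Ints_add Ints_mult Ints_of_int)
  qed
  from this[of 0] have "of_int D * l r \<in> \<int>" if "r \<in> int_adjoin (zeta n)" for r
    using that unfolding int_adjoin_def by auto
  then show ?thesis using D l by (intro exI[of _ l] exI[of _ D]) simp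
qed

text \<open>Landau's argument: if \<open>g(\<zeta>\<^sup>j) = 0\<close>, then \<open>g(\<zeta>\<^sup>j\<^sup>p)\<close> is \<open>p\<close> times an element of \<open>\<int>[\<zeta>]\<close>, and each of
  the finitely many nonzero values of \<open>g\<close> at powers of \<open>\<zeta>\<close> has only finitely many such \<open>p\<close>.\<close>

lemma zeta_conj_large_prime:
  assumes n: "n > 0"
  shows "\<exists>B. \<forall>p j. prime p \<and> p > B \<and> poly (map_poly of_int g) (zeta n ^ j) = 0 \<longrightarrow>
    poly (map_poly of_int g) (zeta n ^ (j * p)) = 0"
proof -
  let ?g = "\<lambda>k. poly (map_poly of_int g) (zeta n ^ k)"
  have "\<exists>D::int. y \<noteq> 0 \<longrightarrow> D > 0 \<and> (\<forall>p r. r \<in> int_adjoin (zeta n) \<and> y = of_nat p * r \<longrightarrow> int p dvd D)" for y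
  proof (cases "y = 0")
    case False
    obtain l :: "complex \<Rightarrow> rat" and D :: int where l: "D > 0" "l y = 1"
      "\<And>q x. l (of_rat q * x) = q * l x" "\<And>r. r \<in> int_adjoin (zeta n) \<Longrightarrow> of_int D * l r \<in> \<int>"
      using int_adjoin_zeta_functional[OF n False] by auto
    have "int p dvd D" if r: "r \<in> int_adjoin (zeta n)" "y = of_nat p * r" for p r
    proof -
      \<comment> \<open>Dividing \<open>y\<close> by \<open>p\<close> inside Z[zeta] produces a
        value of \<open>l\<close> equal to \<open>1 / p\<close>, so \<open>p\<close> divides the
        common denominator \<open>D\<close>.\<close>
      have "1 = of_nat p * l r" using l(3)[of "of_nat p" r] l(2) r(2) by simp
      moreover obtain e where "of_int D * l r = of_int e" using l(4)[OF r(1)] by (auto elim: Ints_cases)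
      ultimately have "of_int D = (of_int (int p * e) :: rat)"
        by (metis mult.left_commute mult.right_neutral of_int_mult of_int_of_nat_eq)
      then show ?thesis by (simp only: of_int_eq_iff) simp
    qed
    then show ?thesis using l(1) by blast
  qed simp
  then obtain D :: "complex \<Rightarrow> int" where
    D: "\<And>y. y \<noteq> 0 \<Longrightarrow> D y > 0 \<and> (\<forall>p r. r \<in> int_adjoin (zeta n) \<and> y = of_nat p * r \<longrightarrow> int p dvd D y)"
    by metis
  \<comment> \<open>Exponents count only modulo \<open>n\<close>, so finitely many bounds suffice;
    their sum stands in for the maximum.\<close>
  define B where "B = (\<Sum>k<n. nat (D (?g k)))"
  have "?g (j * p) = 0" if p: "prime p" "p > B" and j: "?g j = 0" for p j
  proof (rule ccontr)
    define k where "k = (j * p) mod n"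
    assume "?g (j * p) \<noteq> 0"
    then have nz: "?g k \<noteq> 0" unfolding k_def using zeta_power_mod[of n "j * p"] by simp
    have p0: "p > 0" using p prime_gt_0_nat by blast
    obtain r where r: "r \<in> int_adjoin (zeta n)" "?g (j * p) - ?g j ^ p = of_nat p * r"
      using int_poly_frobenius[OF p(1) int_adjoin_power[OF int_adjoin_closed(4), of "zeta n" j], of g]
      by (auto simp: power_mult)
    then have "?g k = of_nat p * r" unfolding k_def using zeta_power_mod[of n "j * p"] j p0 by (simp add: zero_power)
    then have "int p dvd D (?g k)" "D (?g k) > 0" using D[OF nz] r(1) by blast+
    then have "p \<le> nat (D (?g k))" using zdvd_imp_le by fastforce
    also have "\<dots> \<le> B" unfolding B_def by (rule member_le_sum) (use n in \<open>auto simp: k_def\<close>)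
    finally show False using p(2) by simp
  qed
  then show ?thesis by blast
qed

text \<open>Add to \<open>a\<close> a multiple of \<open>n\<close> by the small primes not dividing
  \<open>a\<close>. A small prime then divides exactly one of the two summands: if it divides
  \<open>a\<close>, it divides neither \<open>n\<close> nor the product. A number with only large
  prime factors takes the place of a large prime in the progression.\<close>

lemma coprime_rough_representative:
  fixes a n :: nat
  assumes n: "n > 0" and "coprime a n"
  obtains k where "[k = a] (mod n)" "k > 0" "\<And>q. prime q \<Longrightarrow> q dvd k \<Longrightarrow> q > B"
proof -
  let ?Q = "{q. prime q \<and> q \<le> B \<and> \<not> q dvd a}"
  define k where "k = a + n * \<Prod>?Q"
  have fin: "finite ?Q" by (rule finite_subset[of _ "{..B}"]) auto
  have pos: "\<Prod>?Q > 0" by (intro prod_pos) (auto simp: prime_gt_0_nat)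
  have "q > B" if q: "prime q" "q dvd k" for q
  proof (rule ccontr)
    assume "\<not> q > B"
    show False
    proof (cases "q dvd a")
      case True
      then have "q dvd n * \<Prod>?Q" using q(2) by (simp add: k_def dvd_add_right_iff)
      moreover have "\<not> q dvd n"
        using True assms(2) q(1) by (metis coprime_common_divisor_nat not_prime_1)
      ultimately have "q dvd \<Prod>?Q" using q(1) prime_dvd_mult_iff by blast
      then obtain s where "s \<in> ?Q" "q dvd s" using prime_dvd_prod_iff[OF fin q(1), of "\<lambda>x. x"] by auto
      then show False using True q(1) primes_dvd_imp_eq by blast
    next
      case False
      then have "q \<in> ?Q" using q(1) \<open>\<not> q > B\<close> by simp
      then have "q dvd \<Prod>?Q" using dvd_prodI[OF fin, of q "\<lambda>x. x"] by simp
      then show False using False q(2) by (simp add: k_def dvd_add_left_iff)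
    qed
  qed
  moreover have "[k = a] (mod n)" by (simp add: k_def cong_def)
  moreover have "k > 0" using n pos by (simp add: k_def)
  ultimately show ?thesis using that by blast
qed

lemma zeta_powi_nat: "n > 0 \<Longrightarrow> zeta n powi a = zeta n ^ nat (a mod int n)"
proof -
  assume n: "n > 0"
  have "zeta n powi a = zeta n powi (a mod int n)" by (rule zeta_powi_cong) (simp add: cong_def)
  then show ?thesis using n by (simp add: power_int_def)
qed

lemma zeta_conj_int:
  assumes n: "n > 0" and a: "coprime a (int n)" and g: "poly (map_poly of_int g) (zeta n) = 0"
  shows "poly (map_poly of_int g) (zeta n powi a) = 0"
proof -
  define b where "b = nat (a mod int n)"
  have b: "int b = a mod int n" using n by (simp add: b_def)
  then have "[a = int b] (mod int n)" by (simp add: cong_def)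
  then have "coprime b n" using a cong_imp_coprime[of a "int b" "int n"] by simp
  obtain B where B: "\<And>p j. prime p \<Longrightarrow> p > B \<Longrightarrow> poly (map_poly of_int g) (zeta n ^ j) = 0 \<Longrightarrow>
    poly (map_poly of_int g) (zeta n ^ (j * p)) = 0"
    using zeta_conj_large_prime[OF n, of g] by blast
  obtain k where k: "[k = b] (mod n)" "k > 0" "\<And>q. prime q \<Longrightarrow> q dvd k \<Longrightarrow> q > B"
    using coprime_rough_representative[OF n \<open>coprime b n\<close>, of B] by metis
  \<comment> \<open>The prime factors of \<open>k\<close> all exceed \<open>B\<close> and are peeled
    off one at a time.\<close>
  have "poly (map_poly of_int g) (zeta n ^ k) = 0"
    using k(2,3)
  proof (induction k rule: less_induct)
    case (less k)
    show ?case
    proof (cases "k = 1")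
      case True then show ?thesis using g by simp
    next
      case False
      then obtain p where p: "prime p" "p dvd k" using prime_factor_nat by blast
      then obtain j where j: "k = j * p" by (metis dvd_div_mult_self)
      have "poly (map_poly of_int g) (zeta n ^ j) = 0"
        using less.prems p prime_gt_1_nat[OF p(1)] by (intro less.IH) (auto simp: j)
      then show ?thesis using B[OF p(1) less.prems(2)[OF p]] j by simp
    qed
  qed
  then show ?thesis
    using zeta_power_mod[of n k] zeta_power_mod[of n b] k(1) zeta_powi_nat[OF n, of a]
    by (simp add: cong_def b_def)
qed

text \<open>Irreducibility of the cyclotomic polynomial in the form used later: a rational relation
  for \<open>zeta n\<close> passes to its conjugates. Clearing denominators reduces it to integer
  polynomials.\<close>

theorem zeta_conj:
  assumes n: "n > 0" and a: "coprime a (int n)" and g: "rpoly g (zeta n) = 0"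
  shows "rpoly g (zeta n powi a) = 0"
proof -
  have "\<exists>D G. (D::int) \<noteq> 0 \<and> (\<forall>x. of_int D * rpoly g x = poly (map_poly of_int G) x)" for g
  proof (induction g)
    case 0
    then show ?case by (intro exI[of _ 1] exI[of _ 0]) simp
  next
    case (pCons c g)
    then obtain D G where D: "D \<noteq> 0" "\<And>x. of_int D * rpoly g x = poly (map_poly of_int G) x" by blast
    obtain a b where ab: "quotient_of c = (a, b)" by force
    have b: "b > 0" "c = of_int a / of_int b" using quotient_of_denom_pos[OF ab] quotient_of_div[OF ab] by auto
    have "of_int (b * D) * rpoly (pCons c g) x = poly (map_poly of_int (pCons (a * D) (smult b G))) x" for x
    proof -
      have bc: "of_int a = of_int b * (of_rat c :: complex)" using b by (simp add: of_rat_divide)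
      show ?thesis
        unfolding int_poly_pCons int_poly_smult D(2)[symmetric] of_int_mult bc by (simp add: algebra_simps)
    qed
    then show ?case using D(1) b(1) by (intro exI[of _ "b * D"] exI[of _ "pCons (a * D) (smult b G)"]) auto
  qed
  then obtain D G where D: "(D::int) \<noteq> 0" "\<And>x. of_int D * rpoly g x = poly (map_poly of_int G) x" by blast
  have "poly (map_poly of_int G) (zeta n) = 0" using D(2)[of "zeta n"] g by simp
  then have "poly (map_poly of_int G) (zeta n powi a) = 0" by (rule zeta_conj_int[OF n a])
  then show ?thesis using D(1) D(2)[of "zeta n powi a"] by simp
qed

section \<open>The Galois action on cyclotomic fields\<close>

text \<open>Polynomial values only; for algebraic \<open>x\<close> this is already the field Q(x),
  by \<open>qadj_inverse\<close> and \<open>rat_adjoin_eq_qadj\<close>.\<close>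

definition qadj :: "complex \<Rightarrow> complex set" where
  "qadj x = range (\<lambda>g. rpoly g x)"

lemma qadjI [intro]: "rpoly g x \<in> qadj x"
  by (simp add: qadj_def)

lemma qadjE:
  assumes "y \<in> qadj x" obtains g where "y = rpoly g x"
  using assms by (auto simp: qadj_def)

lemma qadj_add: "y \<in> qadj x \<Longrightarrow> z \<in> qadj x \<Longrightarrow> y + z \<in> qadj x"
  unfolding qadj_def by (force simp: rpoly_add[symmetric] simp del: rpoly_add)

lemma qadj_mult: "y \<in> qadj x \<Longrightarrow> z \<in> qadj x \<Longrightarrow> y * z \<in> qadj x"
  unfolding qadj_def by (force simp: rpoly_mult[symmetric] simp del: rpoly_mult)

lemma qadj_of_rat [simp]: "of_rat c \<in> qadj x"
  using qadjI[of "[:c:]" x] by simp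

lemma qadj_Rats: "\<rat> \<subseteq> qadj x"
  by (auto elim: Rats_cases)

lemma qadj_0 [simp]: "0 \<in> qadj x" and qadj_1 [simp]: "1 \<in> qadj x" and qadj_of_nat [simp]: "of_nat k \<in> qadj x"
  using qadj_of_rat[of 0 x] qadj_of_rat[of 1 x] qadj_of_rat[of "of_nat k" x] by simp_all

lemma qadj_self [simp]: "x \<in> qadj x"
  using qadjI[of "[:0, 1:]" x] by simp

lemma qadj_minus: "y \<in> qadj x \<Longrightarrow> - y \<in> qadj x"
  using qadj_mult[OF qadj_of_rat[of "- 1" x], of y] by (simp add: of_rat_minus)

lemma qadj_diff: "y \<in> qadj x \<Longrightarrow> z \<in> qadj x \<Longrightarrow> y - z \<in> qadj x"
  using qadj_add[OF _ qadj_minus, of y x z] by simp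

lemma qadj_power: "y \<in> qadj x \<Longrightarrow> y ^ k \<in> qadj x"
  by (induction k) (simp_all add: qadj_mult)

lemma qadj_sum: "(\<And>i. i \<in> A \<Longrightarrow> f i \<in> qadj x) \<Longrightarrow> sum f A \<in> qadj x"
  by (induction A rule: infinite_finite_induct) (simp_all add: qadj_add)

lemma qadj_rpoly: "y \<in> qadj x \<Longrightarrow> rpoly g y \<in> qadj x"
  by (induction g) (simp_all add: qadj_add qadj_mult)

lemma qadj_subset: "y \<in> qadj x \<Longrightarrow> qadj y \<subseteq> qadj x"
  by (auto elim!: qadjE[of _ y] simp: qadj_rpoly)

lemma rpoly_bezout:
  fixes g h :: "rat poly"
  obtains u v where "\<And>x. rpoly u x * rpoly g x + rpoly v x * rpoly h x = rpoly (gcd g h) x"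
proof -
  let ?u = "fst (bezout_coefficients g h)" and ?v = "snd (bezout_coefficients g h)"
  have "?u * g + ?v * h = gcd g h" by (rule bezout_coefficients_fst_snd)
  then have "rpoly ?u x * rpoly g x + rpoly ?v x * rpoly h x = rpoly (gcd g h) x" for x
    by (metis rpoly_add rpoly_mult)
  then show ?thesis using that by blast
qed

text \<open>An annihilator \<open>e\<close> of least degree takes the place of the minimal
  polynomial. Its gcd with \<open>g\<close> does not vanish at \<open>x\<close>, so the cofactor
  does, and minimality forces the gcd to be constant. Bezout's identity then inverts
  \<open>y\<close>.\<close>

lemma qadj_inverse:
  assumes h: "h \<noteq> 0" "rpoly h x = 0" and y: "y \<in> qadj x"
  shows "inverse y \<in> qadj x"
proof (cases "y = 0")
  case False
  obtain g where g: "y = rpoly g x" using y by (rule qadjE)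
  define P where "P k \<longleftrightarrow> (\<exists>e. e \<noteq> 0 \<and> rpoly e x = 0 \<and> degree e = k)" for k
  have "P (degree h)" using h by (auto simp: P_def)
  then obtain e where e: "e \<noteq> 0" "rpoly e x = 0" "degree e = (LEAST k. P k)"
    using LeastI[of P] unfolding P_def by blast
  obtain u v where uv: "\<And>x. rpoly u x * rpoly g x + rpoly v x * rpoly e x = rpoly (gcd g e) x"
    using rpoly_bezout[of g e] by blast
  obtain r where r: "e = gcd g e * r" by (metis dvdE gcd_dvd2)
  obtain s where s: "g = gcd g e * s" by (metis dvdE gcd_dvd1)
  have "rpoly (gcd g e) x \<noteq> 0" using s False g by (metis mult_zero_left rpoly_mult)
  then have r0: "rpoly r x = 0" using r e(2) by (metis mult_eq_0_iff rpoly_mult)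
  have "r \<noteq> 0" using r e(1) by auto
  then have "degree e \<le> degree r" unfolding e(3) using r0 by (intro Least_le) (auto simp: P_def)
  moreover have "degree e = degree (gcd g e) + degree r"
    using degree_mult_eq[of "gcd g e" r] \<open>r \<noteq> 0\<close> e(1) r by (metis gcd_eq_0_iff)
  ultimately have "degree (gcd g e) = 0" by linarith
  then obtain c where c: "gcd g e = [:c:]" by (rule degree_eq_zeroE)
  have "c \<noteq> 0" using c e(1) by auto
  moreover have "rpoly u x * y = of_rat c" using uv[of x] e(2) g by (simp add: c)
  ultimately have "inverse y = of_rat (inverse c) * rpoly u x"
    unfolding of_rat_inverse using False by (simp add: field_simps)
  then show ?thesis by (simp add: qadj_mult qadjI)
qed simp

lemma zeta_algebraic:
  assumes "n > 0"
  shows "\<exists>h. h \<noteq> 0 \<and> rpoly h (zeta n) = 0"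
proof (intro exI conjI)
  show "monom 1 n - (1 :: rat poly) \<noteq> 0"
  proof
    assume "monom 1 n - (1 :: rat poly) = 0"
    then have "degree (monom 1 n :: rat poly) = degree (1 :: rat poly)" by simp
    then show False using assms by (simp add: degree_monom_eq)
  qed
  show "rpoly (monom 1 n - 1) (zeta n) = 0" by simp
qed

lemma zeta_powi_qadj: "n > 0 \<Longrightarrow> zeta n powi a \<in> qadj (zeta n)"
  by (simp add: zeta_powi_nat qadj_power)

text \<open>The automorphism of Q(zeta_n) raising \<open>zeta n\<close> to the power
  \<open>a\<close>. Independence of the chosen polynomial is \<open>zeta_conj\<close>; only values
  on \<open>qadj (zeta n)\<close> are meaningful.\<close>

definition conj_map :: "nat \<Rightarrow> int \<Rightarrow> complex \<Rightarrow> complex" where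
  "conj_map n a x = rpoly (SOME g. x = rpoly g (zeta n)) (zeta n powi a)"

lemma conj_map_rpoly:
  assumes "n > 0" "coprime a (int n)"
  shows "conj_map n a (rpoly g (zeta n)) = rpoly g (zeta n powi a)"
proof -
  define h where "h = (SOME h. rpoly g (zeta n) = rpoly h (zeta n))"
  have "rpoly g (zeta n) = rpoly h (zeta n)" unfolding h_def by (rule someI) simp
  then have "rpoly (g - h) (zeta n) = 0" by simp
  then have "rpoly (g - h) (zeta n powi a) = 0" by (rule zeta_conj[OF assms])
  then show ?thesis by (simp add: conj_map_def h_def)
qed

lemma conj_map_cong: "[a = b] (mod int n) \<Longrightarrow> conj_map n a = conj_map n b"
  by (rule ext) (simp add: conj_map_def zeta_powi_cong)

context
  fixes n :: nat and a :: int
  assumes n: "n > 0" and a: "coprime a (int n)"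
begin

lemma conj_map_closed: "x \<in> qadj (zeta n) \<Longrightarrow> conj_map n a x \<in> qadj (zeta n)"
  by (auto elim!: qadjE simp: conj_map_rpoly[OF n a] intro!: qadj_rpoly zeta_powi_qadj n)

lemma conj_map_of_rat: "conj_map n a (of_rat c) = of_rat c"
  using conj_map_rpoly[OF n a, of "[:c:]"] by simp

lemma conj_map_add:
  "x \<in> qadj (zeta n) \<Longrightarrow> y \<in> qadj (zeta n) \<Longrightarrow> conj_map n a (x + y) = conj_map n a x + conj_map n a y"
proof -
  assume "x \<in> qadj (zeta n)" "y \<in> qadj (zeta n)"
  then obtain g h where "x = rpoly g (zeta n)" "y = rpoly h (zeta n)" by (elim qadjE) blast
  then show ?thesis
    using conj_map_rpoly[OF n a, of "g + h"] conj_map_rpoly[OF n a, of g] conj_map_rpoly[OF n a, of h] by simp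
qed

lemma conj_map_mult:
  "x \<in> qadj (zeta n) \<Longrightarrow> y \<in> qadj (zeta n) \<Longrightarrow> conj_map n a (x * y) = conj_map n a x * conj_map n a y"
proof -
  assume "x \<in> qadj (zeta n)" "y \<in> qadj (zeta n)"
  then obtain g h where "x = rpoly g (zeta n)" "y = rpoly h (zeta n)" by (elim qadjE) blast
  then show ?thesis
    using conj_map_rpoly[OF n a, of "g * h"] conj_map_rpoly[OF n a, of g] conj_map_rpoly[OF n a, of h] by simp
qed

lemma conj_map_minus: "x \<in> qadj (zeta n) \<Longrightarrow> conj_map n a (- x) = - conj_map n a x"
  using conj_map_mult[OF qadj_of_rat[of "- 1"], of x] conj_map_of_rat[of "- 1"] by (simp add: of_rat_minus)

lemma conj_map_diff:
  "x \<in> qadj (zeta n) \<Longrightarrow> y \<in> qadj (zeta n) \<Longrightarrow> conj_map n a (x - y) = conj_map n a x - conj_map n a y"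
  using conj_map_add[of x "- y"] conj_map_minus[of y] qadj_minus[of y] by simp

lemma conj_map_eval:
  "x \<in> qadj (zeta n) \<Longrightarrow> conj_map n a (rpoly g x) = rpoly g (conj_map n a x)"
proof -
  assume "x \<in> qadj (zeta n)"
  then obtain h where "x = rpoly h (zeta n)" by (rule qadjE)
  then show ?thesis
    using conj_map_rpoly[OF n a, of "pcompose g h"] conj_map_rpoly[OF n a, of h] by simp
qed

lemma conj_map_sum:
  assumes "\<And>i. i \<in> A \<Longrightarrow> f i \<in> qadj (zeta n)"
  shows "conj_map n a (sum f A) = (\<Sum>i\<in>A. conj_map n a (f i))"
  using assms conj_map_of_rat[of 0]
  by (induction A rule: infinite_finite_induct) (simp_all add: conj_map_add qadj_sum)

lemma conj_map_zeta: "conj_map n a (zeta n powi b) = zeta n powi (a * b)"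
proof -
  have "conj_map n a (zeta n powi b) = (zeta n powi a) ^ nat (b mod int n)"
    using conj_map_rpoly[OF n a, of "monom 1 (nat (b mod int n))"] by (simp add: zeta_powi_nat[OF n, of b])
  also have "\<dots> = zeta n powi (a * (b mod int n))"
    using n by (simp add: power_int_mult power_int_def[of _ "b mod int n"])
  also have "\<dots> = zeta n powi (a * b)" by (rule zeta_powi_cong) (simp add: cong_def mod_mult_right_eq)
  finally show ?thesis .
qed

lemma conj_map_mult_index:
  assumes b: "coprime b (int n)" and x: "x \<in> qadj (zeta n)"
  shows "conj_map n a (conj_map n b x) = conj_map n (a * b) x"
proof -
  obtain g where g: "x = rpoly g (zeta n)" using x by (rule qadjE)
  have ab: "coprime (a * b) (int n)" using a b by simp
  show ?thesis
    unfolding g conj_map_rpoly[OF n b] conj_map_rpoly[OF n ab]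
    by (simp add: conj_map_eval zeta_powi_qadj[OF n] conj_map_zeta)
qed

end

lemma conj_map_1: "n > 0 \<Longrightarrow> x \<in> qadj (zeta n) \<Longrightarrow> conj_map n 1 x = x"
  by (elim qadjE) (simp add: conj_map_rpoly)

text \<open>A multiple of \<open>x\<close> is the sum of its conjugates under the units
  \<open>1 + m * t\<close>, where \<open>m = n div q\<close>. For a power of \<open>zeta n\<close>,
  the sum over all \<open>t\<close> below \<open>q\<close> is 0 or \<open>q\<close> times a power of
  \<open>zeta m\<close>, and the terms at nonunits lie in Q(zeta_m) as well.\<close>

lemma qadj_averaging:
  assumes n: "n > 0" and q: "prime q" "q dvd n" and x: "x \<in> qadj (zeta n)"
    and fixed: "\<And>a. coprime a (int n) \<Longrightarrow> [a = 1] (mod int (n div q)) \<Longrightarrow> conj_map n a x = x"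
  shows "x \<in> qadj (zeta (n div q))"
proof -
  define m where "m = n div q"
  have nm: "n = m * q" using q(2) by (simp add: m_def)
  have q0: "q > 0" and m0: "m > 0" using n nm by auto
  have zq: "zeta n ^ q = zeta m" "zeta n ^ m = zeta q"
    using zeta_mult[OF m0 q0] zeta_mult[OF q0 m0] nm by (simp_all add: mult.commute)
  have in_m: "zeta n powi (int q * b) \<in> qadj (zeta m)" for b
    using zeta_powi_qadj[OF m0, of b] zq(1) by (simp add: power_int_mult)
  let ?T = "{t \<in> {0..<int q}. coprime (1 + int m * t) (int n)}"
  have fin: "finite ?T" by (rule finite_subset[of _ "{0..<int q}"]) auto
  have S: "(\<Sum>t\<in>?T. zeta n powi (i * (1 + int m * t))) \<in> qadj (zeta m)" for i
  proof -
    \<comment> \<open>\<open>1 + m * t\<close> is prime to \<open>m\<close>, so as a nonunit it is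
      divisible by \<open>q\<close>, and \<open>zeta n ^ q\<close> is \<open>zeta m\<close>.\<close>
    have bad: "zeta n powi (i * (1 + int m * t)) \<in> qadj (zeta m)" if "t \<in> {0..<int q} - ?T" for t
    proof -
      have "coprime (1 + int m * t) (int m)"
        by (metis add.commute coprime_1_left coprime_iff_gcd_eq_1 gcd.commute gcd_add_mult mult.commute)
      then have "\<not> coprime (1 + int m * t) (int q)" using that by (simp add: nm)
      then have "int q dvd 1 + int m * t"
        using q(1) prime_imp_coprime[of "int q" "1 + int m * t"] by (auto simp: coprime_commute)
      then obtain s where "1 + int m * t = int q * s" by blast
      then show ?thesis using in_m[of "i * s"] by (simp add: mult.left_commute)
    qed
    have "zeta n powi (i * (1 + int m * t)) = zeta n powi i * zeta q powi (t * i)" for t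
    proof -
      have "zeta n powi (i * (1 + int m * t)) = zeta n powi i * zeta n powi (int m * (t * i))"
        by (subst power_int_add[symmetric]) (auto simp: algebra_simps)
      then show ?thesis using zq(2) by (simp add: power_int_mult)
    qed
    then have "(\<Sum>t\<in>{0..<int q}. zeta n powi (i * (1 + int m * t)))
      = zeta n powi i * (if int q dvd i then of_nat q else 0)"
      by (simp only: sum_distrib_left[symmetric] sum_zeta_powi[OF q0])
    also have "\<dots> \<in> qadj (zeta m)"
      using in_m by (auto simp: dvd_def intro!: qadj_mult)
    finally have all: "(\<Sum>t\<in>{0..<int q}. zeta n powi (i * (1 + int m * t))) \<in> qadj (zeta m)" .
    have "(\<Sum>t\<in>?T. zeta n powi (i * (1 + int m * t)))
      = (\<Sum>t\<in>{0..<int q}. zeta n powi (i * (1 + int m * t)))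
        - (\<Sum>t\<in>{0..<int q} - ?T. zeta n powi (i * (1 + int m * t)))"
      by (subst sum.subset_diff[of ?T "{0..<int q}"]) auto
    also have "\<dots> \<in> qadj (zeta m)" by (intro qadj_diff all qadj_sum bad)
    finally show ?thesis .
  qed
  \<comment> \<open>The extra factor with exponent \<open>i\<close> absorbs the variable split off
    by \<open>pCons\<close>.\<close>
  have gen: "(\<Sum>t\<in>?T. zeta n powi (i * (1 + int m * t)) * rpoly g (zeta n powi (1 + int m * t))) \<in> qadj (zeta m)"
    for i g
  proof (induction g arbitrary: i)
    case (pCons c g)
    have "zeta n powi (i * (1 + int m * t)) * rpoly (pCons c g) (zeta n powi (1 + int m * t))
      = of_rat c * zeta n powi (i * (1 + int m * t))
        + zeta n powi ((i + 1) * (1 + int m * t)) * rpoly g (zeta n powi (1 + int m * t))" for t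
    proof -
      have "zeta n powi ((i + 1) * (1 + int m * t)) = zeta n powi (i * (1 + int m * t)) * zeta n powi (1 + int m * t)"
        by (subst power_int_add[symmetric]) (auto simp: algebra_simps)
      then show ?thesis by (simp add: distrib_left mult_ac)
    qed
    then show ?case
      using pCons.IH[of "i + 1"] S[of i]
      by (simp only: sum.distrib sum_distrib_left[symmetric]) (intro qadj_add qadj_mult qadj_of_rat)
  qed simp
  obtain g where g: "x = rpoly g (zeta n)" using x by (rule qadjE)
  have "of_nat (card ?T) * x = (\<Sum>t\<in>?T. conj_map n (1 + int m * t) x)"
  proof -
    have "(\<Sum>t\<in>?T. conj_map n (1 + int m * t) x) = (\<Sum>t\<in>?T. x)"
      by (rule sum.cong) (auto intro!: fixed simp: m_def[symmetric] cong_def)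
    then show ?thesis by simp
  qed
  also have "\<dots> = (\<Sum>t\<in>?T. rpoly g (zeta n powi (1 + int m * t)))"
    by (rule sum.cong) (auto simp: g conj_map_rpoly[OF n])
  also have "\<dots> \<in> qadj (zeta m)" using gen[of 0 g] by simp
  finally have Tx: "of_nat (card ?T) * x \<in> qadj (zeta m)" .
  have c0: "card ?T \<noteq> 0"
  proof -
    have "0 \<in> ?T" using q0 by simp
    then have "?T \<noteq> {}" by blast
    then show ?thesis unfolding card_eq_0_iff using fin by blast
  qed
  have "of_rat (inverse (of_nat (card ?T))) * (of_nat (card ?T) * x) \<in> qadj (zeta m)"
    by (rule qadj_mult[OF qadj_of_rat Tx])
  moreover have "of_rat (inverse (of_nat (card ?T))) * (of_nat (card ?T) * x) = x"
    unfolding of_rat_inverse of_rat_of_nat_eq using c0 by simp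
  ultimately have "x \<in> qadj (zeta m)" by (simp only:)
  then show ?thesis by (simp only: m_def)
qed

text \<open>If \<open>q\<close> still divides \<open>n div q\<close>, then \<open>b\<close> itself
  is a unit; otherwise \<open>b\<close> is adjusted to be 1 modulo \<open>q\<close>.\<close>

lemma coprime_lift_prime:
  fixes n q :: nat and b :: int
  assumes n: "n > 0" and q: "prime q" "q dvd n" and b: "coprime b (int (n div q))"
  obtains a where "[a = b] (mod int (n div q))" "coprime a (int n)"
proof (cases "q dvd n div q")
  case True
  have "coprime b (int q)"
    using b True coprime_divisors[of b b "int q" "int (n div q)"] by simp
  then have "coprime b (int (n div q) * int q)" using b by simp
  moreover have "int (n div q) * int q = int n" using q(2) by (simp flip: of_nat_mult)
  ultimately show ?thesis using that[of b] by simp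
next
  case False
  then have cop: "coprime (int (n div q)) (int q)"
    using prime_imp_coprime[OF q(1) False] by (simp add: coprime_commute)
  obtain a where a: "[a = b] (mod int (n div q))" "[a = 1] (mod int q)"
    using binary_chinese_remainder_int[OF cop] by blast
  have "coprime a (int (n div q))" "coprime a (int q)"
    using b cong_imp_coprime[OF cong_sym[OF a(1)]] cong_imp_coprime[OF cong_sym[OF a(2)]] by simp_all
  then have "coprime a (int (n div q) * int q)" by simp
  moreover have "int (n div q) * int q = int n" using q(2) by (simp flip: of_nat_mult)
  ultimately show ?thesis using that[of a] a(1) by simp
qed

lemma conj_map_restrict:
  assumes n: "n > 0" and d: "d > 0" and a: "coprime a (int (d * n))" and x: "x \<in> qadj (zeta d)"
  shows "conj_map (d * n) a x = conj_map d a x"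
proof -
  obtain g where g: "x = rpoly g (zeta d)" using x by (rule qadjE)
  have dn: "d * n > 0" "coprime a (int d)" using n d a by auto
  have z: "zeta d = rpoly (monom 1 n) (zeta (d * n))" using zeta_mult[OF d n] by simp
  have "conj_map (d * n) a x = rpoly g (rpoly (monom 1 n) (zeta (d * n) powi a))"
    unfolding g using conj_map_rpoly[OF dn(1) a, of "pcompose g (monom 1 n)"] z by simp
  also have "rpoly (monom 1 n) (zeta (d * n) powi a) = zeta d powi a"
  proof -
    have "rpoly (monom 1 n) (zeta (d * n) powi a) = (zeta (d * n) powi a) powi (int n)" by simp
    also have "\<dots> = (zeta (d * n) powi (int n)) powi a" by (simp only: power_int_mult[symmetric] mult.commute)
    finally show ?thesis using zeta_mult[OF d n] by simp
  qed
  finally show ?thesis unfolding g conj_map_rpoly[OF d dn(2)] .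
qed

text \<open>Averaging removes one prime factor of \<open>n\<close> at a time until the modulus is 1,
  where \<open>zeta 1 = 1\<close>.\<close>

lemma conj_map_fixed_rational:
  assumes "n > 0" "x \<in> qadj (zeta n)" "\<And>a. coprime a (int n) \<Longrightarrow> conj_map n a x = x"
  shows "x \<in> \<rat>"
  using assms
proof (induction n rule: less_induct)
  case (less n)
  show ?case
  proof (cases "n = 1")
    case True
    then have "zeta n = 1" using zeta_power_eq_1[of 1] by simp
    then have "zeta n = of_rat 1" by simp
    then obtain g where "x = rpoly g (of_rat 1)" using less.prems(2) by (metis qadjE)
    moreover have "rpoly g (of_rat 1) \<in> \<rat>" for g by (induction g) simp_all
    ultimately show ?thesis by blast
  next
    case False
    then obtain q where q: "prime q" "q dvd n" using prime_factor_nat by blast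
    define d where "d = n div q"
    have n: "n = d * q" and q1: "q > 1" using q prime_gt_1_nat by (auto simp: d_def)
    then have d: "d > 0" "d < n" using less.prems(1) by auto
    have xd: "x \<in> qadj (zeta d)"
      unfolding d_def by (rule qadj_averaging[OF less.prems(1) q less.prems(2)]) (rule less.prems(3))
    show ?thesis
    proof (rule less.IH[OF d(2,1) xd])
      fix b assume "coprime b (int d)"
      then obtain a where a: "[a = b] (mod int d)" "coprime a (int n)"
        using coprime_lift_prime[OF less.prems(1) q, of b] unfolding d_def by blast
      have "conj_map d b x = conj_map d a x" using conj_map_cong[OF a(1)] by simp
      also have "\<dots> = conj_map n a x"
        using conj_map_restrict[of q d a x] a(2) q1 d(1) xd n by simp
      finally show "conj_map d b x = x" using less.prems(3)[OF a(2)] by simp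
    qed
  qed
qed

section \<open>Elements fixed by the kernel of a cubic character\<close>

lemma zeta3_square_square: "((zeta 3)\<^sup>2)\<^sup>2 = zeta 3"
proof -
  have "((zeta 3)\<^sup>2)\<^sup>2 = zeta 3 ^ 3 * zeta 3" by (simp add: power2_eq_square power3_eq_cube)
  then show ?thesis by (simp only: zeta3_cube mult_1)
qed

lemma cong_solve_pair:
  fixes c :: int and m n :: nat
  assumes "[c = 1] (mod int (gcd n m))"
  obtains b where "[b = c] (mod int n)" "[b = 1] (mod int m)"
proof -
  have "gcd (int n) (int m) dvd 1 - c" using assms by (simp add: cong_iff_dvd_diff dvd_diff_commute)
  then obtain t where "[int n * t = 1 - c] (mod int m)" using cong_solve_dvd_int by blast
  then have "[c + int n * t = c + (1 - c)] (mod int m)" by (intro cong_add cong_refl)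
  moreover have "[c + int n * t = c] (mod int n)" by (simp add: cong_def)
  ultimately show ?thesis using that by simp
qed

text \<open>If \<open>f\<close> does not divide \<open>m\<close>, primitivity gives a unit
  \<open>c\<close> outside the kernel that is 1 modulo \<open>gcd f m\<close>. Some \<open>b\<close>
  is then \<open>c\<close> modulo \<open>f\<close> and 1 modulo \<open>m\<close>; computed in
  Q(zeta_fm), its action would both move and fix \<open>y\<close>.\<close>

lemma primitive_conductor:
  assumes f: "f > 0" "primitive_char f \<chi>" and y: "y \<in> qadj (zeta f)"
    and moved: "\<And>a. coprime a (int f) \<Longrightarrow> \<chi> a \<noteq> 1 \<Longrightarrow> conj_map f a y \<noteq> y"
    and m: "m > 0" "y \<in> qadj (zeta m)"
  shows "f dvd m"
proof (rule ccontr)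
  assume "\<not> f dvd m"
  then have "f div gcd f m \<noteq> 1" using f(1)
    by (metis dvd_div_mult_self gcd_dvd1 gcd_dvd2 mult_1)
  then obtain q where q: "prime q" "q dvd f div gcd f m" using prime_factor_nat by blast
  have "q * gcd f m dvd f" using q(2) by (metis dvd_div_mult_self gcd_dvd1 mult_dvd_mono dvd_refl)
  then have qf: "q dvd f" and g: "gcd f m dvd f div q"
  proof -
    obtain k where k: "f = q * (gcd f m * k)"
      using \<open>q * gcd f m dvd f\<close> by (metis dvdE mult.assoc)
    then show "q dvd f" by (metis dvd_triv_left)
    have "f div q = gcd f m * k"
      using k prime_gt_0_nat[OF q(1)] by (metis nonzero_mult_div_cancel_left less_not_refl)
    then show "gcd f m dvd f div q" by (metis dvd_triv_left)
  qed
  obtain c where c: "[c = 1] (mod int (f div q))" "coprime c (int f)" "\<chi> c \<noteq> 1"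
    using f(2) q(1) qf unfolding primitive_char_def by blast
  have "[c = 1] (mod int (gcd f m))" using cong_dvd_modulus[OF c(1)] g by simp
  then obtain b where b: "[b = c] (mod int f)" "[b = 1] (mod int m)" by (rule cong_solve_pair)
  have "coprime b (int f)" "coprime b (int m)"
    using c(2) cong_imp_coprime[OF cong_sym[OF b(1)]] cong_imp_coprime[OF cong_sym[OF b(2)]] by simp_all
  then have bfm: "coprime b (int (f * m))" "coprime b (int (m * f))" by simp_all
  have "conj_map f c y = conj_map f b y" using conj_map_cong[OF b(1)] by simp
  also have "\<dots> = conj_map (f * m) b y" using conj_map_restrict[OF m(1) f(1) bfm(1) y] by simp
  also have "\<dots> = conj_map m b y" using conj_map_restrict[OF f(1) m(1) bfm(2) m(2)] by (simp add: mult.commute)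
  also have "\<dots> = conj_map m 1 y" using conj_map_cong[OF b(2)] by simp
  also have "\<dots> = y" by (rule conj_map_1[OF m])
  finally show False using moved[OF c(2,3)] by simp
qed

definition fixed_by_ker :: "nat \<Rightarrow> (int \<Rightarrow> complex) \<Rightarrow> complex \<Rightarrow> bool" where
  "fixed_by_ker n \<chi> x \<longleftrightarrow> x \<in> qadj (zeta n) \<and> (\<forall>a. coprime a (int n) \<and> \<chi> a = 1 \<longrightarrow> conj_map n a x = x)"

context
  fixes n :: nat and \<chi> :: "int \<Rightarrow> complex"
  assumes n: "n > 0" and \<chi>: "cubic_char n \<chi>"
begin

lemma fixed_by_ker_add: "fixed_by_ker n \<chi> x \<Longrightarrow> fixed_by_ker n \<chi> y \<Longrightarrow> fixed_by_ker n \<chi> (x + y)"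
  and fixed_by_ker_mult: "fixed_by_ker n \<chi> x \<Longrightarrow> fixed_by_ker n \<chi> y \<Longrightarrow> fixed_by_ker n \<chi> (x * y)"
  and fixed_by_ker_diff: "fixed_by_ker n \<chi> x \<Longrightarrow> fixed_by_ker n \<chi> y \<Longrightarrow> fixed_by_ker n \<chi> (x - y)"
  by (auto simp: fixed_by_ker_def qadj_add qadj_mult qadj_diff conj_map_add[OF n] conj_map_mult[OF n] conj_map_diff[OF n])

lemma fixed_by_ker_conj:
  assumes "fixed_by_ker n \<chi> x" "coprime a (int n)"
  shows "fixed_by_ker n \<chi> (conj_map n a x)"
  unfolding fixed_by_ker_def
proof (intro conjI allI impI)
  have x: "x \<in> qadj (zeta n)" using assms(1) by (simp add: fixed_by_ker_def)
  show "conj_map n a x \<in> qadj (zeta n)" by (rule conj_map_closed[OF n assms(2) x])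
  fix b assume b: "coprime b (int n) \<and> \<chi> b = 1"
  then have "conj_map n b (conj_map n a x) = conj_map n a (conj_map n b x)"
    using conj_map_mult_index[OF n _ _ x] assms(2) by (simp add: mult.commute)
  then show "conj_map n b (conj_map n a x) = conj_map n a x"
    using assms(1) b by (simp add: fixed_by_ker_def)
qed

lemma fixed_by_ker_index:
  assumes "fixed_by_ker n \<chi> x" "coprime a (int n)" "coprime b (int n)" "\<chi> a = \<chi> b"
  shows "conj_map n a x = conj_map n b x"
proof -
  have x: "x \<in> qadj (zeta n)" using assms(1) by (simp add: fixed_by_ker_def)
  \<comment> \<open>\<open>b ^ 2\<close> serves as inverse of \<open>b\<close> modulo the kernel,
    since \<open>\<chi> b\<close> has cube 1.\<close>
  define c where "c = b ^ 2 * a"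
  have "\<chi> c = \<chi> b ^ 3"
    using assms(4) by (simp add: c_def cubic_char_mult[OF n \<chi>] power2_eq_square power3_eq_cube)
  then have c: "\<chi> c = 1" "coprime c (int n)"
    using cubic_char_cube[OF n \<chi> assms(3)] assms(2,3) by (simp_all add: c_def)
  have b3: "\<chi> (b ^ 3) = 1" "coprime (b ^ 3) (int n)"
    using cubic_char_cube[OF n \<chi> assms(3)] assms(3)
    by (simp_all add: cubic_char_mult[OF n \<chi>] power3_eq_cube)
  have "conj_map n a x = conj_map n a (conj_map n (b ^ 3) x)"
    using assms(1) b3 by (simp add: fixed_by_ker_def)
  also have "\<dots> = conj_map n (b * c) x"
    using conj_map_mult_index[OF n assms(2) b3(2) x]
    by (simp add: c_def power3_eq_cube power2_eq_square mult_ac)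
  also have "\<dots> = conj_map n b (conj_map n c x)"
    using conj_map_mult_index[OF n assms(3) c(2) x] by simp
  also have "conj_map n c x = x" using assms(1) c by (simp add: fixed_by_ker_def)
  finally show ?thesis .
qed

lemma cubic_char_values:
  assumes a: "coprime a (int n)" "\<chi> a \<noteq> 1" and b: "coprime b (int n)"
  shows "\<chi> b = 1 \<or> \<chi> b = \<chi> a \<or> \<chi> b = \<chi> (a * a)"
proof -
  have "\<chi> a ^ 3 = 1" "\<chi> b ^ 3 = 1" using cubic_char_cube[OF n \<chi>] a b by blast+
  then have "\<chi> a = zeta 3 \<or> \<chi> a = (zeta 3)\<^sup>2" "\<chi> b = 1 \<or> \<chi> b = zeta 3 \<or> \<chi> b = (zeta 3)\<^sup>2"
    using cube_root_unity a(2) by blast+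
  moreover have "\<chi> (a * a) = (\<chi> a)\<^sup>2" by (simp only: cubic_char_mult[OF n \<chi>] power2_eq_square)
  ultimately show ?thesis using zeta3_square_square by metis
qed

text \<open>The quotient by the kernel has order 3, so one unit outside the kernel generates it and
  being fixed by that unit means being fixed by all.\<close>

lemma fixed_by_ker_rational:
  assumes x: "fixed_by_ker n \<chi> x" and a: "coprime a (int n)" "\<chi> a \<noteq> 1" and fx: "conj_map n a x = x"
  shows "x \<in> \<rat>"
proof (rule conj_map_fixed_rational[OF n])
  show xq: "x \<in> qadj (zeta n)" using x by (simp add: fixed_by_ker_def)
  fix b assume b: "coprime b (int n)"
  have aa: "coprime (a * a) (int n)" using a(1) by simp
  have "conj_map n (a * a) x = x"
    using conj_map_mult_index[OF n a(1) a(1) xq] fx by simp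
  then have "conj_map n b x = conj_map n a x" if "\<chi> b \<noteq> 1"
    using cubic_char_values[OF a b] that fixed_by_ker_index[OF x b a(1)] fixed_by_ker_index[OF x b aa] fx by metis
  moreover have "conj_map n b x = x" if "\<chi> b = 1"
    using x b that by (simp add: fixed_by_ker_def)
  ultimately show "conj_map n b x = x" using fx by auto
qed

text \<open>Lagrange interpolation through the three conjugates, with the denominator cleared: the
  coefficients are invariant under the cyclic shift and hence rational.\<close>

lemma fixed_by_ker_in_qadj:
  assumes x: "fixed_by_ker n \<chi> x" and y: "fixed_by_ker n \<chi> y"
    and a: "coprime a (int n)" and moved: "conj_map n a y \<noteq> y"
  shows "x \<in> qadj y"
proof -
  let ?s = "conj_map n a"
  have a1: "\<chi> a \<noteq> 1" using y a moved by (auto simp: fixed_by_ker_def)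
  have a3: "\<chi> (a * (a * a)) = 1" "coprime (a * (a * a)) (int n)" "coprime (a * a) (int n)"
    using cubic_char_cube[OF n \<chi> a] a by (simp_all add: cubic_char_mult[OF n \<chi>] power3_eq_cube mult.assoc)
  have s3: "?s (?s (?s z)) = z" if z: "fixed_by_ker n \<chi> z" for z
  proof -
    have zq: "z \<in> qadj (zeta n)" using z by (simp add: fixed_by_ker_def)
    show ?thesis
      using z a3 conj_map_mult_index[OF n a a zq] conj_map_mult_index[OF n a a3(3) zq]
      by (simp add: fixed_by_ker_def)
  qed
  define x1 x2 y1 y2 where "x1 = ?s x" and "x2 = ?s x1" and "y1 = ?s y" and "y2 = ?s y1"
  note F = fixed_by_ker_add fixed_by_ker_mult fixed_by_ker_diff
  have fx: "fixed_by_ker n \<chi> x1" "fixed_by_ker n \<chi> x2" "fixed_by_ker n \<chi> y1" "fixed_by_ker n \<chi> y2"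
    using fixed_by_ker_conj x y a by (simp_all add: x1_def x2_def y1_def y2_def)
  have q: "x \<in> qadj (zeta n)" "x1 \<in> qadj (zeta n)" "x2 \<in> qadj (zeta n)"
    "y \<in> qadj (zeta n)" "y1 \<in> qadj (zeta n)" "y2 \<in> qadj (zeta n)"
    using x y fx by (simp_all add: fixed_by_ker_def)
  have s: "?s x = x1" "?s x1 = x2" "?s x2 = x" "?s y = y1" "?s y1 = y2" "?s y2 = y"
    using s3[OF x] s3[OF y] by (simp_all add: x1_def x2_def y1_def y2_def)
  note S = conj_map_add[OF n a] conj_map_mult[OF n a] conj_map_diff[OF n a] qadj_add qadj_mult qadj_diff q s
  have ne: "y1 \<noteq> y" "y2 \<noteq> y1" "y2 \<noteq> y"
    using moved s by (metis)+
  \<comment> \<open>\<open>d\<close> is the Vandermonde product of the conjugates of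
    \<open>y\<close>. Up to sign, \<open>N0\<close>, \<open>N1\<close>, \<open>N2\<close> are the
    coefficients, multiplied by \<open>d\<close>, of the quadratic that sends \<open>y\<close>,
    \<open>y1\<close>, \<open>y2\<close> to \<open>x\<close>, \<open>x1\<close>,
    \<open>x2\<close>.\<close>
  define d N0 N1 N2 where "d = (y - y1) * (y1 - y2) * (y2 - y)"
    and "N0 = x * ((y1 - y2) * (y1 * y2)) + x1 * ((y2 - y) * (y2 * y)) + x2 * ((y - y1) * (y * y1))"
    and "N1 = x * (y1 * y1 - y2 * y2) + x1 * (y2 * y2 - y * y) + x2 * (y * y - y1 * y1)"
    and "N2 = x * (y1 - y2) + x1 * (y2 - y) + x2 * (y - y1)"
  have "fixed_by_ker n \<chi> d" "fixed_by_ker n \<chi> N0" "fixed_by_ker n \<chi> N1" "fixed_by_ker n \<chi> N2"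
    unfolding d_def N0_def N1_def N2_def by (intro F x y fx)+
  moreover have "?s d = d" "?s N0 = N0" "?s N1 = N1" "?s N2 = N2"
    unfolding d_def N0_def N1_def N2_def by (simp_all add: S)
  ultimately have "d \<in> \<rat>" "N0 \<in> \<rat>" "N1 \<in> \<rat>" "N2 \<in> \<rat>"
    using fixed_by_ker_rational[OF _ a a1] by blast+
  then have R: "- inverse d \<in> qadj y" "N0 \<in> qadj y" "N1 \<in> qadj y" "N2 \<in> qadj y"
    using qadj_Rats[of y] by (auto intro!: qadj_minus)
  have "d \<noteq> 0" using ne by (auto simp: d_def)
  moreover have "d * x = - (N0 - N1 * y + N2 * (y * y))"
    unfolding d_def N0_def N1_def N2_def by (simp add: algebra_simps)
  ultimately have "x = - inverse d * (N0 - N1 * y + N2 * (y * y))" by (simp add: field_simps)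
  then show ?thesis
    using R by (simp only:) (intro qadj_mult qadj_add qadj_diff R qadj_self)
qed

end

lemma cubic_period_qadj: "n > 0 \<Longrightarrow> cubic_period n \<chi> z \<in> qadj (zeta n)"
  unfolding cubic_period_def by (intro qadj_sum) (simp add: zeta_powi_qadj)

text \<open>Multiplying exponents by \<open>b\<close> carries the fibre of \<open>\<chi>\<close>
  over \<open>z\<close> to the fibre over \<open>z * \<chi> b\<close>.\<close>

lemma cubic_period_conj:
  assumes n: "n > 0" and \<chi>: "cubic_char n \<chi>" and b: "coprime b (int n)"
  shows "conj_map n b (cubic_period n \<chi> z) = cubic_period n \<chi> (z * \<chi> b)"
proof -
  note C = n \<chi>
  have "conj_map n b (cubic_period n \<chi> z)
    = (\<Sum>a\<in>{0..<int n}. if \<chi> a = z then zeta n powi (b * a) else 0)"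
    unfolding cubic_period_def
    using conj_map_of_rat[OF n b, of 0]
    by (subst conj_map_sum[OF n b]) (auto simp: zeta_powi_qadj[OF n] conj_map_zeta[OF n b] intro!: sum.cong)
  also have "\<dots> = (\<Sum>a\<in>{0..<int n}. if \<chi> (b * a) = z * \<chi> b then zeta n powi (b * a) else 0)"
    using cubic_char_nonzero[OF C b] by (intro sum.cong) (auto simp: cubic_char_mult[OF C])
  also have "\<dots> = cubic_period n \<chi> (z * \<chi> b)"
    unfolding cubic_period_def
    by (rule sum_residues_mult[where h = "\<lambda>a. if \<chi> a = z * \<chi> b then zeta n powi a else 0"])
      (use n b cubic_char_cong[OF C] zeta_powi_cong in metis)+
  finally show ?thesis .
qed

text \<open>A nontrivial cube root of unity fixing the period would make all three periods equal. As
  they sum to 0, the period would be 0, hence rational.\<close>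

lemma cubic_period_moved:
  assumes n: "n > 0" "9 dvd n" and \<chi>: "primitive_char n \<chi>"
    and irr: "cubic_period n \<chi> 1 \<notin> \<rat>" and a: "coprime a (int n)" "\<chi> a \<noteq> 1"
  shows "conj_map n a (cubic_period n \<chi> 1) \<noteq> cubic_period n \<chi> 1"
proof
  note C = n(1) primitive_cubic[OF \<chi>]
  let ?w = "\<chi> a"
  assume "conj_map n a (cubic_period n \<chi> 1) = cubic_period n \<chi> 1"
  then have 1: "cubic_period n \<chi> ?w = cubic_period n \<chi> 1"
    using cubic_period_conj[OF C a(1), of 1] by simp
  then have 2: "cubic_period n \<chi> (?w\<^sup>2) = cubic_period n \<chi> 1"
    using cubic_period_conj[OF C a(1), of ?w] cubic_period_conj[OF C a(1), of 1]
    by (simp add: power2_eq_square)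
  have "?w = zeta 3 \<or> ?w = (zeta 3)\<^sup>2"
    using cube_root_unity[OF cubic_char_cube[OF C a(1)]] a(2) by blast
  then have "cubic_period n \<chi> (zeta 3) = cubic_period n \<chi> 1" "cubic_period n \<chi> (zeta 3 ^ 2) = cubic_period n \<chi> 1"
    using 1 2 zeta3_square_square by metis+
  then have "cubic_period n \<chi> 1 = 0" using cubic_period_sum[OF n \<chi>] by simp
  then show False using irr by simp
qed

section \<open>Cyclic cubic fields\<close>

lemma field_complex_ring: "Ring.field complex_ring"
  by (rule field_from_type_algebra)

lemma ring_complex_ring: "Ring.ring complex_ring"
  by (rule ring_from_type_algebra)

lemma complex_ring_simps [simp]:
  "carrier complex_ring = UNIV" "x \<otimes>\<^bsub>complex_ring\<^esub> y = x * y" "x \<oplus>\<^bsub>complex_ring\<^esub> y = x + y"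
  "\<one>\<^bsub>complex_ring\<^esub> = 1" "\<zero>\<^bsub>complex_ring\<^esub> = 0"
  by (simp_all add: ring_of_type_algebra_def)

lemma complex_ring_a_inv [simp]: "\<ominus>\<^bsub>complex_ring\<^esub> x = - x"
proof -
  interpret Ring.field complex_ring by (rule field_complex_ring)
  show ?thesis by (rule minus_equality) auto
qed

lemma complex_ring_m_inv: "x \<noteq> 0 \<Longrightarrow> inv\<^bsub>complex_ring\<^esub> x = inverse x"
proof -
  interpret Ring.field complex_ring by (rule field_complex_ring)
  assume "x \<noteq> 0" then show ?thesis by (intro inv_char) auto
qed

lemma subfield_complexI:
  assumes "1 \<in> K" "\<And>x. x \<in> K \<Longrightarrow> - x \<in> K" "\<And>x y. x \<in> K \<Longrightarrow> y \<in> K \<Longrightarrow> x * y \<in> K"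
    "\<And>x y. x \<in> K \<Longrightarrow> y \<in> K \<Longrightarrow> x + y \<in> K" "\<And>x. x \<in> K \<Longrightarrow> inverse x \<in> K"
  shows "subfield K complex_ring"
proof -
  interpret Ring.field complex_ring by (rule field_complex_ring)
  show ?thesis
    by (intro subfieldI' subringI) (use assms complex_ring_m_inv in auto)
qed

lemma subfield_complexD:
  assumes "subfield K complex_ring"
  shows "1 \<in> K" "0 \<in> K" "x \<in> K \<Longrightarrow> - x \<in> K" "x \<in> K \<Longrightarrow> y \<in> K \<Longrightarrow> x * y \<in> K"
    "x \<in> K \<Longrightarrow> y \<in> K \<Longrightarrow> x + y \<in> K" "x \<in> K \<Longrightarrow> inverse x \<in> K"
proof -
  interpret Ring.field complex_ring by (rule field_complex_ring)
  note S = subringE[OF subfieldE(1)[OF assms]]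
  show "1 \<in> K" "0 \<in> K" "x \<in> K \<Longrightarrow> - x \<in> K" "x \<in> K \<Longrightarrow> y \<in> K \<Longrightarrow> x * y \<in> K"
    "x \<in> K \<Longrightarrow> y \<in> K \<Longrightarrow> x + y \<in> K"
    using S(2,3) S(5)[of x] S(6)[of x y] S(7)[of x y] by simp_all
  show "x \<in> K \<Longrightarrow> inverse x \<in> K"
    using subfield_m_inv(1)[OF assms, of x] complex_ring_m_inv[of x] \<open>0 \<in> K\<close> by (cases "x = 0") auto
qed

lemma subfield_Rats: "subfield \<rat> complex_ring"
  by (rule subfield_complexI) auto

lemma subfield_rpoly:
  assumes K: "subfield K complex_ring" "\<rat> \<subseteq> K" and x: "x \<in> K"
  shows "rpoly g x \<in> K"
proof (induction g)
  case (pCons c g)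
  have "of_rat c \<in> K" using K(2) by auto
  then show ?case using subfield_complexD(4,5)[OF K(1)] x pCons.IH by simp
qed (use subfield_complexD(2)[OF K(1)] in simp)

lemma subfield_qadj:
  assumes "h \<noteq> 0" "rpoly h x = 0"
  shows "subfield (qadj x) complex_ring"
  by (rule subfield_complexI) (auto intro: qadj_minus qadj_mult qadj_add qadj_inverse[OF assms])

lemma rat_adjoin_eq_qadj:
  assumes "h \<noteq> 0" "rpoly h x = 0"
  shows "rat_adjoin x = qadj x"
proof -
  interpret Ring.field complex_ring by (rule field_complex_ring)
  have "subfield (rat_adjoin x) complex_ring" "insert x \<rat> \<subseteq> rat_adjoin x"
    unfolding rat_adjoin_def by (rule generate_field_is_subfield) (auto intro: generate_field.incl)
  then have "qadj x \<subseteq> rat_adjoin x" by (auto elim!: qadjE intro: subfield_rpoly)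
  moreover have "rat_adjoin x \<subseteq> qadj x"
    unfolding rat_adjoin_def
    by (rule generate_field_min_subfield1) (use subfield_qadj[OF assms] qadj_Rats in auto)
  ultimately show ?thesis by blast
qed

lemma rat_adjoin_zeta: "n > 0 \<Longrightarrow> rat_adjoin (zeta n) = qadj (zeta n)"
  using zeta_algebraic rat_adjoin_eq_qadj by blast

lemma line_extension_complex:
  "ring.line_extension complex_ring K v E = {k * v + e | k e. k \<in> K \<and> e \<in> E}"
proof -
  interpret Ring.field complex_ring by (rule field_complex_ring)
  show ?thesis unfolding set_eq_iff line_extension_mem_iff mem_Collect_eq complex_ring_simps by blast
qed

lemma dimension_two:
  assumes "w \<notin> \<rat>"
  shows "ring.dimension complex_ring 2 \<rat> {a + b * w | a b. a \<in> \<rat> \<and> b \<in> \<rat>}"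
proof -
  interpret Ring.field complex_ring by (rule field_complex_ring)
  have 1: "dimension 1 \<rat> \<rat>" by (rule dimension_one[OF subfield_Rats])
  have "dimension (Suc 1) \<rat> (line_extension \<rat> w \<rat>)"
    by (rule Suc_dim[OF _ assms 1]) simp
  moreover have "line_extension \<rat> w \<rat> = {a + b * w | a b. a \<in> \<rat> \<and> b \<in> \<rat>}"
    unfolding line_extension_complex by (auto simp: add.commute)
  ultimately show ?thesis by (simp add: numeral_2_eq_2)
qed

definition quad_span :: "complex \<Rightarrow> complex set" where
  "quad_span x = {a + b * x + c * x\<^sup>2 | a b c. a \<in> \<rat> \<and> b \<in> \<rat> \<and> c \<in> \<rat>}"

lemma quad_span_qadj: "quad_span x \<subseteq> qadj x"
  using qadj_Rats[of x] unfolding quad_span_def by (auto intro!: qadj_add qadj_mult qadj_power)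

lemma dimension_three:
  assumes ind: "\<And>a b c. a \<in> \<rat> \<Longrightarrow> b \<in> \<rat> \<Longrightarrow> c \<in> \<rat> \<Longrightarrow> a + b * x + c * x\<^sup>2 = 0 \<Longrightarrow> b = 0 \<and> c = 0"
  shows "ring.dimension complex_ring 3 \<rat> (quad_span x)"
proof -
  interpret Ring.field complex_ring by (rule field_complex_ring)
  have "x \<notin> \<rat>" using ind[of "- x" 1 0] by auto
  note 2 = dimension_two[OF this]
  have "x\<^sup>2 \<notin> {a + b * x | a b. a \<in> \<rat> \<and> b \<in> \<rat>}"
  proof clarify
    fix a b assume "x\<^sup>2 = a + b * x" "a \<in> \<rat>" "b \<in> \<rat>"
    then show False using ind[of "- a" "- b" 1] by simp
  qed
  then have "dimension (Suc 2) \<rat> (line_extension \<rat> (x\<^sup>2) {a + b * x | a b. a \<in> \<rat> \<and> b \<in> \<rat>})"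
    by (intro Suc_dim 2) simp_all
  moreover have "line_extension \<rat> (x\<^sup>2) {a + b * x | a b. a \<in> \<rat> \<and> b \<in> \<rat>} = quad_span x"
  proof -
    have "c * x\<^sup>2 + (a + b * x) = a + b * x + c * x\<^sup>2" for a b c by simp
    then show ?thesis
      unfolding line_extension_complex quad_span_def set_eq_iff mem_Collect_eq by metis
  qed
  ultimately show ?thesis by (simp add: numeral_3_eq_3)
qed

lemma dimension_three_subset_eq:
  assumes "ring.dimension complex_ring 3 \<rat> E" "ring.dimension complex_ring 3 \<rat> F" "E \<subseteq> F"
  shows "E = F"
proof -
  interpret Ring.field complex_ring by (rule field_complex_ring)
  note Q = subfield_Rats
  obtain Us where Us: "set Us \<subseteq> carrier complex_ring" "independent \<rat> Us" "length Us = 3" "Span \<rat> Us = E"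
    using exists_base[OF Q assms(1)] by auto
  have "set Us \<subseteq> Span \<rat> Us" by (rule Span_base_incl[OF Q Us(1)])
  then have "set Us \<subseteq> F" using Us(4) assms(3) by blast
  then obtain Vs where "length (Vs @ Us) = 3" "Span \<rat> (Vs @ Us) = F"
    using complete_base[OF Q assms(2) Us(2)] by blast
  then show ?thesis using Us(3,4) by simp
qed

section \<open>Galois groups acting on polynomial values\<close>

context
  fixes K F :: "complex set"
  assumes K: "subfield K complex_ring" and FK: "F \<subseteq> K"
begin

lemma galois_group_carrier:
  "\<sigma> \<in> carrier (galois_group K F) \<longleftrightarrow>
     \<sigma> \<in> Bij K \<and> \<sigma> 1 = 1 \<and> (\<forall>x\<in>F. \<sigma> x = x) \<and>
     (\<forall>x\<in>K. \<forall>y\<in>K. \<sigma> (x * y) = \<sigma> x * \<sigma> y \<and> \<sigma> (x + y) = \<sigma> x + \<sigma> y)"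
  by (auto simp: galois_group_def Bij_def ring_hom_def bij_betw_def)

lemma galois_group_mult:
  assumes "\<sigma> \<in> carrier (galois_group K F)" "\<tau> \<in> carrier (galois_group K F)"
  shows "\<sigma> \<otimes>\<^bsub>galois_group K F\<^esub> \<tau> = compose K \<sigma> \<tau>"
  using assms by (simp add: galois_group_def BijGroup_def)

lemma galois_group_one: "\<one>\<^bsub>galois_group K F\<^esub> = (\<lambda>x\<in>K. x)"
  by (simp add: galois_group_def BijGroup_def)

lemma group_galois_group: "group (galois_group K F)"
proof -
  interpret B: group "BijGroup K" by (rule group_BijGroup)
  note KD = subfield_complexD[OF K]
  let ?H = "carrier (galois_group K F)"
  have sub: "subgroup ?H (BijGroup K)"
  proof (rule B.subgroupI)
    show "?H \<subseteq> carrier (BijGroup K)" by (auto simp: galois_group_def BijGroup_def)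
    have "(\<lambda>x\<in>K. x) \<in> ?H"
      using KD(1,4,5) FK id_Bij[of K] by (auto simp: galois_group_carrier)
    then show "?H \<noteq> {}" by blast
  next
    fix \<sigma> assume \<sigma>: "\<sigma> \<in> ?H"
    then have b: "\<sigma> \<in> Bij K" and s: "\<sigma> 1 = 1" "\<And>x. x \<in> F \<Longrightarrow> \<sigma> x = x"
      "\<And>x y. x \<in> K \<Longrightarrow> y \<in> K \<Longrightarrow> \<sigma> (x * y) = \<sigma> x * \<sigma> y"
      "\<And>x y. x \<in> K \<Longrightarrow> y \<in> K \<Longrightarrow> \<sigma> (x + y) = \<sigma> x + \<sigma> y"
      by (simp_all add: galois_group_carrier)
    let ?r = "inv_into K \<sigma>"
    have inj: "inj_on \<sigma> K" and im: "\<sigma> ` K = K" using b by (auto simp: Bij_def bij_betw_def)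
    have r: "?r x \<in> K" "\<sigma> (?r x) = x" if "x \<in> K" for x
      using that im inv_into_into[of x \<sigma> K] f_inv_into_f[of x \<sigma> K] by auto
    have "(\<lambda>x\<in>K. ?r x) \<in> ?H"
      unfolding galois_group_carrier
    proof (intro conjI ballI restrict_inv_into_Bij[OF b])
      show "(\<lambda>x\<in>K. ?r x) 1 = 1" using KD(1) inv_into_f_eq[OF inj, of 1 1] s(1) by simp
      show "(\<lambda>x\<in>K. ?r x) x = x" if "x \<in> F" for x
        using FK that inv_into_f_eq[OF inj, of x x] s(2) by auto
      fix x y assume xy: "x \<in> K" "y \<in> K"
      show "(\<lambda>x\<in>K. ?r x) (x * y) = (\<lambda>x\<in>K. ?r x) x * (\<lambda>x\<in>K. ?r x) y"
        using xy r KD(4) s(3) by (auto intro!: inv_into_f_eq[OF inj])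
      show "(\<lambda>x\<in>K. ?r x) (x + y) = (\<lambda>x\<in>K. ?r x) x + (\<lambda>x\<in>K. ?r x) y"
        using xy r KD(5) s(4) by (auto intro!: inv_into_f_eq[OF inj])
    qed
    then show "inv\<^bsub>BijGroup K\<^esub> \<sigma> \<in> ?H" by (simp add: inv_BijGroup[OF b])
  next
    fix \<sigma> \<tau> assume *: "\<sigma> \<in> ?H" "\<tau> \<in> ?H"
    then have b: "\<sigma> \<in> Bij K" "\<tau> \<in> Bij K" by (simp_all add: galois_group_carrier)
    have \<tau>K: "\<tau> x \<in> K" if "x \<in> K" for x using b(2) that by (auto simp: Bij_def bij_betw_def)
    have "compose K \<sigma> \<tau> x = \<sigma> (\<tau> x)" if "x \<in> K" for x using that by (simp add: compose_def)
    then have "compose K \<sigma> \<tau> \<in> ?H"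
      using * FK \<tau>K KD(1,4,5) compose_Bij[OF b] by (auto simp: galois_group_carrier)
    then show "\<sigma> \<otimes>\<^bsub>BijGroup K\<^esub> \<tau> \<in> ?H" using b by (simp add: BijGroup_def)
  qed
  have "galois_group K F = (BijGroup K)\<lparr>carrier := ?H\<rparr>" by (simp add: galois_group_def)
  then show ?thesis using subgroup.subgroup_is_group[OF sub group_BijGroup] by simp
qed

lemma galois_group_rpoly:
  assumes Q: "F = \<rat>" and \<sigma>: "\<sigma> \<in> carrier (galois_group K F)" and x: "x \<in> K"
  shows "\<sigma> (rpoly g x) = rpoly g (\<sigma> x)"
proof (induction g)
  case 0
  have "0 \<in> F" using Q by simp
  then show ?case using \<sigma> by (simp add: galois_group_carrier)
next
  case (pCons c g)
  have c: "of_rat c \<in> F" using Q by simp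
  have g: "rpoly g x \<in> K" by (rule subfield_rpoly[OF K _ x]) (use FK Q in simp)
  then have "x * rpoly g x \<in> K" using subfield_complexD(4)[OF K x] by blast
  then show ?case using \<sigma> c g x FK pCons.IH by (auto simp: galois_group_carrier)
qed

lemma galois_group_closed: "\<sigma> \<in> carrier (galois_group K F) \<Longrightarrow> x \<in> K \<Longrightarrow> \<sigma> x \<in> K"
  by (auto simp: galois_group_carrier Bij_def bij_betw_def)

lemma galois_group_inj: "\<sigma> \<in> carrier (galois_group K F) \<Longrightarrow> x \<in> K \<Longrightarrow> y \<in> K \<Longrightarrow> \<sigma> x = \<sigma> y \<Longrightarrow> x = y"
  by (auto simp: galois_group_carrier Bij_def bij_betw_def inj_on_def)

lemma galois_group_generate_fixed:
  assumes \<sigma>: "\<sigma> \<in> carrier (galois_group K F)" and z: "z \<in> K" "\<sigma> z = z"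
    and "\<tau> \<in> generate (galois_group K F) {\<sigma>}"
  shows "\<tau> z = z"
proof -
  interpret G: group "galois_group K F" by (rule group_galois_group)
  have incl: "generate (galois_group K F) {\<sigma>} \<subseteq> carrier (galois_group K F)"
    by (rule G.generate_incl) (use \<sigma> in simp)
  show ?thesis using assms(4)
  proof (induction rule: generate.induct)
    case one
    then show ?case using z by (simp add: galois_group_one)
  next
    case (incl h)
    then show ?case using z by simp
  next
    case (inv h)
    then have h: "h = \<sigma>" by simp
    have "(inv\<^bsub>galois_group K F\<^esub> \<sigma> \<otimes>\<^bsub>galois_group K F\<^esub> \<sigma>) z = z"
      using \<sigma> z by (simp add: galois_group_one)
    then show ?case using \<sigma> z h galois_group_mult[OF G.inv_closed[OF \<sigma>] \<sigma>] by (simp add: compose_def)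
  next
    case (eng g h)
    then have "g \<in> carrier (galois_group K F)" "h \<in> carrier (galois_group K F)" using incl by auto
    then show ?case using eng.IH z by (simp add: galois_group_mult compose_def)
  qed
qed

end

section \<open>Irreducible cubics with cyclically permuted roots\<close>

lemma rpoly_irreducible_dvd:
  assumes h: "irreducible h" "rpoly h x = 0" and g: "rpoly g x = 0"
  shows "h dvd g"
proof (rule ccontr)
  assume "\<not> h dvd g"
  then have "coprime h g" using h(1) by (simp add: irreducible_imp_prime_elem prime_elem_imp_coprime)
  then have "gcd g h = 1" by (metis gcd.commute coprime_imp_gcd_eq_1)
  moreover obtain u v where "\<And>x. rpoly u x * rpoly g x + rpoly v x * rpoly h x = rpoly (gcd g h) x"
    using rpoly_bezout by blast
  then have "rpoly (gcd g h) x = 0" using h(2) g by (metis add_0 mult_zero_right)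
  ultimately show False by simp
qed

lemma irreducible_cubicI:
  fixes h :: "rat poly"
  assumes "degree h = 3" "\<And>r. poly h r \<noteq> 0"
  shows "irreducible h"
proof (rule irreducibleI)
  show "h \<noteq> 0" using assms(1) by auto
  then show "\<not> h dvd 1" using assms(1) by (simp add: is_unit_iff_degree)
  fix a b assume ab: "h = a * b"
  have nz: "a \<noteq> 0" "b \<noteq> 0" using \<open>h \<noteq> 0\<close> ab by auto
  then have deg: "degree a + degree b = 3" using assms(1) ab degree_mult_eq by metis
  have lin: "\<exists>r. poly p r = 0" if p1: "degree p = 1" for p :: "rat poly"
  proof -
    obtain d c where p: "p = [:c, d:]" "d \<noteq> 0" using degree1_coeffs[OF p1] by blast
    then have "poly p (- c / d) = 0" by simp
    then show ?thesis by blast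
  qed
  have "degree a \<noteq> 1" "degree b \<noteq> 1" using lin assms(2) ab by (metis mult_eq_0_iff poly_mult)+
  then have "degree a = 0 \<or> degree b = 0" using deg by linarith
  then show "a dvd 1 \<or> b dvd 1" using nz by (auto simp: is_unit_iff_degree)
qed

lemma rpoly_of_rat: "rpoly g (of_rat r) = of_rat (poly g r)"
  by (induction g) (simp_all add: of_rat_add of_rat_mult)

lemma rpoly_cubic_roots:
  assumes h: "degree h = 3" and r: "rpoly h x0 = 0" "rpoly h x1 = 0" "rpoly h x2 = 0"
    and distinct: "x0 \<noteq> x1" "x1 \<noteq> x2" "x2 \<noteq> x0"
  shows "rpoly h y = 0 \<longleftrightarrow> y = x0 \<or> y = x1 \<or> y = x2"
proof
  let ?p = "map_poly of_rat h :: complex poly"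
  have p: "degree ?p = 3" using h by (subst degree_map_poly) auto
  then have nz: "?p \<noteq> 0" by auto
  assume "rpoly h y = 0"
  then have "{y, x0, x1, x2} \<subseteq> {x. poly ?p x = 0}" using r by (auto simp: rpoly_def)
  then have "card {y, x0, x1, x2} \<le> 3"
    using le_trans[OF card_mono[OF poly_roots_finite[OF nz]] card_poly_roots_bound[OF nz]] unfolding p by blast
  then show "y = x0 \<or> y = x1 \<or> y = x2" using distinct by (auto simp: card_insert_if split: if_splits)
qed (use r in auto)

text \<open>A cyclic cubic field in coordinates: \<open>t\<close> expresses a generator of the
  Galois group as a polynomial map on the roots. Both the Shanks polynomials and arbitrary cyclic
  cubic fields provide instances.\<close>

locale cyclic_cubic_poly =
  fixes h t :: "rat poly" and x0 x1 x2 :: complex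
  assumes irr: "irreducible h" and deg: "degree h = 3"
    and roots: "\<And>y. rpoly h y = 0 \<longleftrightarrow> y = x0 \<or> y = x1 \<or> y = x2"
    and distinct: "x0 \<noteq> x1" "x1 \<noteq> x2" "x2 \<noteq> x0"
    and t: "rpoly t x0 = x1" "rpoly t x1 = x2" "rpoly t x2 = x0"
begin

lemma h_nonzero: "h \<noteq> 0" using deg by auto

lemma h_dvd: "rpoly h y = 0 \<Longrightarrow> rpoly g y = 0 \<Longrightarrow> h dvd g"
  by (rule rpoly_irreducible_dvd[OF irr])

lemma rpoly_transfer: "rpoly h y = 0 \<Longrightarrow> rpoly h z = 0 \<Longrightarrow> rpoly g y = 0 \<Longrightarrow> rpoly g z = 0"
  by (auto dest: h_dvd elim!: dvdE)

lemma quad_independent: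
  assumes "a \<in> \<rat>" "b \<in> \<rat>" "c \<in> \<rat>" "a + b * x0 + c * x0\<^sup>2 = 0"
  shows "a = 0 \<and> b = 0 \<and> c = 0"
proof -
  obtain a' b' c' where abc: "a = of_rat a'" "b = of_rat b'" "c = of_rat c'"
    using assms(1-3) by (auto elim!: Rats_cases)
  have "rpoly [:a', b', c':] x0 = 0"
    using assms(4) by (simp add: abc power2_eq_square algebra_simps)
  then have "h dvd [:a', b', c':]" using h_dvd[of x0] roots by simp
  moreover have "degree [:a', b', c':] < degree h" unfolding deg by simp
  ultimately have "[:a', b', c':] = 0" using divides_degree by fastforce
  then show ?thesis by (simp add: abc)
qed

lemma qadj_conj: "qadj x1 = qadj x0" "qadj x2 = qadj x0"
proof -
  have "x1 \<in> qadj x0" "x2 \<in> qadj x1" "x0 \<in> qadj x2" using t by (metis qadjI)+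
  then show "qadj x1 = qadj x0" "qadj x2 = qadj x0" by (meson qadj_subset subset_antisym subset_trans)+
qed

lemma qadj_root: "rpoly h y = 0 \<Longrightarrow> qadj y = qadj x0"
  using roots qadj_conj by auto

lemma rat_adjoin_root: "rpoly h y = 0 \<Longrightarrow> rat_adjoin y = qadj x0"
  using rat_adjoin_eq_qadj[OF h_nonzero] qadj_root by simp

lemma subfield_L: "subfield (qadj x0) complex_ring"
  using subfield_qadj[OF h_nonzero] roots by simp

lemma L_eq_quad_span: "qadj x0 = quad_span x0"
proof -
  have dv: "h dvd g - (g mod h)" for g by (simp add: minus_mod_eq_mult_div)
  have "qadj x0 \<subseteq> quad_span x0"
  proof
    fix z assume "z \<in> qadj x0"
    then obtain g where g: "z = rpoly g x0" by (rule qadjE)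
    obtain k where "g - g mod h = h * k" using dv[of g] by blast
    then have "rpoly (g - g mod h) x0 = 0" using roots[of x0] by (simp only: rpoly_mult) simp
    then have z: "z = rpoly (g mod h) x0" by (simp add: g)
    have "degree (g mod h) < 3" using degree_mod_less[OF h_nonzero, of g] deg by auto
    then have "g mod h = [:coeff (g mod h) 0, coeff (g mod h) 1, coeff (g mod h) 2:]"
      by (intro poly_eqI) (auto simp: coeff_pCons coeff_eq_0 numeral_eq_Suc split: nat.split)
    then have "z = of_rat (coeff (g mod h) 0) + of_rat (coeff (g mod h) 1) * x0 + of_rat (coeff (g mod h) 2) * x0\<^sup>2"
      unfolding z by (metis (no_types) rpoly_pCons rpoly_0 mult_zero_right add_0_right mult.commute
          distrib_left mult.assoc power2_eq_square add.assoc)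
    then show "z \<in> quad_span x0"
      unfolding quad_span_def mem_Collect_eq using Rats_of_rat by blast
  qed
  then show ?thesis using quad_span_qadj by blast
qed

lemma dimension_L: "ring.dimension complex_ring 3 \<rat> (qadj x0)"
  unfolding L_eq_quad_span by (rule dimension_three) (use quad_independent in blast)

text \<open>The automorphism taking \<open>x0\<close> to the root \<open>y\<close>; irreducibility
  of \<open>h\<close> makes it independent of the chosen polynomial.\<close>

definition emb :: "complex \<Rightarrow> complex \<Rightarrow> complex" where
  "emb y = (\<lambda>z\<in>qadj x0. rpoly (SOME g. z = rpoly g x0) y)"

lemma emb_rpoly:
  assumes "rpoly h y = 0"
  shows "emb y (rpoly g x0) = rpoly g y"
proof -
  define k where "k = (SOME k. rpoly g x0 = rpoly k x0)"
  have "rpoly g x0 = rpoly k x0" unfolding k_def by (rule someI) simp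
  then have "rpoly (g - k) y = 0" using rpoly_transfer[of x0 y "g - k"] roots[of x0] assms by simp
  then show ?thesis by (simp add: emb_def k_def qadjI)
qed

lemma emb_carrier:
  assumes y: "rpoly h y = 0"
  shows "emb y \<in> carrier (galois_group (qadj x0) \<rat>)"
  unfolding galois_group_carrier[OF subfield_L qadj_Rats]
proof (intro conjI ballI)
  have inj: "inj_on (emb y) (qadj x0)"
  proof (rule inj_onI, elim qadjE)
    fix z z' g g' assume *: "emb y z = emb y z'" "z = rpoly g x0" "z' = rpoly g' x0"
    then have "rpoly (g - g') y = 0" using emb_rpoly[OF y] by simp
    then have "rpoly (g - g') x0 = 0" using rpoly_transfer[of y x0] y roots[of x0] by blast
    then show "z = z'" using * by simp
  qed
  have "emb y ` qadj x0 = qadj x0"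
  proof -
    have "emb y ` qadj x0 = qadj y"
      unfolding qadj_def image_image by (rule image_cong) (simp_all add: emb_rpoly[OF y])
    then show ?thesis using qadj_root[OF y] by simp
  qed
  then show "emb y \<in> Bij (qadj x0)" using inj by (simp add: Bij_def bij_betw_def emb_def)
  show "emb y 1 = 1" using emb_rpoly[OF y, of 1] by simp
  show "emb y x = x" if "x \<in> \<rat>" for x
    using that emb_rpoly[OF y, of "[:_:]"] by (auto elim!: Rats_cases)
  fix z z' assume "z \<in> qadj x0" "z' \<in> qadj x0"
  then obtain g g' where g: "z = rpoly g x0" "z' = rpoly g' x0" by (elim qadjE) blast
  show "emb y (z * z') = emb y z * emb y z'" "emb y (z + z') = emb y z + emb y z'"
    using emb_rpoly[OF y, of "g * g'"] emb_rpoly[OF y, of "g + g'"] by (simp_all add: g emb_rpoly[OF y])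
qed

lemma galois_conj:
  assumes "\<sigma> \<in> carrier (galois_group (qadj x0) \<rat>)"
  shows "rpoly h (\<sigma> x0) = 0" "\<sigma> = emb (\<sigma> x0)"
proof -
  have ev: "\<sigma> (rpoly g x0) = rpoly g (\<sigma> x0)" for g
    by (rule galois_group_rpoly[OF subfield_L qadj_Rats refl assms qadj_self])
  have "\<sigma> 0 = 0" using ev[of 0] by simp
  then show *: "rpoly h (\<sigma> x0) = 0" using ev[of h] roots[of x0] by simp
  have "\<sigma> \<in> extensional (qadj x0)"
    using assms by (simp add: galois_group_carrier[OF subfield_L qadj_Rats] Bij_def)
  then show "\<sigma> = emb (\<sigma> x0)"
  proof (rule extensionalityI)
    show "emb (\<sigma> x0) \<in> extensional (qadj x0)" by (simp add: emb_def)
    fix z assume "z \<in> qadj x0"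
    then obtain g where "z = rpoly g x0" by (rule qadjE)
    then show "\<sigma> z = emb (\<sigma> x0) z" using ev[of g] emb_rpoly[OF *, of g] by simp
  qed
qed

lemma galois_carrier: "carrier (galois_group (qadj x0) \<rat>) = {emb x0, emb x1, emb x2}"
proof (intro subset_antisym subsetI)
  fix \<sigma> assume s: "\<sigma> \<in> carrier (galois_group (qadj x0) \<rat>)"
  have "\<sigma> x0 = x0 \<or> \<sigma> x0 = x1 \<or> \<sigma> x0 = x2" using galois_conj(1)[OF s] roots by simp
  then have "emb (\<sigma> x0) \<in> {emb x0, emb x1, emb x2}" by auto
  then show "\<sigma> \<in> {emb x0, emb x1, emb x2}" by (subst galois_conj(2)[OF s])
qed (use emb_carrier roots in auto)

lemma emb_x0: "rpoly h y = 0 \<Longrightarrow> emb y x0 = y"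
  using emb_rpoly[of y "[:0, 1:]"] by simp

lemma galois_x0_next:
  assumes "\<sigma> \<in> carrier (galois_group (qadj x0) \<rat>)"
  shows "\<sigma> x1 = rpoly t (\<sigma> x0)" "\<sigma> x2 = rpoly t (rpoly t (\<sigma> x0))"
  using galois_group_rpoly[OF subfield_L qadj_Rats refl assms qadj_self, of t]
    galois_group_rpoly[OF subfield_L qadj_Rats refl assms qadj_self, of "pcompose t t"] by (simp_all add: t)

text \<open>A generator cannot fix \<open>x0\<close> and commutes with \<open>t\<close>, so its
  value at \<open>x0\<close> decides everything. Both orientations of the 3-cycle occur, since a
  group of order 3 has two generators.\<close>

lemma galois_generator_orbit:
  assumes \<sigma>: "\<sigma> \<in> carrier (galois_group (qadj x0) \<rat>)"
    and gen: "generate (galois_group (qadj x0) \<rat>) {\<sigma>} = carrier (galois_group (qadj x0) \<rat>)"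
  shows "\<sigma> x0 = x1 \<and> \<sigma> x1 = x2 \<and> \<sigma> x2 = x0 \<or> \<sigma> x0 = x2 \<and> \<sigma> x2 = x1 \<and> \<sigma> x1 = x0"
proof -
  have "\<sigma> x0 \<noteq> x0"
  proof
    assume "\<sigma> x0 = x0"
    then have "emb x1 x0 = x0"
      using galois_group_generate_fixed[OF subfield_L qadj_Rats \<sigma> qadj_self] gen emb_carrier[of x1] roots by blast
    then show False using emb_x0[of x1] roots distinct by simp
  qed
  then have "\<sigma> x0 = x1 \<or> \<sigma> x0 = x2" using galois_conj(1)[OF \<sigma>] roots by blast
  then show ?thesis using galois_x0_next[OF \<sigma>] t by auto
qed

lemma cyclic_cubic: "cyclic_cubic_field (qadj x0)"
proof -
  interpret R: ring complex_ring by (rule ring_complex_ring)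
  let ?G = "galois_group (qadj x0) \<rat>"
  interpret G: group ?G by (rule group_galois_group[OF subfield_L qadj_Rats])
  have r: "rpoly h x0 = 0" "rpoly h x1 = 0" "rpoly h x2 = 0" using roots by auto
  have e: "emb x0 \<in> carrier ?G" "emb x1 \<in> carrier ?G" "emb x2 \<in> carrier ?G" using emb_carrier r by auto
  have one: "emb x0 = \<one>\<^bsub>?G\<^esub>"
    unfolding galois_group_one[OF subfield_L qadj_Rats] emb_def
    by (rule restrict_ext) (metis (mono_tags) qadjE someI)
  have sq: "emb x1 \<otimes>\<^bsub>?G\<^esub> emb x1 = emb x2"
  proof -
    have "(emb x1 \<otimes>\<^bsub>?G\<^esub> emb x1) x0 = x2"
      using galois_group_mult[OF subfield_L qadj_Rats e(2) e(2)] emb_x0[OF r(2)] emb_rpoly[OF r(2), of t]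
      by (simp add: compose_def t)
    then show ?thesis using galois_conj(2)[OF G.m_closed[OF e(2) e(2)]] by simp
  qed
  have "carrier ?G \<subseteq> generate ?G {emb x1}"
    unfolding galois_carrier one sq[symmetric] by (auto intro: generate.intros)
  moreover have "generate ?G {emb x1} \<subseteq> carrier ?G" by (rule G.generate_incl) (use e in simp)
  ultimately have "subgroup_generated ?G {emb x1} = ?G"
    unfolding subgroup_generated_def using e(2) by simp
  then have cyc: "cyclic_group ?G" unfolding cyclic_group_def using e(2) by blast
  have "{z \<in> qadj x0. \<forall>\<sigma>\<in>carrier ?G. \<sigma> z = z} \<subseteq> \<rat>"
  proof clarify
    fix z assume z: "z \<in> qadj x0" "\<forall>\<sigma>\<in>carrier ?G. \<sigma> z = z"
    obtain a b c where g: "z = rpoly [:a, b, c:] x0"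
      using z(1) unfolding L_eq_quad_span quad_span_def
      by (force elim!: Rats_cases simp: power2_eq_square algebra_simps)
    have "emb x1 z = z" "emb x2 z = z" using z(2) e by auto
    then have eq: "rpoly [:a, b, c:] x1 = rpoly [:a, b, c:] x0" "rpoly [:a, b, c:] x2 = rpoly [:a, b, c:] x0"
      using emb_rpoly[OF r(2), of "[:a, b, c:]"] emb_rpoly[OF r(3), of "[:a, b, c:]"] unfolding g by metis+
    let ?b = "of_rat b :: complex" and ?c = "of_rat c :: complex"
    \<comment> \<open>A polynomial of degree at most 2 that takes the same value at three distinct
      points is constant.\<close>
    have "(x1 - x0) * (?b + ?c * (x1 + x0)) = 0" "(x2 - x0) * (?b + ?c * (x2 + x0)) = 0"
      using eq by (simp_all add: algebra_simps)
    then have bc: "?b + ?c * (x1 + x0) = 0" "?b + ?c * (x2 + x0) = 0" using distinct by auto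
    have "?c * (x1 - x2) = (?b + ?c * (x1 + x0)) - (?b + ?c * (x2 + x0))" by (simp add: algebra_simps)
    also have "\<dots> = 0" unfolding bc by simp
    finally have "?c = 0" using distinct by simp
    then have "z = of_rat a" using bc(1) by (simp add: g)
    then show "z \<in> \<rat>" by simp
  qed
  then have fixed: "{z \<in> qadj x0. \<forall>\<sigma>\<in>carrier ?G. \<sigma> z = z} = \<rat>"
    using qadj_Rats by (auto simp: galois_group_carrier[OF subfield_L qadj_Rats])
  then show ?thesis
    unfolding cyclic_cubic_field_def galois_extension_def
    using cyc fixed dimension_L subfield_L subfield_Rats qadj_Rats R.finite_dimensionI[OF dimension_L] by blast
qed

end


text \<open>A generator of the Galois group is not known in advance to have order 3. The dimension
  excludes an involution, which gives three distinct conjugates; a linear relation for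
  \<open>x0\<close> then supplies \<open>h\<close>, and the rest follows.\<close>

lemma cyclic_cubic_field_generator:
  assumes L: "cyclic_cubic_field L"
  obtains h t x0 x1 x2 where "cyclic_cubic_poly h t x0 x1 x2" "L = qadj x0"
proof -
  let ?G = "galois_group L \<rat>"
  have K: "subfield L complex_ring" "\<rat> \<subseteq> L" and dim: "ring.dimension complex_ring 3 \<rat> L"
    and fixed: "{x \<in> L. \<forall>\<sigma>\<in>carrier ?G. \<sigma> x = x} = \<rat>" and cyc: "cyclic_group ?G"
    using L by (auto simp: cyclic_cubic_field_def galois_extension_def)
  note KD = subfield_complexD[OF K(1)] and inj = galois_group_inj[OF K] and cl = galois_group_closed[OF K]
    and ev = galois_group_rpoly[OF K refl]
  obtain \<tau> where \<tau>: "\<tau> \<in> carrier ?G" "generate ?G {\<tau>} = carrier ?G"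
  proof -
    obtain \<tau> where \<tau>: "\<tau> \<in> carrier ?G" "subgroup_generated ?G {\<tau>} = ?G"
      using cyc by (auto simp: cyclic_group_def)
    then have "carrier ?G \<inter> {\<tau>} = {\<tau>}" by blast
    then have "generate ?G {\<tau>} = carrier ?G" using \<tau>(2) carrier_subgroup_generated[of ?G "{\<tau>}"] by simp
    then show ?thesis using that \<tau>(1) by blast
  qed
  have rat: "z \<in> \<rat>" if "z \<in> L" "\<tau> z = z" for z
    using fixed galois_group_generate_fixed[OF K \<tau>(1) that] that(1) \<tau>(2) by blast
  have ratI: "\<tau> z = z" if "z \<in> \<rat>" for z
    using \<tau>(1) that by (simp add: galois_group_carrier[OF K])
  have add: "\<tau> (x + y) = \<tau> x + \<tau> y" and mult: "\<tau> (x * y) = \<tau> x * \<tau> y" if "x \<in> L" "y \<in> L" for x y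
    using \<tau>(1) that by (simp_all add: galois_group_carrier[OF K])
  have dL: "x - y \<in> L" if "x \<in> L" "y \<in> L" for x y
    using KD(5)[OF that(1) KD(3)[OF that(2)]] by simp
  have diff: "\<tau> (x - y) = \<tau> x - \<tau> y" if "x \<in> L" "y \<in> L" for x y
    using add[OF dL[OF that] that(2)] by simp
  note \<tau>L = cl[OF \<tau>(1)]
  interpret Ring.field complex_ring by (rule field_complex_ring)
  have "\<exists>z\<in>L. \<tau> (\<tau> z) \<noteq> z"
  proof (rule ccontr)
    assume "\<not> ?thesis"
    then have inv2: "\<tau> (\<tau> z) = z" if "z \<in> L" for z using that by blast
    have "L \<noteq> \<rat>"
    proof
      assume "L = \<rat>"
      then have "dimension 1 \<rat> L" using dimension_one[OF subfield_Rats] by simp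
      then show False using dimension_is_inj[OF subfield_Rats _ dim] by fastforce
    qed
    then obtain w0 where w0: "w0 \<in> L" "w0 \<notin> \<rat>" using K(2) by blast
    \<comment> \<open>If the generator were an involution, \<open>w\<close> would be anti-invariant.
      Each \<open>z\<close> is half the sum of \<open>z + \<tau> z\<close> and
      \<open>z - \<tau> z\<close>; the former is rational, and the latter is a rational multiple of
      \<open>w\<close> because a product of two anti-invariant elements is rational. So L would have
      dimension 2.\<close>
    define w where "w = w0 - \<tau> w0"
    have wL: "w \<in> L" using w0 \<tau>L dL by (simp add: w_def)
    have w1: "\<tau> w = - w" using w0 \<tau>L inv2 by (simp add: w_def diff)
    have w2: "w \<noteq> 0" using rat[OF w0(1)] w0(2) by (auto simp: w_def)
    have w3: "w \<notin> \<rat>" using ratI[of w] w1 w2 by auto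
    have "L = {a + b * w | a b. a \<in> \<rat> \<and> b \<in> \<rat>}"
    proof (intro subset_antisym subsetI)
      fix z assume z: "z \<in> L"
      define v where "v = z - \<tau> z"
      have vL: "v \<in> L" using z \<tau>L dL by (simp add: v_def)
      have "\<tau> v = - v" using z \<tau>L inv2 by (simp add: v_def diff)
      then have r: "v * w \<in> \<rat>" "w * w \<in> \<rat>"
        using rat[OF KD(4)[OF vL wL]] rat[OF KD(4)[OF wL wL]] mult[OF vL wL] mult[OF wL wL] w1 by simp_all
      have "\<tau> (z + \<tau> z) = z + \<tau> z" using z \<tau>L inv2 by (simp add: add add.commute)
      then have s: "z + \<tau> z \<in> \<rat>" using rat KD(5)[OF z \<tau>L[OF z]] by blast
      have "z = (z + \<tau> z) / 2 + (v * w) / (2 * (w * w)) * w"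
        using w2 by (simp add: v_def field_simps)
      moreover have "(z + \<tau> z) / 2 \<in> \<rat>" "(v * w) / (2 * (w * w)) \<in> \<rat>"
        by (rule Rats_divide[OF s Rats_number_of], rule Rats_divide[OF r(1) Rats_mult[OF Rats_number_of r(2)]])
      ultimately show "z \<in> {a + b * w | a b. a \<in> \<rat> \<and> b \<in> \<rat>}" by blast
    next
      fix z assume "z \<in> {a + b * w | a b. a \<in> \<rat> \<and> b \<in> \<rat>}"
      then show "z \<in> L" using K(2) KD(4,5) wL by blast
    qed
    then have "dimension 2 \<rat> L" using dimension_two[OF w3] by simp
    then show False using dimension_is_inj[OF subfield_Rats _ dim] by fastforce
  qed
  then obtain x0 where x0: "x0 \<in> L" "\<tau> (\<tau> x0) \<noteq> x0" by blast
  define x1 x2 where "x1 = \<tau> x0" and "x2 = \<tau> x1"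
  have xL: "x0 \<in> L" "x1 \<in> L" "x2 \<in> L" using x0 \<tau>L by (simp_all add: x1_def x2_def)
  have d20: "x2 \<noteq> x0" using x0 by (simp add: x1_def x2_def)
  then have d01: "x0 \<noteq> x1" by (metis x1_def x2_def)
  then have d12: "x1 \<noteq> x2" using inj[OF \<tau>(1) xL(1,2)] by (auto simp: x1_def x2_def)
  have dist: "x0 \<noteq> x1" "x1 \<noteq> x2" "x2 \<noteq> x0" by (fact d01 d12 d20)+
  have ev0: "\<tau> (rpoly g x) = rpoly g (\<tau> x)" if "x \<in> L" for g x by (rule ev[OF \<tau>(1) that])
  have vanish: "rpoly g x1 = 0 \<and> rpoly g x2 = 0" if "rpoly g x0 = 0" for g
    using that ev0[OF xL(1), of g] ev0[OF xL(2), of g] ratI[of 0] by (simp add: x1_def x2_def)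
  \<comment> \<open>Applying \<open>\<tau>\<close> transports a quadratic relation for
    \<open>x0\<close> to \<open>x1\<close> and \<open>x2\<close>, and three distinct roots are too
    many.\<close>
  have "dimension 3 \<rat> (quad_span x0)"
  proof (rule dimension_three)
    fix a b c assume "a \<in> \<rat>" "b \<in> \<rat>" "c \<in> \<rat>" and eq: "a + b * x0 + c * x0\<^sup>2 = 0"
    then obtain a' b' c' where abc: "a = of_rat a'" "b = of_rat b'" "c = of_rat c'"
      by (auto elim!: Rats_cases)
    have 0: "a + x0 * (b + x0 * c) = 0" using eq by (simp add: power2_eq_square algebra_simps)
    then have 12: "a + x1 * (b + x1 * c) = 0" "a + x2 * (b + x2 * c) = 0"
      using vanish[of "[:a', b', c':]"] by (simp_all add: abc)
    have "(x1 - x0) * (b + c * (x1 + x0)) = (a + x1 * (b + x1 * c)) - (a + x0 * (b + x0 * c))"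
      "(x2 - x0) * (b + c * (x2 + x0)) = (a + x2 * (b + x2 * c)) - (a + x0 * (b + x0 * c))"
      by (simp_all add: algebra_simps)
    then have bc: "b + c * (x1 + x0) = 0" "b + c * (x2 + x0) = 0" using 0 12 dist by auto
    have "c * (x1 - x2) = (b + c * (x1 + x0)) - (b + c * (x2 + x0))" by (simp add: algebra_simps)
    then have "c = 0" using bc dist by simp
    then show "b = 0 \<and> c = 0" using bc by simp
  qed
  moreover have "quad_span x0 \<subseteq> L"
  proof
    fix z assume "z \<in> quad_span x0"
    then obtain a b c where abc: "z = a + b * x0 + c * (x0 * x0)" "a \<in> L" "b \<in> L" "c \<in> L"
      using K(2) unfolding quad_span_def power2_eq_square by blast
    show "z \<in> L" unfolding abc(1) by (intro KD(4,5) abc(2-4) xL(1))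
  qed
  ultimately have LQ: "quad_span x0 = L" by (intro dimension_three_subset_eq dim)
  have "qadj x0 \<subseteq> L" using subfield_rpoly[OF K xL(1)] by (auto elim: qadjE)
  then have Lq: "L = qadj x0" using LQ quad_span_qadj by blast
  obtain t where t: "x1 = rpoly t x0" using xL(2) unfolding Lq by (rule qadjE)
  have t1: "x2 = rpoly t x1" using ev0[OF xL(1), of t] t by (simp add: x1_def x2_def)
  then have t2: "\<tau> x2 = rpoly t x2" using ev0[OF xL(2), of t] by (simp add: x2_def)
  have "x0 * (x0 * x0) \<in> quad_span x0" unfolding LQ by (intro KD(4) xL(1))
  then obtain a b c where abc: "x0 * (x0 * x0) = of_rat a + of_rat b * x0 + of_rat c * x0\<^sup>2"
    unfolding quad_span_def by (auto elim!: Rats_cases)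
  define h where "h = [:- a, - b, - c, 1:]"
  have h0: "rpoly h x0 = 0" using abc by (simp add: h_def of_rat_minus power2_eq_square algebra_simps)
  have h12: "rpoly h x1 = 0" "rpoly h x2 = 0" using vanish[OF h0] by auto
  have hdeg: "degree h = 3" by (simp add: h_def)
  note roots = rpoly_cubic_roots[OF hdeg h0 h12 dist]
  have "irreducible h"
  proof (rule irreducible_cubicI[OF hdeg])
    fix r
    have "x0 \<notin> \<rat>" "x1 \<notin> \<rat>" "x2 \<notin> \<rat>"
      using ratI[of x0] ratI[of x1] dist inj[OF \<tau>(1) xL(2,3)] ratI[of x2] by (auto simp: x1_def x2_def)
    then have "rpoly h (of_rat r) \<noteq> 0" unfolding roots by (metis Rats_of_rat)
    then show "poly h r \<noteq> 0" by (simp add: rpoly_of_rat)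
  qed
  \<comment> \<open>\<open>\<tau> x2\<close> is again a root of \<open>h\<close>, and injectivity
    excludes \<open>x1\<close> and \<open>x2\<close>; this closes the 3-cycle.\<close>
  moreover have "\<tau> x2 = x0"
  proof -
    have "rpoly h (\<tau> x2) = 0" using ev0[OF xL(3), of h] h12(2) ratI[of 0] by simp
    moreover have "\<tau> x2 \<noteq> x1" using inj[OF \<tau>(1) xL(3,1)] dist by (auto simp: x1_def)
    moreover have "\<tau> x2 \<noteq> x2" using inj[OF \<tau>(1) xL(3,2)] dist by (auto simp: x2_def)
    ultimately show ?thesis using roots by blast
  qed
  ultimately have "cyclic_cubic_poly h t x0 x1 x2"
    unfolding cyclic_cubic_poly_def using hdeg roots dist t t1 t2 by simp
  then show ?thesis using that Lq by blast
qed

section \<open>Gaussian periods\<close>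

lemma embeddings_zeta:
  assumes n: "n > 0" and y: "y \<in> qadj (zeta n)"
  shows "embeddings (qadj (zeta n)) (qadj y) =
    (\<lambda>a. restrict (conj_map n a) (qadj (zeta n))) ` {a \<in> {0..<int n}. coprime a (int n) \<and> conj_map n a y = y}"
proof (intro subset_antisym subsetI)
  let ?K = "qadj (zeta n)"
  fix \<tau> assume "\<tau> \<in> embeddings ?K (qadj y)"
  then have ext: "\<tau> \<in> extensional ?K" and one: "\<tau> 1 = 1" and fx: "\<And>x. x \<in> qadj y \<Longrightarrow> \<tau> x = x"
    and mult: "\<And>u v. u \<in> ?K \<Longrightarrow> v \<in> ?K \<Longrightarrow> \<tau> (u * v) = \<tau> u * \<tau> v"
    and add: "\<And>u v. u \<in> ?K \<Longrightarrow> v \<in> ?K \<Longrightarrow> \<tau> (u + v) = \<tau> u + \<tau> v"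
    by (auto simp: embeddings_def ring_hom_def)
  have ev: "\<tau> (rpoly g (zeta n)) = rpoly g (\<tau> (zeta n))" for g
  proof (induction g)
    case 0
    show ?case using fx[of 0] by simp
  next
    case (pCons c g)
    then show ?case using fx[of "of_rat c"] by (simp add: add mult qadj_mult qadjI)
  qed
  have inj: "u = 0" if u: "u \<in> ?K" "\<tau> u = 0" for u
  proof (rule ccontr)
    assume "u \<noteq> 0"
    moreover have "inverse u \<in> ?K" using zeta_algebraic[OF n] qadj_inverse u(1) by blast
    ultimately have "\<tau> 1 = \<tau> u * \<tau> (inverse u)" using mult[OF u(1), of "inverse u"] by simp
    then show False using one u(2) by simp
  qed
  have "\<tau> (zeta n) ^ n = 1" using ev[of "monom 1 n"] one by simp
  then obtain k where k: "k < n" "\<tau> (zeta n) = zeta n powi int k"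
    using bij_betw_roots_unity[OF n] unfolding bij_betw_def zeta_powi by (auto simp: image_iff set_eq_iff)
  \<comment> \<open>A common factor \<open>g\<close> would make the embedding send the nonzero
    element \<open>zeta n ^ (n / g) - 1\<close> to 0.\<close>
  have cop: "coprime (int k) (int n)"
  proof (rule ccontr)
    assume "\<not> coprime (int k) (int n)"
    then have g1: "gcd k n \<noteq> 1" by (simp add: coprime_iff_gcd_eq_1)
    define g where "g = gcd k n"
    have "g dvd k" "g dvd n" by (simp_all add: g_def)
    then obtain j e where je: "k = g * j" "n = g * e" by (elim dvdE)
    have "k * e = n * j" by (simp add: je)
    then have "int n dvd int k * int e" by (metis dvd_triv_left of_nat_mult)
    then have "zeta n powi (int k * int e) = 1" using zeta_powi_eq_1_iff[OF n] by blast
    then have "\<tau> (zeta n ^ e) = 1" using ev[of "monom 1 e"] k(2) by (simp add: power_int_mult)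
    moreover have "\<tau> (- 1) = - 1" using fx[of "- 1"] qadj_minus[OF qadj_1] by blast
    ultimately have "\<tau> (zeta n ^ e + (- 1)) = 0"
      using add[of "zeta n ^ e" "- 1"] by (simp add: qadj_power qadj_minus)
    then have "zeta n ^ e + (- 1) = 0"
      by (rule inj[OF qadj_add[OF qadj_power[OF qadj_self] qadj_minus[OF qadj_1]]])
    then have "zeta n powi int e = 1" by simp
    then have "n dvd e" using zeta_powi_eq_1_iff[OF n, of "int e"] by simp
    moreover have "e > 0" using je n by (cases e) auto
    ultimately have "n \<le> e" using dvd_imp_le by blast
    moreover have "g \<ge> 2" using g1 n je(2) unfolding g_def[symmetric] by (cases g) auto
    then have "2 * e \<le> g * e" by (rule mult_right_mono) simp
    ultimately show False using je(2) \<open>e > 0\<close> by linarith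
  qed
  have \<tau>: "\<tau> u = conj_map n (int k) u" if "u \<in> ?K" for u
    using that by (elim qadjE) (simp add: ev k(2) conj_map_rpoly[OF n cop])
  have "\<tau> = restrict (conj_map n (int k)) ?K"
    using ext \<tau> by (intro extensionalityI[of \<tau> ?K]) auto
  moreover have "conj_map n (int k) y = y" using fx[of y] \<tau>[OF y] by simp
  ultimately show "\<tau> \<in> (\<lambda>a. restrict (conj_map n a) ?K) ` {a \<in> {0..<int n}. coprime a (int n) \<and> conj_map n a y = y}"
    using k(1) cop by auto
next
  let ?K = "qadj (zeta n)"
  fix \<tau> assume "\<tau> \<in> (\<lambda>a. restrict (conj_map n a) ?K) ` {a \<in> {0..<int n}. coprime a (int n) \<and> conj_map n a y = y}"
  then obtain a where a: "coprime a (int n)" "conj_map n a y = y" "\<tau> = restrict (conj_map n a) ?K" by blast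
  have "\<tau> x = x" if x: "x \<in> qadj y" for x
  proof -
    obtain g where "x = rpoly g y" using x by (rule qadjE)
    then show ?thesis using a conj_map_eval[OF n a(1) y, of g] qadj_rpoly[OF y, of g] by simp
  qed
  moreover have "conj_map n a 1 = 1" using conj_map_of_rat[OF n a(1), of 1] by simp
  ultimately show "\<tau> \<in> embeddings ?K (qadj y)"
    unfolding embeddings_def ring_hom_def
    by (auto simp: a(3) conj_map_add[OF n a(1)] conj_map_mult[OF n a(1)] qadj_add qadj_mult)
qed

text \<open>The embeddings over Q(y) are the conjugations by units in the kernel of
  \<open>\<chi>\<close>, distinct residues giving distinct embeddings, so the trace of
  \<open>zeta n\<close> is the kernel sum.\<close>

lemma gaussian_period_eq:
  assumes n: "n > 0" and \<chi>: "cubic_char n \<chi>" and y: "y \<in> qadj (zeta n)"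
    and fixed: "\<And>a. coprime a (int n) \<Longrightarrow> conj_map n a y = y \<longleftrightarrow> \<chi> a = 1"
  shows "gaussian_period n (qadj y) = cubic_period n \<chi> 1"
proof -
  let ?K = "qadj (zeta n)" and ?A = "{a \<in> {0..<int n}. coprime a (int n) \<and> conj_map n a y = y}"
  have A: "?A = {a \<in> {0..<int n}. \<chi> a = 1}"
    using fixed cubic_char_zero[OF n \<chi>] by force
  have val: "restrict (conj_map n a) ?K (zeta n) = zeta n powi a" if "coprime a (int n)" for a
    using conj_map_zeta[OF n that, of 1] by simp
  have inj: "inj_on (\<lambda>a. restrict (conj_map n a) ?K) ?A"
  proof (rule inj_onI)
    fix a b assume ab: "a \<in> ?A" "b \<in> ?A" "restrict (conj_map n a) ?K = restrict (conj_map n b) ?K"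
    then have "zeta n powi a = zeta n powi b" using val by (metis (no_types, lifting) mem_Collect_eq)
    then show "a = b" using ab zeta_powi_cong_iff[OF n] by (simp add: cong_def)
  qed
  have "gaussian_period n (qadj y) = (\<Sum>\<tau>\<in>embeddings ?K (qadj y). \<tau> (zeta n))"
    by (simp add: gaussian_period_def field_trace_def rat_adjoin_zeta[OF n])
  also have "\<dots> = (\<Sum>a\<in>?A. restrict (conj_map n a) ?K (zeta n))"
    unfolding embeddings_zeta[OF n y] by (rule sum.reindex[OF inj, unfolded comp_def])
  also have "\<dots> = (\<Sum>a\<in>?A. zeta n powi a)" by (rule sum.cong) (use val in auto)
  also have "\<dots> = cubic_period n \<chi> 1"
    unfolding A cubic_period_def by (simp add: sum.If_cases Int_def)
  finally show ?thesis .
qed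

context cyclic_cubic_poly
begin

text \<open>Identifies the Galois group of Q(x0) with the cube roots of unity by the position of the
  image of \<open>x0\<close> in the cycle \<open>x0\<close>, \<open>x1\<close>,
  \<open>x2\<close>.\<close>

definition cubic_index_char :: "nat \<Rightarrow> int \<Rightarrow> complex" where
  "cubic_index_char f a = (if \<not> coprime a (int f) then 0 else if conj_map f a x0 = x0 then 1
    else if conj_map f a x0 = x1 then zeta 3 else zeta 3 ^ 2)"

text \<open>Conjugation commutes with the polynomial map \<open>t\<close>, so positions in the cycle
  add up under composition; this is multiplicativity of the character.\<close>

lemma cubic_index_char:
  assumes f: "f > 0" and x0: "x0 \<in> qadj (zeta f)"
  shows "cubic_char f (cubic_index_char f)"
    and "coprime a (int f) \<Longrightarrow> cubic_index_char f a = 1 \<longleftrightarrow> conj_map f a x0 = x0"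
proof -
  define xs where "xs i = (rpoly t ^^ i) x0" for i
  have xs0: "xs 0 = x0" "xs 1 = x1" "xs 2 = x2" "xs 3 = x0"
    by (simp_all add: xs_def t numeral_2_eq_2 numeral_3_eq_3)
  have xs_mod: "xs i = xs (i mod 3)" for i
  proof -
    have "(rpoly t ^^ (3 * k)) x0 = x0" for k
      using xs0(4) by (induction k) (simp_all add: funpow_add xs_def)
    then have "(rpoly t ^^ (i mod 3 + 3 * (i div 3))) x0 = (rpoly t ^^ (i mod 3)) x0"
      by (simp only: funpow_add comp_apply)
    then show ?thesis by (simp add: xs_def)
  qed
  have zmod: "zeta 3 ^ i = zeta 3 ^ (i mod 3)" for i by (rule zeta_power_mod)
  have val: "cubic_index_char f a = zeta 3 ^ i" if a: "coprime a (int f)" "conj_map f a x0 = xs i" for a i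
  proof -
    have "i mod 3 = 0 \<or> i mod 3 = 1 \<or> i mod 3 = 2" by presburger
    then have "cubic_index_char f a = zeta 3 ^ (i mod 3)"
      using a xs_mod[of i] xs0 distinct by (auto simp: cubic_index_char_def)
    then show ?thesis using zmod[of i] by simp
  qed
  have ex: "\<exists>i. conj_map f a x0 = xs i" if a: "coprime a (int f)" for a
  proof -
    have "rpoly h (conj_map f a x0) = conj_map f a (rpoly h x0)" by (simp add: conj_map_eval[OF f a x0])
    also have "rpoly h x0 = of_rat 0" using roots by simp
    finally have "rpoly h (conj_map f a x0) = 0" using conj_map_of_rat[OF f a, of 0] by simp
    then show ?thesis unfolding roots using xs0 by metis
  qed
  have xs_eval: "\<exists>g. \<forall>z. (rpoly t ^^ i) z = rpoly g z" for i
  proof (induction i)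
    case 0
    show ?case by (intro exI[of _ "[:0, 1:]"]) simp
  next
    case (Suc i)
    then obtain g where "\<forall>z. (rpoly t ^^ i) z = rpoly g z" by blast
    then show ?case by (intro exI[of _ "pcompose t g"]) simp
  qed
  show "cubic_char f (cubic_index_char f)"
    unfolding cubic_char_def
  proof (intro conjI allI impI)
    fix a b
    show "cubic_index_char f (a * b) = cubic_index_char f a * cubic_index_char f b"
    proof (cases "coprime a (int f) \<and> coprime b (int f)")
      case True
      then have a: "coprime a (int f)" and b: "coprime b (int f)" by auto
      obtain i j where ij: "conj_map f a x0 = xs i" "conj_map f b x0 = xs j" using ex a b by metis
      obtain g where g: "\<And>z. (rpoly t ^^ j) z = rpoly g z" using xs_eval by blast
      have "conj_map f (a * b) x0 = conj_map f a (xs j)"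
        using conj_map_mult_index[OF f a b x0] ij by simp
      also have "\<dots> = (rpoly t ^^ j) (xs i)"
        unfolding xs_def[of j] g conj_map_eval[OF f a x0] ij ..
      also have "\<dots> = xs (j + i)" by (simp add: xs_def funpow_add)
      finally have "conj_map f (a * b) x0 = xs (j + i)" .
      then have "cubic_index_char f (a * b) = zeta 3 ^ (j + i)" using val a b by simp
      then show ?thesis using val[OF a ij(1)] val[OF b ij(2)] by (simp add: power_add)
    qed (auto simp: cubic_index_char_def)
  next
    fix a b assume ab: "[a = b] (mod int f)"
    then have "coprime a (int f) \<longleftrightarrow> coprime b (int f)" using cong_imp_coprime cong_sym by blast
    then show "cubic_index_char f a = cubic_index_char f b"
      using conj_map_cong[OF ab] by (simp add: cubic_index_char_def)
  next
    fix a assume a: "coprime a (int f)"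
    then obtain i where "cubic_index_char f a = zeta 3 ^ i" using ex val by blast
    then have "cubic_index_char f a ^ 3 = (zeta 3 ^ 3) ^ i" by (simp only: power_mult[symmetric] mult.commute)
    then show "cubic_index_char f a ^ 3 = 1" by (simp only: zeta3_cube power_one)
  qed (auto simp: cubic_index_char_def)
  have "zeta 3 ^ 2 \<noteq> 1"
    using zeta3_cube zeta3_ne_1 by (auto simp: power2_eq_square power3_eq_cube)
  then show "cubic_index_char f a = 1 \<longleftrightarrow> conj_map f a x0 = x0" if "coprime a (int f)"
    using that zeta3_ne_1 by (auto simp: cubic_index_char_def)
qed

text \<open>If the character were trivial on the units that are 1 modulo \<open>f div q\<close>,
  averaging would place \<open>x0\<close> in the smaller cyclotomic field, against minimality of
  \<open>f\<close>.\<close>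

lemma primitive_cubic_index_char:
  assumes f: "f > 0" and x0: "x0 \<in> qadj (zeta f)"
    and min: "\<And>m. m > 0 \<Longrightarrow> x0 \<in> qadj (zeta m) \<Longrightarrow> f \<le> m"
  shows "primitive_char f (cubic_index_char f)"
  unfolding primitive_char_def
proof (intro conjI allI impI cubic_index_char(1)[OF f x0])
  fix q assume q: "prime q \<and> q dvd f"
  show "\<exists>a. [a = 1] (mod int (f div q)) \<and> coprime a (int f) \<and> cubic_index_char f a \<noteq> 1"
  proof (rule ccontr)
    assume "\<not> ?thesis"
    then have "x0 \<in> qadj (zeta (f div q))"
      using q cubic_index_char(2)[OF f x0] by (intro qadj_averaging[OF f _ _ x0]) auto
    moreover have q1: "q > 1" using q prime_gt_1_nat by blast
    moreover have "f div q > 0" using q f q1 by (auto simp: div_greater_zero_iff dvd_imp_le)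
    ultimately have "f \<le> f div q" using min by blast
    moreover have "f div q < f" using f q1 by simp
    ultimately show False by simp
  qed
qed

end

section \<open>The simplest cubic fields\<close>

lemma rpoly_shanks_poly:
  "rpoly (shanks_poly n) x = x ^ 3 - of_rat n * x\<^sup>2 - (of_rat n + 3) * x - 1"
  by (simp add: shanks_poly_def of_rat_add of_rat_diff of_rat_minus power2_eq_square power3_eq_cube algebra_simps)

lemma degree_shanks_poly: "degree (shanks_poly n) = 3"
  by (simp add: shanks_poly_def)

text \<open>The polynomial \<open>t\<close> represents the substitution \<open>\<rho> \<mapsto> - 1 / (1 + \<rho>)\<close> of order 3 on the roots.\<close>

lemma shanks_cyclic_cubic_poly:
  assumes irr: "irreducible (shanks_poly n)" and \<rho>: "rpoly (shanks_poly n) \<rho> = 0"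
  defines "t \<equiv> [:- 2, - (n + 1), 1:]"
  shows "cyclic_cubic_poly (shanks_poly n) t \<rho> (rpoly t \<rho>) (rpoly t (rpoly t \<rho>))"
proof -
  let ?h = "shanks_poly n" and ?n = "of_rat n :: complex"
  have t: "rpoly t x = x\<^sup>2 - (?n + 1) * x - 2" for x
    by (simp add: t_def of_rat_add of_rat_diff of_rat_minus power2_eq_square algebra_simps)
  \<comment> \<open>This is where the coefficients of \<open>t\<close> come from: the product is the
    Shanks polynomial minus 1.\<close>
  have step: "(1 + x) * rpoly t x = - 1" if "rpoly ?h x = 0" for x
  proof -
    have "(1 + x) * rpoly t x = rpoly ?h x - 1"
      unfolding t rpoly_shanks_poly by (simp add: power2_eq_square power3_eq_cube algebra_simps)
    then show ?thesis using that by simp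
  qed
  have root: "rpoly ?h (rpoly t x) = 0" if x: "rpoly ?h x = 0" for x
  proof -
    let ?y = "rpoly t x"
    have s: "x * ?y = - 1 - ?y" using step[OF x] by (simp add: algebra_simps)
    have "1 + x \<noteq> 0" using step[OF x] by auto
    \<comment> \<open>Clearing denominators after the substitution of \<open>- 1 / (1 + x)\<close>
      returns minus the Shanks polynomial at \<open>x\<close>.\<close>
    have "(1 + x) ^ 3 * rpoly ?h ?y = ((1 + x) * ?y) ^ 3 - ?n * (1 + x) * ((1 + x) * ?y)\<^sup>2
      - (?n + 3) * (1 + x)\<^sup>2 * ((1 + x) * ?y) - (1 + x) ^ 3"
      unfolding rpoly_shanks_poly by (simp add: power2_eq_square power3_eq_cube algebra_simps)
    also have "\<dots> = - rpoly ?h x"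
      unfolding step[OF x] rpoly_shanks_poly by (simp add: power2_eq_square power3_eq_cube algebra_simps)
    finally show ?thesis using x \<open>1 + x \<noteq> 0\<close> by simp
  qed
  have moved: "rpoly t x \<noteq> x" if x: "rpoly ?h x = 0" for x
  proof
    assume "rpoly t x = x"
    then have "rpoly [:1, 1, 1:] x = 0" using step[OF x] by (simp add: algebra_simps eq_neg_iff_add_eq_0)
    then have "?h dvd [:1, 1, 1:]" by (rule rpoly_irreducible_dvd[OF irr x])
    then have "degree ?h \<le> degree [:1, 1, 1 :: rat:]" by (rule dvd_imp_degree_le) simp
    then show False by (simp add: degree_shanks_poly)
  qed
  define x1 x2 where "x1 = rpoly t \<rho>" and "x2 = rpoly t x1"
  have r: "rpoly ?h \<rho> = 0" "rpoly ?h x1 = 0" "rpoly ?h x2 = 0"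
    using \<rho> root by (simp_all add: x1_def x2_def)
  have e1: "(1 + \<rho>) * x1 = - 1" and e2: "(1 + x1) * x2 = - 1"
    using step[OF r(1)] step[OF r(2)] by (simp_all only: x1_def x2_def)
  have "(1 + \<rho>) * (1 + x1) = \<rho>" unfolding distrib_left[of "1 + \<rho>"] e1 by simp
  then have "\<rho> * x2 = (1 + \<rho>) * ((1 + x1) * x2)" by (simp only: mult.assoc[symmetric])
  then have "\<rho> * (1 + x2) = - 1" unfolding e2 by (simp add: distrib_left)
  moreover have "(1 + x2) * rpoly t x2 = - 1" by (rule step[OF r(3)])
  ultimately have t2: "rpoly t x2 = \<rho>"
    by (metis mult.commute mult_cancel_left mult_zero_left neg_equal_0_iff_equal zero_neq_one)
  have dist: "\<rho> \<noteq> x1" "x1 \<noteq> x2" "x2 \<noteq> \<rho>"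
    using moved[OF r(1)] moved[OF r(2)] moved[OF r(3)] t2 by (auto simp: x1_def x2_def)
  show ?thesis
    unfolding cyclic_cubic_poly_def x1_def[symmetric] x2_def[symmetric]
    using irr degree_shanks_poly[of n] rpoly_cubic_roots[OF degree_shanks_poly r dist] dist t2
    by (simp add: x1_def x2_def)
qed

lemma moebius_prod_primes:
  assumes "finite S" "\<And>p. p \<in> S \<Longrightarrow> prime p"
  shows "squarefree (\<Prod>S)" "moebius_mu (\<Prod>S) = (- 1) ^ card S"
proof -
  show sq: "squarefree (\<Prod>S)"
  proof (rule squarefree_prod_coprime)
    show "coprime a b" if "a \<in> S" "b \<in> S" "a \<noteq> b" for a b
      by (rule primes_coprime) (use assms(2) that in auto)
    show "squarefree a" if "a \<in> S" for a by (rule squarefree_prime) (use assms(2) that in auto)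
  qed
  have "prime_factors (\<Prod>S) = (\<Union>p\<in>S. prime_factors p)"
  proof -
    have "0 \<notin> (\<lambda>x. x) ` S" using assms(2)[of 0] by auto
    then show ?thesis using prime_factors_prod[OF assms(1), of "\<lambda>x. x"] by (simp add: comp_def)
  qed
  also have "\<dots> = (\<Union>p\<in>S. {p})" by (rule SUP_cong) (simp_all add: assms(2) prime_prime_factors)
  also have "\<dots> = S" by simp
  finally show "moebius_mu (\<Prod>S) = (- 1) ^ card S" using sq by (simp add: moebius_mu_def)
qed

text \<open>An admissible pair coupled with a character whose Jacobi sum has trace \<open>M\<close>
  up to the Moebius sign. It arises from a pair by \<open>primitive_char_of_admissible\<close> and
  from a field by \<open>admissible_of_primitive_char\<close>.\<close>

locale admissible_setup =
  fixes S :: "nat set" and f :: nat and M0 N :: int and \<chi> :: "int \<Rightarrow> complex"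
  assumes S: "finite S" "\<And>p. p \<in> S \<Longrightarrow> prime p \<and> [p = 1] (mod 3)" and f: "f = 9 * \<Prod>S"
    and adm: "admissible_pair f (3 * M0) N"
    and \<chi>: "primitive_char f \<chi>"
    and trace: "(- 1) ^ card S * (jacobi_sum f \<chi> + cnj (jacobi_sum f \<chi>)) = of_int (3 * M0)"
begin

definition n1 :: rat where "n1 = (of_int (3 * M0) - 3 * of_int N) / 2"
definition n :: rat where "n = n1 / of_int N"
definition m :: int where "m = int (\<Prod>S)"
definition \<mu> :: int where "\<mu> = (- 1) ^ card S"
definition \<eta> :: complex where "\<eta> = cubic_period f \<chi> 1"
definition T :: "complex \<Rightarrow> complex" where "T x = of_int \<mu> * (of_int N * x - of_rat n1 / 3)"

lemma N0: "N > 0" and N3: "\<not> [N = 0] (mod 3)" and m4: "4 * m = M0\<^sup>2 + 3 * N\<^sup>2"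
  and f_pos: "f > 0" and nine_dvd: "9 dvd f" and m3: "[m = 1] (mod 3)"
proof -
  show "N > 0" "\<not> [N = 0] (mod 3)" using adm by (auto simp: admissible_pair_def)
  have "4 * int f = (3 * M0)\<^sup>2 + 27 * N\<^sup>2" using adm by (auto simp: admissible_pair_def)
  then have "9 * (4 * m) = 9 * (M0\<^sup>2 + 3 * N\<^sup>2)" unfolding f m_def by (simp add: power_mult_distrib algebra_simps)
  then show "4 * m = M0\<^sup>2 + 3 * N\<^sup>2" by (simp only: mult_cancel_left) simp
  show "f > 0" "9 dvd f" using coprime_9_prod(3)[OF S] by (simp_all add: f)
  have "[int (\<Prod>S) = int 1] (mod int 3)" using coprime_9_prod(2)[OF S] by (simp only: cong_int_iff)
  then show "[m = 1] (mod 3)" by (simp add: m_def)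
qed

lemma mu_square: "\<mu> * \<mu> = 1"
  by (simp add: \<mu>_def flip: power_add)

text \<open>\<open>M0\<close> and \<open>N\<close> have equal parity, which makes \<open>n1\<close>
  integral. A common prime of \<open>a\<close> and \<open>N\<close> is not 3, and its square divides
  \<open>f\<close>, hence the squarefree number \<open>m\<close>.\<close>

lemma n1_int:
  obtains a where "n1 = of_int a" "coprime a N" "a\<^sup>2 + 3 * a * N + 9 * N\<^sup>2 = int f"
proof -
  have "even (M0\<^sup>2 + 3 * N\<^sup>2)" unfolding m4[symmetric] by simp
  then have "even (3 * M0 - 3 * N)" by simp
  then obtain a where a: "3 * M0 - 3 * N = 2 * a" by blast
  have "of_int (3 * M0) - 3 * of_int N = (of_int (3 * M0 - 3 * N) :: rat)" by simp
  then have a': "n1 = of_int a" unfolding n1_def a by simp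
  have "4 * (a\<^sup>2 + 3 * a * N + 9 * N\<^sup>2) = (2 * a)\<^sup>2 + 6 * (2 * a) * N + 36 * N\<^sup>2"
    by (simp add: power2_eq_square algebra_simps)
  also have "\<dots> = 9 * (M0\<^sup>2 + 3 * N\<^sup>2)" unfolding a[symmetric] by (simp add: power2_eq_square algebra_simps)
  also have "\<dots> = 4 * int f" unfolding m4[symmetric] by (simp add: f m_def)
  finally have norm: "a\<^sup>2 + 3 * a * N + 9 * N\<^sup>2 = int f" by simp
  have "coprime a N"
  proof (rule ccontr)
    assume "\<not> coprime a N"
    then have "gcd a N \<noteq> 1" by (simp add: coprime_iff_gcd_eq_1)
    moreover have "gcd a N \<noteq> 0" using N0 by simp
    ultimately obtain q where q: "prime q" "q dvd a" "q dvd N"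
      using prime_divisor_exists[of "gcd a N"] by auto
    obtain u v where uv: "a = q * u" "N = q * v" using q(2,3) by (elim dvdE)
    have "q * q * (u\<^sup>2 + 3 * u * v + 9 * v\<^sup>2) = int f"
      unfolding norm[symmetric] uv by (simp add: power2_eq_square algebra_simps)
    then have "q * q dvd int f" by (metis dvd_triv_left)
    then have qq: "q\<^sup>2 dvd 9 * m" by (simp add: f m_def power2_eq_square)
    have "q \<noteq> 3" using N3 q(3) by (auto simp: cong_0_iff)
    then have "coprime q 3" using q(1) by (simp add: primes_coprime)
    then have "coprime (q\<^sup>2) (3\<^sup>2)"
      by (simp only: coprime_power_left_iff coprime_power_right_iff simp_thms)
    then have qm: "q\<^sup>2 dvd m" using qq coprime_dvd_mult_right_iff[of "q\<^sup>2" 9 m] by simp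
    define r where "r = nat q"
    then have r: "q = int r" "prime r" using q(1) prime_ge_0_int[OF q(1)] by auto
    have "int (r\<^sup>2) dvd int (\<Prod>S)" using qm unfolding m_def r(1) by (simp only: of_nat_power)
    then have "r\<^sup>2 dvd \<Prod>S" by (simp only: int_dvd_int_iff)
    then have "r dvd 1" using moebius_prod_primes(1)[OF S(1)] S(2) by (auto simp: squarefree_def)
    then show False using r(2) by simp
  qed
  then show ?thesis using that a a' norm by blast
qed

text \<open>Completing the cube: \<open>of_int N * x - of_rat n1 / 3\<close> is \<open>N\<close>
  times \<open>x - n / 3\<close>. The resulting depressed cubic is the one satisfied by
  \<open>\<mu> * \<eta>\<close>.\<close>

lemma poly_identity:
  "of_int N ^ 3 * rpoly (shanks_poly n) x =
     (of_int N * x - of_rat n1 / 3) ^ 3 - 3 * of_int m * (of_int N * x - of_rat n1 / 3) - of_int m * of_int M0"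
proof -
  define A B C :: complex where "A = of_rat n1" and "B = of_int N" and "C = of_int M0"
  have B: "B \<noteq> 0" using N0 by (simp add: B_def)
  have "A = (3 * C - 3 * B) / 2"
    unfolding A_def n1_def by (simp add: of_rat_divide of_rat_diff of_rat_mult B_def C_def)
  then have A: "A = 3 * ((C - B) / 2)" by (simp add: algebra_simps)
  define D where "D = (C - B) / 2"
  have C: "C = 2 * D + B" by (simp add: D_def)
  have AD: "A = 3 * D" using A by (simp add: D_def)
  have "4 * of_int m = C\<^sup>2 + 3 * B\<^sup>2"
    unfolding B_def C_def by (metis m4 of_int_add of_int_mult of_int_numeral of_int_power)
  also have "\<dots> = 4 * (D\<^sup>2 + D * B + B\<^sup>2)" unfolding C by (simp add: power2_eq_square algebra_simps)
  finally have m: "of_int m = D\<^sup>2 + D * B + B\<^sup>2" by (simp only: mult_cancel_left) simp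
  have n: "of_rat n * B = 3 * D" using B AD by (simp add: n_def of_rat_divide A_def B_def)
  have "B ^ 3 * rpoly (shanks_poly n) x
    = B ^ 3 * x ^ 3 - (of_rat n * B) * B\<^sup>2 * x\<^sup>2 - ((of_rat n * B) * B\<^sup>2 + 3 * B ^ 3) * x - B ^ 3"
    unfolding rpoly_shanks_poly by (simp add: power2_eq_square power3_eq_cube algebra_simps)
  also have "\<dots> = (B * x - D) ^ 3 - 3 * of_int m * (B * x - D) - of_int m * C"
    unfolding n m C by (simp add: power2_eq_square power3_eq_cube algebra_simps)
  finally show ?thesis using AD by (simp add: A_def B_def C_def)
qed

text \<open>With \<open>m = 1 + 3 * k\<close>, modulo 9 the square of \<open>M0\<close> is
  \<open>1 + 3 * k\<close> and that of \<open>m\<close> is \<open>1 + 6 * k\<close>, so the terms in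
  \<open>k\<close> cancel. The two forms serve \<open>\<eta>\<close> and the Shanks polynomial in
  \<open>cubic_no_rat_root\<close>.\<close>

lemma const_square: "[(\<mu> * m * M0)\<^sup>2 = 1] (mod 9)" "[(m * M0)\<^sup>2 = 1] (mod 9)"
proof -
  obtain k where k: "m = 1 + 3 * k" using m3 by (metis cong_iff_lin cong_sym mult.commute)
  have "N mod 3 = 1 \<or> N mod 3 = 2" using N3 by (auto simp: cong_def)
  then have "[N\<^sup>2 = 1] (mod 3)" by (auto simp: cong_def power_mod[of N 3 2, symmetric])
  then obtain j where j: "N\<^sup>2 = 1 + 3 * j" by (metis cong_iff_lin cong_sym mult.commute)
  have M0: "M0\<^sup>2 = 1 + 12 * k - 9 * j" using m4 by (simp add: k j)
  have "(m * M0)\<^sup>2 - 1 = 9 * (2 * k - j + 9 * k * k - 6 * k * j + k * k * (12 * k - 9 * j))"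
    unfolding power_mult_distrib M0 k by (simp add: power2_eq_square algebra_simps)
  then show *: "[(m * M0)\<^sup>2 = 1] (mod 9)" by (simp only: cong_iff_dvd_diff dvd_triv_left)
  have "(\<mu> * m * M0)\<^sup>2 = (\<mu> * \<mu>) * (m * M0)\<^sup>2" by (simp add: power2_eq_square mult_ac)
  then show "[(\<mu> * m * M0)\<^sup>2 = 1] (mod 9)" using * mu_square by simp
qed

lemma irreducible_shanks: "irreducible (shanks_poly n)"
proof (rule irreducible_cubicI[OF degree_shanks_poly])
  fix r
  show "poly (shanks_poly n) r \<noteq> 0"
  proof
    assume "poly (shanks_poly n) r = 0"
    then have "rpoly (shanks_poly n) (of_rat r) = 0" by (simp add: rpoly_of_rat)
    moreover define y where "y = of_int N * r - n1 / 3"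
    have "of_int N * of_rat r - of_rat n1 / 3 = (of_rat y :: complex)"
      by (simp add: y_def of_rat_diff of_rat_mult of_rat_divide)
    ultimately have "of_rat (y ^ 3) = (of_rat (3 * of_int m * y + of_int (m * M0)) :: complex)"
      using poly_identity[of "of_rat r"] by (simp add: of_rat_power of_rat_add of_rat_mult algebra_simps)
    then have "y ^ 3 = 3 * of_int m * y + of_int (m * M0)" by (simp only: of_rat_eq_iff)
    then show False by (rule cubic_no_rat_root[OF m3 const_square(2)])
  qed
qed

lemma eta_cubic: "\<eta> ^ 3 = 3 * of_int m * \<eta> + of_int (\<mu> * m * M0)"
proof -
  have fm: "of_nat f = (9 * of_int m :: complex)" by (simp add: f m_def)
  have "of_int \<mu> * (jacobi_sum f \<chi> + cnj (jacobi_sum f \<chi>)) = 3 * of_int M0"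
    using trace by (simp add: \<mu>_def)
  then have "of_int (\<mu> * \<mu>) * (jacobi_sum f \<chi> + cnj (jacobi_sum f \<chi>)) = of_int \<mu> * (3 * of_int M0)"
    by (simp add: mult.assoc)
  then have J: "jacobi_sum f \<chi> + cnj (jacobi_sum f \<chi>) = 3 * of_int (\<mu> * M0)"
    unfolding mu_square by simp
  have "27 * \<eta> ^ 3 = of_nat f * (jacobi_sum f \<chi> + cnj (jacobi_sum f \<chi>)) + 9 * of_nat f * \<eta>"
    unfolding \<eta>_def by (rule cubic_period_poly[OF f_pos nine_dvd \<chi>]) simp
  also have "\<dots> = 27 * (3 * of_int m * \<eta> + of_int (\<mu> * m * M0))"
    unfolding J fm by (simp add: algebra_simps)
  finally show ?thesis by (simp only: mult_cancel_left) simp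
qed

lemma eta_irrational: "\<eta> \<notin> \<rat>"
proof
  assume "\<eta> \<in> \<rat>"
  then obtain y where y: "\<eta> = of_rat y" by (rule Rats_cases)
  have "of_rat (y ^ 3) = (of_rat (3 * of_int m * y + of_int (\<mu> * m * M0)) :: complex)"
    using eta_cubic unfolding y by (simp add: of_rat_power of_rat_add of_rat_mult)
  then have "y ^ 3 = 3 * of_int m * y + of_int (\<mu> * m * M0)" by (simp only: of_rat_eq_iff)
  then show False by (rule cubic_no_rat_root[OF m3 const_square(1)])
qed

lemma eta_moved: "coprime a (int f) \<Longrightarrow> \<chi> a \<noteq> 1 \<Longrightarrow> conj_map f a \<eta> \<noteq> \<eta>"
  unfolding \<eta>_def by (rule cubic_period_moved[OF f_pos nine_dvd \<chi> eta_irrational[unfolded \<eta>_def]])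

lemma eta_fixed: "coprime a (int f) \<Longrightarrow> conj_map f a \<eta> = \<eta> \<longleftrightarrow> \<chi> a = 1"
proof -
  assume a: "coprime a (int f)"
  have "conj_map f a \<eta> = \<eta>" if "\<chi> a = 1"
    using cubic_period_conj[OF f_pos primitive_cubic[OF \<chi>] a, of 1] that by (simp add: \<eta>_def)
  then show ?thesis using eta_moved[OF a] by blast
qed

lemma eta_qadj: "\<eta> \<in> qadj (zeta f)"
  unfolding \<eta>_def by (rule cubic_period_qadj[OF f_pos])

text \<open>\<open>T\<close> is an invertible affine map with rational coefficients, so a root is
  found by solving for it and generates the same field as \<open>\<eta>\<close>.\<close>

lemma eta_root: obtains \<rho> where "rpoly (shanks_poly n) \<rho> = 0" "\<eta> = T \<rho>" "qadj \<eta> = qadj \<rho>"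
proof -
  define \<rho> where "\<rho> = (of_int \<mu> * \<eta> + of_rat n1 / 3) / of_int N"
  have N: "of_int N \<noteq> (0 :: complex)" using N0 by simp
  have mm: "of_int \<mu> * (of_int \<mu> * z) = (z :: complex)" for z
    using arg_cong[OF mu_square, of "of_int :: int \<Rightarrow> complex"] by (simp add: mult.assoc[symmetric])
  have Y: "of_int N * \<rho> - of_rat n1 / 3 = of_int \<mu> * \<eta>" using N by (simp add: \<rho>_def)
  have "(of_int \<mu> * \<eta>) ^ 3 = of_int \<mu> * (of_int \<mu> * (of_int \<mu> * \<eta> ^ 3))"
    by (simp add: power3_eq_cube)
  also have "\<dots> = of_int \<mu> * \<eta> ^ 3" by (simp only: mm)
  also have "\<dots> = of_int \<mu> * (3 * of_int m * \<eta>) + of_int \<mu> * (of_int \<mu> * (of_int m * of_int M0))"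
    unfolding eta_cubic by (simp only: distrib_left of_int_mult mult.assoc)
  also have "\<dots> = 3 * of_int m * (of_int \<mu> * \<eta>) + of_int m * of_int M0" unfolding mm by simp
  finally have "of_int N ^ 3 * rpoly (shanks_poly n) \<rho> = 0"
    unfolding poly_identity Y by simp
  then have r: "rpoly (shanks_poly n) \<rho> = 0" using N by simp
  have T: "\<eta> = T \<rho>" unfolding T_def Y mm ..
  have "\<eta> = rpoly [:- of_int \<mu> * n1 / 3, of_int \<mu> * of_int N:] \<rho>"
    unfolding T T_def by (simp add: of_rat_mult of_rat_minus of_rat_divide algebra_simps)
  then have 1: "\<eta> \<in> qadj \<rho>" by (metis qadjI)
  have "\<rho> = rpoly [:n1 / 3 / of_int N, of_int \<mu> / of_int N:] \<eta>"
    unfolding \<rho>_def by (simp add: of_rat_divide of_rat_mult add_divide_distrib)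
  then have "\<rho> \<in> qadj \<eta>" by (metis qadjI)
  then show ?thesis using that r T 1 by (meson qadj_subset subset_antisym)
qed

context
  fixes \<rho> :: complex
  assumes \<rho>: "rpoly (shanks_poly n) \<rho> = 0"
begin

interpretation C: cyclic_cubic_poly "shanks_poly n" "[:- 2, - (n + 1), 1:]" \<rho>
  "rpoly [:- 2, - (n + 1), 1:] \<rho>" "rpoly [:- 2, - (n + 1), 1:] (rpoly [:- 2, - (n + 1), 1:] \<rho>)"
  by (rule shanks_cyclic_cubic_poly[OF irreducible_shanks \<rho>])

lemma rat_adjoin_eta: "rat_adjoin \<rho> = qadj \<rho>" "qadj \<rho> = qadj \<eta>"
proof -
  show "rat_adjoin \<rho> = qadj \<rho>" by (rule C.rat_adjoin_root[OF \<rho>])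
  show "qadj \<rho> = qadj \<eta>" using eta_root C.qadj_root by metis
qed

lemma cyclic_cubic_rat_adjoin: "cyclic_cubic_field (rat_adjoin \<rho>)"
  unfolding rat_adjoin_eta(1) by (rule C.cyclic_cubic)

lemma conductor_rat_adjoin: "is_conductor (rat_adjoin \<rho>) f"
  unfolding is_conductor_def rat_adjoin_eta
proof (intro conjI allI impI f_pos)
  show "qadj \<eta> \<subseteq> rat_adjoin (zeta f)"
    unfolding rat_adjoin_zeta[OF f_pos] by (rule qadj_subset[OF eta_qadj])
  fix k :: nat assume k: "k > 0" "qadj \<eta> \<subseteq> rat_adjoin (zeta k)"
  then have "\<eta> \<in> qadj (zeta k)" using rat_adjoin_zeta[OF k(1)] qadj_self by blast
  then have "f dvd k" using primitive_conductor[OF f_pos \<chi> eta_qadj _ k(1)] eta_moved by blast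
  then show "f \<le> k" using k(1) dvd_imp_le by blast
qed

lemma gaussian_period_rat_adjoin: "gaussian_period f (rat_adjoin \<rho>) = \<eta>"
  unfolding rat_adjoin_eta
  using gaussian_period_eq[OF f_pos primitive_cubic[OF \<chi>] eta_qadj eta_fixed] by (simp add: \<eta>_def)

text \<open>The period is \<open>T z\<close> for some root \<open>z\<close>, not necessarily the
  given \<open>\<rho>\<close>, and \<open>\<sigma>\<close> may run through the roots in either
  direction. Only the set of roots and the product of linear factors matter, and both are
  insensitive to these choices.\<close>

lemma gaussian_periods_conj:
  assumes \<sigma>: "\<sigma> \<in> carrier (galois_group (rat_adjoin \<rho>) \<rat>)"
    and gen: "generate (galois_group (rat_adjoin \<rho>) \<rat>) {\<sigma>} = carrier (galois_group (rat_adjoin \<rho>) \<rat>)"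
  defines "y0 \<equiv> gaussian_period f (rat_adjoin \<rho>)"
  shows "{y0, \<sigma> y0, \<sigma> (\<sigma> y0)} = {T \<rho>, T (\<sigma> \<rho>), T (\<sigma> (\<sigma> \<rho>))}"
    and "smult (of_int N ^ 3 * of_int \<mu>) (map_poly of_rat (shanks_poly n)) =
      pcompose ([:- y0, 1:] * [:- \<sigma> y0, 1:] * [:- \<sigma> (\<sigma> y0), 1:])
        (smult (of_int \<mu>) [:- of_rat n1 / 3, of_int N:])"
proof -
  note \<sigma>' = \<sigma>[unfolded rat_adjoin_eta(1)] and gen' = gen[unfolded rat_adjoin_eta(1)]
  define x1 x2 where "x1 = rpoly [:- 2, - (n + 1), 1:] \<rho>" and "x2 = rpoly [:- 2, - (n + 1), 1:] x1"
  note orbit = C.galois_generator_orbit[OF \<sigma>' gen', folded x1_def, folded x2_def]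
  note roots = C.roots[folded x1_def, folded x2_def] and dist = C.distinct[folded x1_def, folded x2_def]
  have K: "\<rho> \<in> qadj \<rho>" "x1 \<in> qadj \<rho>" "x2 \<in> qadj \<rho>"
    by (simp_all add: x1_def x2_def qadj_rpoly del: rpoly_pCons)
  have T: "T x = rpoly [:- of_int \<mu> * n1 / 3, of_int \<mu> * of_int N:] x" for x
    unfolding T_def by (simp add: of_rat_mult of_rat_minus of_rat_divide algebra_simps)
  have \<sigma>T: "\<sigma> (T x) = T (\<sigma> x)" if "x \<in> qadj \<rho>" for x
    unfolding T by (rule galois_group_rpoly[OF C.subfield_L qadj_Rats refl \<sigma>' that])
  obtain z where z: "rpoly (shanks_poly n) z = 0" "\<eta> = T z" using eta_root by blast
  have y0: "y0 = T z" using z gaussian_period_rat_adjoin by (simp add: y0_def)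
  have zx: "z = \<rho> \<or> z = x1 \<or> z = x2" using z(1) roots by blast
  then have zK: "z \<in> qadj \<rho>" "\<sigma> z \<in> qadj \<rho>" using K orbit by auto
  have y1: "\<sigma> y0 = T (\<sigma> z)" "\<sigma> (\<sigma> y0) = T (\<sigma> (\<sigma> z))" using \<sigma>T zK by (simp_all add: y0)
  have sets: "{z, \<sigma> z, \<sigma> (\<sigma> z)} = {\<rho>, x1, x2}" "{\<rho>, \<sigma> \<rho>, \<sigma> (\<sigma> \<rho>)} = {\<rho>, x1, x2}"
    using zx orbit by auto
  have "T ` {z, \<sigma> z, \<sigma> (\<sigma> z)} = T ` {\<rho>, \<sigma> \<rho>, \<sigma> (\<sigma> \<rho>)}" unfolding sets ..
  then show "{y0, \<sigma> y0, \<sigma> (\<sigma> y0)} = {T \<rho>, T (\<sigma> \<rho>), T (\<sigma> (\<sigma> \<rho>))}" unfolding y1(2) unfolding y1(1) unfolding y0 by simp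
  let ?h = "map_poly of_rat (shanks_poly n) :: complex poly"
  let ?q = "[:- \<rho>, 1:] * [:- x1, 1:] * [:- x2, 1:]"
  have hq: "?h = ?q"
  proof (rule poly_eqI_degree_lead_coeff[where n = 3 and A = "{\<rho>, x1, x2}"])
    show "degree ?h \<le> 3" by (simp add: shanks_poly_def map_poly_pCons)
    show "degree ?q \<le> 3" by simp
    show "coeff ?h 3 = coeff ?q 3"
      by (simp add: shanks_poly_def map_poly_pCons numeral_3_eq_3)
    show "card {\<rho>, x1, x2} \<ge> 3" using dist by auto
    show "poly ?h x = poly ?q x" if x: "x \<in> {\<rho>, x1, x2}" for x
    proof -
      have "poly ?h x = 0" using roots[of x] x unfolding rpoly_def by blast
      moreover have "poly ?q x = (x - \<rho>) * (x - x1) * (x - x2)" by (simp add: algebra_simps)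
      ultimately show ?thesis using x by auto
    qed
  qed
  have prod: "(x - z) * (x - \<sigma> z) * (x - \<sigma> (\<sigma> z)) = (x - \<rho>) * (x - x1) * (x - x2)" for x
    using zx orbit by auto
  have mm: "of_int \<mu> * (of_int \<mu> * w) = (w :: complex)" for w
    using arg_cong[OF mu_square, of "of_int :: int \<Rightarrow> complex"] by (simp add: mult.assoc[symmetric])
  show "smult (of_int N ^ 3 * of_int \<mu>) ?h =
      pcompose ([:- y0, 1:] * [:- \<sigma> y0, 1:] * [:- \<sigma> (\<sigma> y0), 1:])
        (smult (of_int \<mu>) [:- of_rat n1 / 3, of_int N:])"
  proof (rule poly_eq_poly_eq_iff[THEN iffD1], rule ext)
    fix x
    let ?u = "of_int \<mu> :: complex" and ?N = "of_int N :: complex"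
    have lin: "?u * (?N * x - of_rat n1 / 3) - T w = ?u * ?N * (x - w)" for w
      by (simp add: T_def algebra_simps)
    have "poly (pcompose ([:- y0, 1:] * [:- \<sigma> y0, 1:] * [:- \<sigma> (\<sigma> y0), 1:])
        (smult ?u [:- of_rat n1 / 3, ?N:])) x
      = (?u * (?N * x - of_rat n1 / 3) - T z) * (?u * (?N * x - of_rat n1 / 3) - T (\<sigma> z))
        * (?u * (?N * x - of_rat n1 / 3) - T (\<sigma> (\<sigma> z)))"
    proof -
      have "poly (pcompose [:- c, 1:] (smult ?u [:- of_rat n1 / 3, ?N:])) x
        = ?u * (?N * x - of_rat n1 / 3) - c" for c
        by (simp add: poly_pcompose algebra_simps)
      then show ?thesis unfolding pcompose_mult poly_mult y1(2) unfolding y1(1) unfolding y0 by simp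
    qed
    \<comment> \<open>Each linear factor contributes \<open>\<mu> * N\<close>; two of the three
      signs cancel.\<close>
    also have "\<dots> = ?u * (?u * (?u * (?N ^ 3 * ((x - z) * (x - \<sigma> z) * (x - \<sigma> (\<sigma> z))))))"
      unfolding lin by (simp add: power3_eq_cube)
    also have "\<dots> = poly (smult (?N ^ 3 * ?u) ?h) x"
      unfolding mm prod hq by (simp add: algebra_simps)
    finally show "poly (smult (?N ^ 3 * ?u) ?h) x
      = poly (pcompose ([:- y0, 1:] * [:- \<sigma> y0, 1:] * [:- \<sigma> (\<sigma> y0), 1:])
        (smult ?u [:- of_rat n1 / 3, ?N:])) x" by (rule sym)
  qed
qed

end

end


theorem theorem1p2:
  fixes \<nu> f :: nat and p :: "nat \<Rightarrow> nat"
  assumes "\<And>i. i \<in> {1..\<nu>} \<Longrightarrow> prime (p i) \<and> [p i = 1] (mod 3)"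
    and "inj_on p {1..\<nu>}"
    and "f = 3\<^sup>2 * (\<Prod>i=1..\<nu>. p i)"
  shows
    "(\<forall>M N. admissible_pair f M N \<longrightarrow>
       (let n1 = (of_int M - 3 * of_int N) / 2 :: rat;
            n2 = of_int N :: rat;
            n = n1 / n2;
            \<mu> = of_int (moebius_mu (f div 9)) :: complex
        in
          (\<exists>a b :: int. n1 = of_int a \<and> n2 = of_int b \<and> coprime a b) \<and>
          n1\<^sup>2 + 3 * n1 * n2 + 9 * n2\<^sup>2 = of_nat f \<and>
          irreducible (shanks_poly n) \<and>
          (\<forall>\<rho>. poly (map_poly of_rat (shanks_poly n)) \<rho> = 0 \<longrightarrow>
             cyclic_cubic_field (rat_adjoin \<rho>) \<and>
             is_conductor (rat_adjoin \<rho>) f \<and>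
             (\<forall>\<sigma> \<in> carrier (galois_group (rat_adjoin \<rho>) \<rat>).
                generate (galois_group (rat_adjoin \<rho>) \<rat>) {\<sigma>} =
                  carrier (galois_group (rat_adjoin \<rho>) \<rat>) \<longrightarrow>
                (let \<eta>0 = gaussian_period f (rat_adjoin \<rho>);
                     \<eta>1 = \<sigma> \<eta>0;
                     \<eta>2 = \<sigma> (\<sigma> \<eta>0);
                     P = [:- \<eta>0, 1:] * [:- \<eta>1, 1:] * [:- \<eta>2, 1:];
                     T = (\<lambda>x. \<mu> * (of_rat n2 * x - of_rat n1 / 3))
                 in
                   smult ((of_rat n2) ^ 3 * \<mu>) (map_poly of_rat (shanks_poly n)) =
                     pcompose P (smult \<mu> [:- of_rat n1 / 3, of_rat n2:]) \<and>
                   {\<eta>0, \<eta>1, \<eta>2} = {T \<rho>, T (\<sigma> \<rho>), T (\<sigma> (\<sigma> \<rho>))}))))) \<and>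
     (\<forall>L. cyclic_cubic_field L \<and> is_conductor L f \<longrightarrow>
       (\<exists>M N. admissible_pair f M N \<and>
         (let n1 = (of_int M - 3 * of_int N) / 2 :: rat;
              n2 = of_int N :: rat;
              n = n1 / n2
          in \<forall>\<rho>. poly (map_poly of_rat (shanks_poly n)) \<rho> = 0 \<longrightarrow> L = rat_adjoin \<rho>)))"
proof -
  define S where "S = p ` {1..\<nu>}"
  have S: "finite S" "\<And>q. q \<in> S \<Longrightarrow> prime q \<and> [q = 1] (mod 3)" using assms(1) by (auto simp: S_def)
  have f: "f = 9 * \<Prod>S" using assms(3) prod.reindex[OF assms(2), of "\<lambda>x. x"] by (simp add: S_def)
  have mu: "moebius_mu (f div 9) = (- 1) ^ card S"
    using moebius_prod_primes(2)[OF S(1)] S(2) by (simp add: f)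
  show ?thesis
  proof (intro conjI allI impI, goal_cases)
    case (1 M N)
    note adm = 1
    obtain M0 where M: "M = 3 * M0" using adm by (auto simp: admissible_pair_def)
    obtain \<chi> where "primitive_char f \<chi>"
      "(- 1) ^ card S * (jacobi_sum f \<chi> + cnj (jacobi_sum f \<chi>)) = of_int M"
      using primitive_char_of_admissible[OF S, of M N] adm unfolding f by blast
    then interpret A: admissible_setup S f M0 N \<chi>
      using S f adm unfolding M by unfold_locales auto
    obtain a where a: "A.n1 = of_int a" "coprime a N" "a\<^sup>2 + 3 * a * N + 9 * N\<^sup>2 = int f"
      using A.n1_int by metis
    have n1: "(of_int M - 3 * of_int N) / 2 = A.n1" by (simp add: A.n1_def M)
    have n: "A.n1 / of_int N = A.n" by (simp add: A.n_def)
    have norm: "A.n1\<^sup>2 + 3 * A.n1 * of_int N + 9 * (of_int N)\<^sup>2 = of_nat f"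
      unfolding a(1) using arg_cong[OF a(3), of "of_int :: int \<Rightarrow> rat"] by simp
    have \<mu>: "of_int (moebius_mu (f div 9)) = (of_int A.\<mu> :: complex)" by (simp add: mu A.\<mu>_def)
    show ?case
      unfolding Let_def n1 n \<mu> rpoly_def[symmetric] of_rat_of_int_eq A.T_def[symmetric]
    proof (intro conjI allI impI ballI norm A.irreducible_shanks)
      show "\<exists>a b :: int. A.n1 = of_int a \<and> of_int N = (of_int b :: rat) \<and> coprime a b" using a by blast
    next
      fix \<rho> assume \<rho>: "rpoly (shanks_poly A.n) \<rho> = 0"
      show "cyclic_cubic_field (rat_adjoin \<rho>)" by (rule A.cyclic_cubic_rat_adjoin[OF \<rho>])
      show "is_conductor (rat_adjoin \<rho>) f" by (rule A.conductor_rat_adjoin[OF \<rho>])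
      fix \<sigma> assume "\<sigma> \<in> carrier (galois_group (rat_adjoin \<rho>) \<rat>)"
        "generate (galois_group (rat_adjoin \<rho>) \<rat>) {\<sigma>} = carrier (galois_group (rat_adjoin \<rho>) \<rat>)"
      note * = A.gaussian_periods_conj[OF \<rho> this]
      show "smult (of_int N ^ 3 * of_int A.\<mu>) (map_poly of_rat (shanks_poly A.n)) =
          pcompose ([:- gaussian_period f (rat_adjoin \<rho>), 1:] * [:- \<sigma> (gaussian_period f (rat_adjoin \<rho>)), 1:]
            * [:- \<sigma> (\<sigma> (gaussian_period f (rat_adjoin \<rho>))), 1:])
          (smult (of_int A.\<mu>) [:- of_rat A.n1 / 3, of_int N:])" by (rule *(2))
      show "{gaussian_period f (rat_adjoin \<rho>), \<sigma> (gaussian_period f (rat_adjoin \<rho>)),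
          \<sigma> (\<sigma> (gaussian_period f (rat_adjoin \<rho>)))} = {A.T \<rho>, A.T (\<sigma> \<rho>), A.T (\<sigma> (\<sigma> \<rho>))}"
        by (rule *(1))
    qed
  next
    case (2 L)
    note L = 2
    obtain h t x0 x1 x2 where "cyclic_cubic_poly h t x0 x1 x2" and Lx: "L = qadj x0"
      using cyclic_cubic_field_generator L by blast
    then interpret C: cyclic_cubic_poly h t x0 x1 x2 by blast
    have f0: "f > 0" and sub: "L \<subseteq> qadj (zeta f)"
      using L rat_adjoin_zeta[of f] by (auto simp: is_conductor_def)
    have x0: "x0 \<in> qadj (zeta f)" using sub qadj_self[of x0] unfolding Lx by blast
    \<comment> \<open>The pair is read off from the character through which the cyclotomic
      conjugations act on \<open>L\<close>.\<close>
    define \<chi> where "\<chi> = C.cubic_index_char f"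
    have \<chi>: "primitive_char f \<chi>"
      unfolding \<chi>_def
    proof (rule C.primitive_cubic_index_char[OF f0 x0])
      fix k :: nat assume k: "k > 0" "x0 \<in> qadj (zeta k)"
      then have "L \<subseteq> rat_adjoin (zeta k)" unfolding Lx rat_adjoin_zeta[OF k(1)] by (intro qadj_subset)
      then show "f \<le> k" using L k(1) by (auto simp: is_conductor_def)
    qed
    obtain M N where adm: "admissible_pair f M N"
      and tr: "(- 1) ^ card S * (jacobi_sum f \<chi> + cnj (jacobi_sum f \<chi>)) = of_int M"
      using admissible_of_primitive_char[OF S, of \<chi>] \<chi> unfolding f by blast
    obtain M0 where M: "M = 3 * M0" using adm by (auto simp: admissible_pair_def)
    interpret A: admissible_setup S f M0 N \<chi>
      using S f adm \<chi> tr unfolding M by unfold_locales auto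
    note cub = primitive_cubic[OF \<chi>]
    have fixed_x0: "fixed_by_ker f \<chi> x0"
      using x0 C.cubic_index_char(2)[OF f0 x0] unfolding fixed_by_ker_def \<chi>_def by blast
    have fixed_eta: "fixed_by_ker f \<chi> A.\<eta>"
      using A.eta_qadj A.eta_fixed by (simp add: fixed_by_ker_def)
    \<comment> \<open>Primitivity at the prime divisor 3 of \<open>f\<close> supplies a unit outside
      the kernel.\<close>
    obtain a where a: "coprime a (int f)" "\<chi> a \<noteq> 1"
    proof -
      have "prime (3::nat)" "3 dvd f" by (simp_all add: f)
      then show ?thesis using \<chi> that unfolding primitive_char_def by blast
    qed
    \<comment> \<open>\<open>x0\<close> and \<open>A.\<eta>\<close> are both fixed by the kernel of
      \<open>\<chi>\<close> and both moved by \<open>a\<close>, so each is a rational polynomial in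
      the other.\<close>
    have "conj_map f a x0 \<noteq> x0" using a C.cubic_index_char(2)[OF f0 x0 a(1)] by (simp add: \<chi>_def)
    then have "A.\<eta> \<in> qadj x0" by (rule fixed_by_ker_in_qadj[OF f0 cub fixed_eta fixed_x0 a(1)])
    moreover have "x0 \<in> qadj A.\<eta>"
      by (rule fixed_by_ker_in_qadj[OF f0 cub fixed_x0 fixed_eta a(1) A.eta_moved[OF a]])
    ultimately have L_eta: "L = qadj A.\<eta>" unfolding Lx by (meson qadj_subset subset_antisym)
    have n1: "(of_int M - 3 * of_int N) / 2 = A.n1" by (simp add: A.n1_def M)
    have n: "A.n1 / of_int N = A.n" by (simp add: A.n_def)
    have "\<forall>\<rho>. rpoly (shanks_poly A.n) \<rho> = 0 \<longrightarrow> L = rat_adjoin \<rho>"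
      using A.rat_adjoin_eta L_eta by metis
    then show ?case
      by (intro exI[of _ M] exI[of _ N] conjI adm) (simp only: Let_def n1 n rpoly_def)
  qed
qed

end
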